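(* Let $V_0>0$ be a constant and let $f:\mathbb{R}\to\mathbb{R}$ be a $C^1$ function satisfying $(f_1)$–$(f_5)$ (with $\theta>2$ from $(f_3)$ and $p>2$, $C_p>0$ from $(f_5)$). Assume $$C_p>\left[\chi_p\frac{2\theta}{\theta-2}\right]^{(p-2)/2},$$ where $\chi_p=\inf_{u\in\mathcal{M}_{B_1(0)}}J_p(u)$, with $$J_p(u)=\frac12\int_{B_1(0)}\big(|\nabla u|^2+V_0|u|^2\big)dx-\frac1p\int_{B_1(0)}|u|^p\,dx,\quad u\in H_0^1(B_1(0)),$$ $$\mathcal{M}_{B_1(0)}=\{u\in H_0^1(B_1(0)):\ u^\pm\neq0,\ J_p'(u^\pm)u^\pm=0\}.$$ Then the autonomous problem $-\Delta u+V_0u=f(u)$ in $\mathbb{R}^2$, $u\in H^1(\mathbb{R}^2)$, does not have a least energy nodal solution; that is, the infimum $\hat c=\inf_{u\in\mathcal{M}}J(u)$ is not attained, where $J(u)=\frac12\int_{\mathbb{R}^2}(|\nabla u|^2+V_0u^2)dx-\int_{\mathbb{R}^2}F(u)dx$ on $H^1(\mathbb{R}^2)$ and $\mathcal{M}=\{u\in H^1(\mathbb{R}^2): u^\pm\neq0,\ J'(u^\pm)u^\pm=0\}$.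
   Context: Hypotheses on $f$: $(f_1)$ there is $C>0$ with $|f(s)|\le Ce^{4\pi s^2}$ for all $s\in\mathbb{R}$; $(f_2)$ $\lim_{s\to0}f(s)/s=0$; $(f_3)$ there is $\theta>2$ with $0<\theta F(s)\le sf(s)$ for all $s\neq0$, where $F(s)=\int_0^sf(t)\,dt$; $(f_4)$ $s\mapsto f(s)/|s|$ is strictly increasing on $(0,+\infty)$; $(f_5)$ there are $p>2$, $C_p>0$ with $\mathrm{sign}(s)f(s)\ge C_p|s|^{p-1}$ for all $s\neq0$. Notation: $u^+=\max\{u,0\}$, $u^-=\min\{u,0\}$. A least energy nodal solution is a $u\in\mathcal{M}$ with $J(u)=\hat c$ and $J'(u)=0$. *)

theory Defs
  imports "HOL-Analysis.Analysis"
begin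

type_synonym R2 = "real ^ 2"

coinductive smooth2 :: "(R2 \<Rightarrow> real) \<Rightarrow> bool" where
  "(\<forall>x. \<phi> differentiable (at x)) \<Longrightarrow>
   (\<forall>v. smooth2 (\<lambda>x. frechet_derivative \<phi> (at x) v)) \<Longrightarrow> smooth2 \<phi>"

definition supp2 :: "(R2 \<Rightarrow> real) \<Rightarrow> R2 set" where
  "supp2 \<phi> = closure {x. \<phi> x \<noteq> 0}"

definition test_fun :: "R2 set \<Rightarrow> (R2 \<Rightarrow> real) \<Rightarrow> bool" where
  "test_fun U \<phi> \<longleftrightarrow> smooth2 \<phi> \<and> compact (supp2 \<phi>) \<and> supp2 \<phi> \<subseteq> U"

definition cgrad :: "(R2 \<Rightarrow> real) \<Rightarrow> R2 \<Rightarrow> R2" where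
  "cgrad \<phi> x = (\<chi> i. frechet_derivative \<phi> (at x) (axis i 1))"

definition has_weak_grad :: "(R2 \<Rightarrow> real) \<Rightarrow> (R2 \<Rightarrow> R2) \<Rightarrow> bool" where
  "has_weak_grad u g \<longleftrightarrow>
     (\<forall>\<phi>. test_fun UNIV \<phi> \<longrightarrow> (\<forall>i.
        (\<integral>x. u x * cgrad \<phi> x $ i \<partial>lebesgue) = - (\<integral>x. g x $ i * \<phi> x \<partial>lebesgue)))"

definition wgrad :: "(R2 \<Rightarrow> real) \<Rightarrow> R2 \<Rightarrow> R2" where
  "wgrad u = (SOME g. g \<in> borel_measurable lebesgue \<and> has_weak_grad u g)"

definition H1 :: "(R2 \<Rightarrow> real) set" where
  "H1 = {u. u \<in> borel_measurable lebesgue \<and> integrable lebesgue (\<lambda>x. (u x)\<^sup>2) \<and>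
            (\<exists>g. g \<in> borel_measurable lebesgue \<and> has_weak_grad u g \<and>
                 integrable lebesgue (\<lambda>x. (norm (g x))\<^sup>2))}"

text \<open>H^1_0(U): closure of C_c^infinity(U) in the H^1 norm (functions extended by zero).\<close>
definition H01 :: "R2 set \<Rightarrow> (R2 \<Rightarrow> real) set" where
  "H01 U = {u \<in> H1. \<exists>\<phi>. (\<forall>n. test_fun U (\<phi> n)) \<and>
      (\<lambda>n. (\<integral>x. (\<phi> n x - u x)\<^sup>2 \<partial>lebesgue)
            + (\<integral>x. (norm (cgrad (\<phi> n) x - wgrad u x))\<^sup>2 \<partial>lebesgue)) \<longlonglongrightarrow> 0}"

definition pos_part :: "(R2 \<Rightarrow> real) \<Rightarrow> R2 \<Rightarrow> real" where
  "pos_part u = (\<lambda>x. max (u x) 0)"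

definition neg_part :: "(R2 \<Rightarrow> real) \<Rightarrow> R2 \<Rightarrow> real" where
  "neg_part u = (\<lambda>x. min (u x) 0)"

definition nonzero :: "(R2 \<Rightarrow> real) \<Rightarrow> bool" where
  "nonzero u \<longleftrightarrow> \<not> (AE x in lebesgue. u x = 0)"

definition Fprim :: "(real \<Rightarrow> real) \<Rightarrow> real \<Rightarrow> real" where
  "Fprim f s = (if 0 \<le> s then integral {0..s} f else - integral {s..0} f)"

definition Jfun :: "real \<Rightarrow> (real \<Rightarrow> real) \<Rightarrow> (R2 \<Rightarrow> real) \<Rightarrow> real" where
  "Jfun V0 f u = 1/2 * (\<integral>x. (norm (wgrad u x))\<^sup>2 + V0 * (u x)\<^sup>2 \<partial>lebesgue)
                 - (\<integral>x. Fprim f (u x) \<partial>lebesgue)"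

definition dJ :: "real \<Rightarrow> (real \<Rightarrow> real) \<Rightarrow> (R2 \<Rightarrow> real) \<Rightarrow> (R2 \<Rightarrow> real) \<Rightarrow> real" where
  "dJ V0 f u v = (\<integral>x. wgrad u x \<bullet> wgrad v x + V0 * u x * v x \<partial>lebesgue)
                 - (\<integral>x. f (u x) * v x \<partial>lebesgue)"

definition Mset :: "real \<Rightarrow> (real \<Rightarrow> real) \<Rightarrow> (R2 \<Rightarrow> real) set" where
  "Mset V0 f = {u \<in> H1. nonzero (pos_part u) \<and> nonzero (neg_part u) \<and>
                  dJ V0 f (pos_part u) (pos_part u) = 0 \<and> dJ V0 f (neg_part u) (neg_part u) = 0}"

definition c_hat :: "real \<Rightarrow> (real \<Rightarrow> real) \<Rightarrow> real" where
  "c_hat V0 f = Inf (Jfun V0 f ` Mset V0 f)"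

definition least_energy_nodal_solution :: "real \<Rightarrow> (real \<Rightarrow> real) \<Rightarrow> (R2 \<Rightarrow> real) \<Rightarrow> bool" where
  "least_energy_nodal_solution V0 f u \<longleftrightarrow>
     u \<in> Mset V0 f \<and> Jfun V0 f u = c_hat V0 f \<and> (\<forall>v\<in>H1. dJ V0 f u v = 0)"

definition Jp :: "real \<Rightarrow> real \<Rightarrow> (R2 \<Rightarrow> real) \<Rightarrow> real" where
  "Jp V0 p u = 1/2 * (\<integral>x\<in>ball 0 1. (norm (wgrad u x))\<^sup>2 + V0 * (u x)\<^sup>2 \<partial>lebesgue)
               - 1/p * (\<integral>x\<in>ball 0 1. \<bar>u x\<bar> powr p \<partial>lebesgue)"

definition dJp :: "real \<Rightarrow> real \<Rightarrow> (R2 \<Rightarrow> real) \<Rightarrow> (R2 \<Rightarrow> real) \<Rightarrow> real" where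
  "dJp V0 p u v = (\<integral>x\<in>ball 0 1. wgrad u x \<bullet> wgrad v x + V0 * u x * v x \<partial>lebesgue)
                  - (\<integral>x\<in>ball 0 1. \<bar>u x\<bar> powr (p - 2) * u x * v x \<partial>lebesgue)"

definition M_ball :: "real \<Rightarrow> real \<Rightarrow> (R2 \<Rightarrow> real) set" where
  "M_ball V0 p = {u \<in> H01 (ball 0 1). nonzero (pos_part u) \<and> nonzero (neg_part u) \<and>
       dJp V0 p (pos_part u) (pos_part u) = 0 \<and> dJp V0 p (neg_part u) (neg_part u) = 0}"

definition chi_p :: "real \<Rightarrow> real \<Rightarrow> real" where
  "chi_p V0 p = Inf (Jp V0 p ` M_ball V0 p)"

end

theory Submission
  imports Defs
begin

text \<open>Suppose that \<open>u\<close> attains the infimum. In the plane the dilation \<open>v (\<lambda> x)\<close> leaves the Dirichlet integral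
  \<open>A\<close> invariant and divides \<open>B = \<integral> V\<^sub>0 v\<^sup>2 - f (v) v\<close> (\<open>zero_order_deriv\<close>) and
  \<open>Q = \<integral> V\<^sub>0 v\<^sup>2 / 2 - F (v)\<close> (\<open>zero_order_energy\<close>) by \<open>\<lambda>\<^sup>2\<close>, so every \<open>v\<close> with \<open>B < 0\<close> has a dilate
  on the Nehari manifold, and its energy is \<open>\<Psi> (v) = A/2 - Q A / B\<close> (\<open>dilation_energy\<close>).
  Cutting off to opposite half-planes and dilating shows that \<open>\<Psi> (v) + \<Psi> (m)\<close> is at least the infimum
  for all \<open>v \<ge> 0 \<ge> m\<close>; hence \<open>w = u\<^sup>+\<close> minimizes \<open>\<Psi>\<close> among nonnegative functions, without any constraint.
  The first variation in directions supported where \<open>w < 1\<close> makes \<open>w\<close> a supersolution there, and testing with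
  \<open>\<phi> (1 - w)\<^sub>+\<^sup>2 / (w + d)\<close> bounds the gradient of essentially \<open>log (w + d)\<close> in \<open>L\<^sup>2\<close> locally, uniformly in
  \<open>d\<close>. Comparing \<open>w\<close> with its translates, one sees that \<open>w\<close> cannot vanish on a set of positive measure unless
  it vanishes identically. But \<open>w = 0\<close> where \<open>u < 0\<close>.\<close>

subsection \<open>Square integrable functions\<close>

definition square_integrable :: "'a measure \<Rightarrow> ('a \<Rightarrow> 'b::real_normed_vector) \<Rightarrow> bool" where
  "square_integrable M f \<longleftrightarrow> f \<in> borel_measurable M \<and> integrable M (\<lambda>x. (norm (f x))\<^sup>2)"

lemma square_integrable_measurable: "square_integrable M f \<Longrightarrow> f \<in> borel_measurable M"
  by (simp add: square_integrable_def)

lemma square_integrable_lborel_measurable: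
  "square_integrable lborel f \<Longrightarrow> f \<in> borel_measurable borel"
  by (simp add: square_integrable_def)

lemma integrable_norm_power2: "square_integrable M f \<Longrightarrow> integrable M (\<lambda>x. (norm (f x))\<^sup>2)"
  by (simp add: square_integrable_def)

lemma integrable_power2:
  fixes f :: "'a \<Rightarrow> real"
  shows "square_integrable M f \<Longrightarrow> integrable M (\<lambda>x. (f x)\<^sup>2)"
  by (simp add: square_integrable_def)

lemma square_integrable_dominated:
  assumes u: "square_integrable M u" and v [measurable]: "v \<in> borel_measurable M"
    and bound: "\<And>x. norm (v x) \<le> c * norm (u x)"
  shows "square_integrable M v"
  unfolding square_integrable_def
proof
  show "integrable M (\<lambda>x. (norm (v x))\<^sup>2)"
  proof (rule Bochner_Integration.integrable_bound)
    show "integrable M (\<lambda>x. c\<^sup>2 * (norm (u x))\<^sup>2)" using integrable_norm_power2[OF u] by simp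
    have "(norm (v x))\<^sup>2 \<le> c\<^sup>2 * (norm (u x))\<^sup>2" for x
      using power_mono[OF bound norm_ge_zero, of x 2] by (simp add: power_mult_distrib)
    then show "AE x in M. norm ((norm (v x))\<^sup>2) \<le> norm (c\<^sup>2 * (norm (u x))\<^sup>2)" by simp
  qed measurable
qed (rule v)

lemma square_integrable_norm:
  fixes f :: "'a \<Rightarrow> 'b::{real_normed_vector, second_countable_topology}"
  shows "square_integrable M f \<Longrightarrow> square_integrable M (\<lambda>x. norm (f x))"
  by (rule square_integrable_dominated[of _ f _ 1]) (auto dest: square_integrable_measurable)

lemma norm_add_power2_le:
  fixes a b :: "'a::real_normed_vector"
  shows "(norm (a + b))\<^sup>2 \<le> 2 * (norm a)\<^sup>2 + 2 * (norm b)\<^sup>2"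
proof -
  have "(norm (a + b))\<^sup>2 \<le> (norm a + norm b)\<^sup>2" by (intro power_mono norm_triangle_ineq) auto
  also have "\<dots> \<le> 2 * (norm a)\<^sup>2 + 2 * (norm b)\<^sup>2"
    using sum_squares_bound[of "norm a" "norm b"] by (simp add: power2_sum)
  finally show ?thesis .
qed

lemma square_integrable_add:
  fixes u v :: "'a \<Rightarrow> 'b::{real_normed_vector, second_countable_topology}"
  assumes u: "square_integrable M u" and v: "square_integrable M v"
  shows "square_integrable M (\<lambda>x. u x + v x)"
  unfolding square_integrable_def
proof
  note [measurable] = square_integrable_measurable[OF u] square_integrable_measurable[OF v]
  show "(\<lambda>x. u x + v x) \<in> borel_measurable M" by measurable
  show "integrable M (\<lambda>x. (norm (u x + v x))\<^sup>2)"
  proof (rule Bochner_Integration.integrable_bound)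
    show "integrable M (\<lambda>x. 2 * (norm (u x))\<^sup>2 + 2 * (norm (v x))\<^sup>2)"
      using integrable_norm_power2[OF u] integrable_norm_power2[OF v] by simp
    show "AE x in M. norm ((norm (u x + v x))\<^sup>2) \<le> norm (2 * (norm (u x))\<^sup>2 + 2 * (norm (v x))\<^sup>2)"
      using norm_add_power2_le by (intro AE_I2) (simp add: abs_of_nonneg)
  qed measurable
qed

lemma square_integrable_bounded_scaleR:
  fixes u :: "'a \<Rightarrow> 'b::{real_normed_vector, second_countable_topology}"
  assumes u: "square_integrable M u" and [measurable]: "\<phi> \<in> borel_measurable M"
    and bound: "\<And>x. \<bar>\<phi> x\<bar> \<le> c"
  shows "square_integrable M (\<lambda>x. \<phi> x *\<^sub>R u x)"
proof (rule square_integrable_dominated[OF u])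
  note [measurable] = square_integrable_measurable[OF u]
  show "(\<lambda>x. \<phi> x *\<^sub>R u x) \<in> borel_measurable M" by measurable
  show "norm (\<phi> x *\<^sub>R u x) \<le> c * norm (u x)" for x using bound by (simp add: mult_right_mono)
qed

lemma square_integrable_scaleR:
  fixes u :: "'a \<Rightarrow> 'b::{real_normed_vector, second_countable_topology}"
  shows "square_integrable M u \<Longrightarrow> square_integrable M (\<lambda>x. c *\<^sub>R u x)"
  by (rule square_integrable_bounded_scaleR) auto

lemma integrable_mult_square_integrable:
  fixes u v :: "'a \<Rightarrow> real"
  assumes u: "square_integrable M u" and v: "square_integrable M v"
  shows "integrable M (\<lambda>x. u x * v x)"
proof (rule Bochner_Integration.integrable_bound)
  note [measurable] = square_integrable_measurable[OF u] square_integrable_measurable[OF v]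
  show "integrable M (\<lambda>x. (u x)\<^sup>2 + (v x)\<^sup>2)" using integrable_power2[OF u] integrable_power2[OF v] by simp
  have "\<bar>u x * v x\<bar> \<le> (u x)\<^sup>2 + (v x)\<^sup>2" for x
    using sum_squares_bound[of "\<bar>u x\<bar>" "\<bar>v x\<bar>"] abs_ge_zero[of "u x * v x"] unfolding abs_mult power2_abs
    by linarith
  then show "AE x in M. norm (u x * v x) \<le> norm ((u x)\<^sup>2 + (v x)\<^sup>2)" by simp
  show "(\<lambda>x. u x * v x) \<in> borel_measurable M" by measurable
qed

lemma integrable_inner_square_integrable:
  fixes g h :: "'a \<Rightarrow> 'b::{real_inner, second_countable_topology}"
  assumes g: "square_integrable M g" and h: "square_integrable M h"
  shows "integrable M (\<lambda>x. g x \<bullet> h x)"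
proof (rule Bochner_Integration.integrable_bound)
  note [measurable] = square_integrable_measurable[OF g] square_integrable_measurable[OF h]
  show "integrable M (\<lambda>x. norm (g x) * norm (h x))"
    using g h by (intro integrable_mult_square_integrable) (auto simp: square_integrable_def)
  show "AE x in M. norm (g x \<bullet> h x) \<le> norm (norm (g x) * norm (h x))"
    using Cauchy_Schwarz_ineq2 by (intro AE_I2) simp
  show "(\<lambda>x. g x \<bullet> h x) \<in> borel_measurable M" by measurable
qed

lemma square_integrable_cong_AE:
  fixes u v :: "'a \<Rightarrow> 'b::{real_normed_vector, second_countable_topology}"
  assumes u: "square_integrable M u" and [measurable]: "v \<in> borel_measurable M" and eq: "AE x in M. u x = v x"
  shows "square_integrable M v"
  unfolding square_integrable_def
proof
  show "integrable M (\<lambda>x. (norm (v x))\<^sup>2)"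
    by (rule integrable_cong_AE_imp[OF integrable_norm_power2[OF u]]) (use eq in auto)
qed fact

lemma square_integrable_completion_iff:
  "f \<in> borel_measurable M \<Longrightarrow> square_integrable (completion M) f \<longleftrightarrow> square_integrable M f"
  by (simp add: square_integrable_def measurable_completion integrable_completion)

lemma square_integrable_lborel_imp_lebesgue:
  "square_integrable lborel f \<Longrightarrow> square_integrable lebesgue f"
  using square_integrable_completion_iff square_integrable_measurable by blast

lemma borel_measurable_vec_nth [measurable (raw)]:
  fixes g :: "'a \<Rightarrow> real ^ 'n"
  shows "g \<in> borel_measurable M \<Longrightarrow> (\<lambda>x. g x $ i) \<in> borel_measurable M"
  by (rule measurable_compose[OF _ borel_measurable_continuous_onI]) (auto intro!: continuous_intros)

lemma square_integrable_vec_nth: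
  fixes g :: "'a \<Rightarrow> real ^ 'n"
  assumes g: "square_integrable M g"
  shows "square_integrable M (\<lambda>x. g x $ i)"
  by (rule square_integrable_dominated[OF g, of _ 1])
    (use square_integrable_measurable[OF g] component_le_norm_cart[of "g _" i] in auto)

lemma integral_power2_pos:
  assumes f: "square_integrable M f" and nz: "\<not> (AE x in M. f x = 0)"
  shows "0 < (\<integral>x. (norm (f x))\<^sup>2 \<partial>M)"
proof -
  have "(\<integral>x. (norm (f x))\<^sup>2 \<partial>M) \<noteq> 0"
    using nz integral_nonneg_eq_0_iff_AE[OF integrable_norm_power2[OF f]] by simp
  moreover have "0 \<le> (\<integral>x. (norm (f x))\<^sup>2 \<partial>M)" by simp
  ultimately show ?thesis by linarith
qed

subsection \<open>Measurability up to null sets and exhaustion by boxes\<close>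

lemma borel_measurable_lebesgueI: "f \<in> borel_measurable borel \<Longrightarrow> f \<in> borel_measurable lebesgue"
  by (simp add: measurable_completion)

lemma ex_borel_representative:
  fixes f :: "'a::euclidean_space \<Rightarrow> 'b::euclidean_space"
  assumes f: "f \<in> borel_measurable lebesgue"
  obtains f' where "f' \<in> borel_measurable borel" "AE x in lborel. f x = f' x"
proof -
  have "\<forall>i\<in>Basis. \<exists>h. h \<in> borel_measurable borel \<and> (AE x in lborel. f x \<bullet> i = h x)"
    using completion_ex_borel_measurable_real borel_measurable_inner[OF f borel_measurable_const] by fastforce
  then obtain h where h: "\<And>i. i \<in> Basis \<Longrightarrow> h i \<in> borel_measurable borel"
    "\<And>i. i \<in> Basis \<Longrightarrow> AE x in lborel. f x \<bullet> i = h i x"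
    by metis
  show ?thesis
  proof
    show "(\<lambda>x. \<Sum>i\<in>Basis. h i x *\<^sub>R i) \<in> borel_measurable borel"
      using h(1) by (intro borel_measurable_sum borel_measurable_scaleR) auto
    have "AE x in lborel. \<forall>i\<in>Basis. f x \<bullet> i = h i x" using h(2) by (intro AE_finite_allI) auto
    then show "AE x in lborel. f x = (\<Sum>i\<in>Basis. h i x *\<^sub>R i)"
      by eventually_elim (metis (no_types, lifting) euclidean_representation sum.cong)
  qed
qed

lemma AE_of_countable_cover:
  assumes "\<And>n::nat. AE x in M. x \<in> A n \<longrightarrow> P x" and "(\<Union>n. A n) = UNIV"
  shows "AE x in M. P x"
proof -
  have "AE x in M. \<forall>n. x \<in> A n \<longrightarrow> P x" unfolding AE_all_countable using assms(1) by blast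
  then show ?thesis by eventually_elim (use assms(2) in blast)
qed

lemma emeasure_incseq_eventually_pos:
  assumes A: "\<And>n. A n \<in> sets M" "incseq A" and pos: "\<not> (AE x in M. x \<notin> (\<Union>n. A n))"
  shows "\<forall>\<^sub>F n in sequentially. 0 < emeasure M (A n)"
proof -
  have "emeasure M (\<Union>n. A n) \<noteq> 0"
  proof
    assume "emeasure M (\<Union>n. A n) = 0"
    then have "(\<Union>n. A n) \<in> null_sets M" using A(1) by (intro null_setsI) auto
    from AE_not_in[OF this] pos show False by simp
  qed
  then have "0 < emeasure M (\<Union>n. A n)" by (simp add: zero_less_iff_neq_zero)
  moreover have "(\<lambda>n. emeasure M (A n)) \<longlonglongrightarrow> emeasure M (\<Union>n. A n)"
    using A by (intro Lim_emeasure_incseq) auto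
  ultimately show ?thesis by (rule order_tendstoD(1)[rotated])
qed

definition centred_box :: "nat \<Rightarrow> 'a::euclidean_space set" where
  "centred_box n = box (- (real n *\<^sub>R One)) (real n *\<^sub>R One)"

lemma centred_box_borel [measurable]: "centred_box n \<in> sets borel"
  by (simp add: centred_box_def)

lemma centred_box_mono: "m \<le> n \<Longrightarrow> centred_box m \<subseteq> centred_box n"
  unfolding centred_box_def by (intro subset_box_imp) (auto simp: inner_Basis)

lemma UN_centred_box: "(\<Union>n. centred_box n) = UNIV"
  using UN_box_eq_UNIV by (simp add: centred_box_def)

lemma set_integral_eq_0_of_boxes:
  fixes h :: "'a::euclidean_space \<Rightarrow> 'b::{banach, second_countable_topology}"
  assumes h: "integrable lborel h" and box: "\<And>a b. (LINT x:box a b|lborel. h x) = 0"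
    and A: "A \<in> sets borel"
  shows "(LINT x:A|lborel. h x) = 0"
proof -
  have set_integrable: "set_integrable lborel A h" if "A \<in> sets borel" for A
    unfolding set_integrable_def using integrable_mult_indicator[OF _ h, of A] that by simp
  have "(\<lambda>n. LINT x:centred_box n|lborel. h x) \<longlonglongrightarrow> (LINT x:(\<Union>n. centred_box n)|lborel. h x)"
    by (rule set_integral_cont_up) (use set_integrable centred_box_mono in \<open>auto simp: incseq_def UN_centred_box\<close>)
  then have whole_space: "(LINT x|lborel. h x) = 0"
    using box
    by (simp add: centred_box_def UN_centred_box[unfolded centred_box_def] set_lebesgue_integral_def LIMSEQ_const_iff)
  have "Int_stable (range (\<lambda>(a, b). box a b :: 'a set))"
    by (auto simp: Int_stable_def box_Int_box)
  moreover have "range (\<lambda>(a, b). box a b :: 'a set) \<subseteq> Pow UNIV" by simp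
  moreover have sets_borel: "sets borel = sigma_sets UNIV (range (\<lambda>(a, b). box a b :: 'a set))"
    by (simp add: borel_eq_box)
  then have "A \<in> sigma_sets UNIV (range (\<lambda>(a, b). box a b))" using A by simp
  ultimately show ?thesis
  proof (induction rule: sigma_sets_induct_disjoint)
    case (compl A)
    have "(LINT x:UNIV - A|lborel. h x) = (LINT x|lborel. h x - indicator A x *\<^sub>R h x)"
      unfolding set_lebesgue_integral_def
      by (intro Bochner_Integration.integral_cong) (auto split: split_indicator)
    also have "\<dots> = 0"
      using whole_space compl set_integrable[of A] h sets_borel
      by (simp add: set_lebesgue_integral_def set_integrable_def)
    finally show ?case .
  next
    case (union A)
    then have A_borel: "A i \<in> sets borel" for i by (auto simp: sets_borel)
    then have "(\<Union>i. A i) \<in> sets borel" by auto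
    with A_borel have "(LINT x:(\<Union>i. A i)|lborel. h x) = (\<Sum>i. (LINT x:(A i)|lborel. h x))"
      by (intro lebesgue_integral_countable_add set_integrable)
        (use union(1) in \<open>auto simp: disjoint_family_on_def\<close>)
    then show ?case using union by simp
  qed (use box in \<open>auto simp: set_lebesgue_integral_def\<close>)
qed

lemma AE_eq_0_of_box_integrals:
  fixes h :: "'a::euclidean_space \<Rightarrow> 'b::{banach, second_countable_topology}"
  assumes "integrable lborel h" "\<And>a b. (LINT x:box a b|lborel. h x) = 0"
  shows "AE x in lborel. h x = 0"
  using assms set_integral_eq_0_of_boxes[OF assms]
  by (intro sigma_finite_measure.density_zero[OF sigma_finite_lborel]) auto

subsection \<open>Translations, shears and dilations of Lebesgue measure\<close>

lemma nn_integral_lborel_translate: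
  fixes f :: "'a::euclidean_space \<Rightarrow> ennreal"
  assumes [measurable]: "f \<in> borel_measurable borel"
  shows "(\<integral>\<^sup>+x. f (x + a) \<partial>lborel) = (\<integral>\<^sup>+x. f x \<partial>lborel)"
proof -
  have "(\<integral>\<^sup>+x. f x \<partial>lborel) = (\<integral>\<^sup>+x. f x \<partial>distr lborel borel ((+) a))" by (simp add: lborel_distr_plus)
  also have "\<dots> = (\<integral>\<^sup>+x. f (a + x) \<partial>lborel)" by (rule nn_integral_distr) auto
  finally show ?thesis by (simp add: add.commute)
qed

lemma integrable_lborel_translate:
  fixes f :: "'a::euclidean_space \<Rightarrow> 'b::{banach, second_countable_topology}"
  assumes f: "integrable lborel f"
  shows "integrable lborel (\<lambda>x. f (x + a))"
proof -
  have "integrable (distr lborel borel ((+) a)) f" using f by (simp add: lborel_distr_plus)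
  then have "integrable lborel (\<lambda>x. f (a + x))" by (rule integrable_distr[rotated]) auto
  then show ?thesis by (simp add: add.commute)
qed

lemma integral_lborel_translate:
  fixes f :: "'a::euclidean_space \<Rightarrow> 'b::{banach, second_countable_topology}"
  shows "(\<integral>x. f (x + a) \<partial>lborel) = (\<integral>x. f x \<partial>lborel)"
proof (cases "integrable lborel f")
  case True
  then have "(\<integral>x. f x \<partial>distr lborel borel ((+) a)) = (\<integral>x. f (a + x) \<partial>lborel)"
    by (intro integral_distr) auto
  then show ?thesis by (simp add: lborel_distr_plus add.commute)
next
  case False
  then have "\<not> integrable lborel (\<lambda>x. f (x + a))"
    using integrable_lborel_translate[of "\<lambda>x. f (x + a)" "- a"] by auto
  with False show ?thesis by (simp add: not_integrable_integral_eq)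
qed

lemma square_integrable_translate:
  fixes u :: "'a::euclidean_space \<Rightarrow> 'b::{real_normed_vector, second_countable_topology}"
  assumes u: "square_integrable lborel u"
  shows "square_integrable lborel (\<lambda>x. u (x + a))"
proof -
  note [measurable] = square_integrable_lborel_measurable[OF u]
  show ?thesis
    using integrable_lborel_translate[OF integrable_norm_power2[OF u], of a] by (simp add: square_integrable_def)
qed

lemma integral_lborel_translate_mult:
  fixes u v :: "'a::euclidean_space \<Rightarrow> real"
  shows "(\<integral>x. u (x + a) * v x \<partial>lborel) = (\<integral>x. u x * v (x - a) \<partial>lborel)"
  using integral_lborel_translate[of "\<lambda>x. u x * v (x - a)" a] by simp

lemma (in pair_sigma_finite) integrable_mult_pair_measure:
  fixes a :: "'a \<Rightarrow> real" and b :: "'b \<Rightarrow> real"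
  assumes a: "integrable M1 a" and b: "integrable M2 b"
  shows "integrable (M1 \<Otimes>\<^sub>M M2) (\<lambda>(x, y). a x * b y)"
proof (rule Fubini_integrable)
  note [measurable] = borel_measurable_integrable[OF a] borel_measurable_integrable[OF b]
  show "(\<lambda>(x, y). a x * b y) \<in> borel_measurable (M1 \<Otimes>\<^sub>M M2)" by measurable
  show "integrable M1 (\<lambda>x. \<integral>y. norm (case (x, y) of (x, y) \<Rightarrow> a x * b y) \<partial>M2)"
    using a by (simp add: abs_mult)
  show "AE x in M1. integrable M2 (\<lambda>y. case (x, y) of (x, y) \<Rightarrow> a x * b y)"
    using b by simp
qed

lemma shear_measurable [measurable]:
  fixes e :: "'a::euclidean_space"
  shows "(\<lambda>(x, s). (x + s *\<^sub>R e, s)) \<in> (lborel \<Otimes>\<^sub>M lborel) \<rightarrow>\<^sub>M (lborel \<Otimes>\<^sub>M lborel)"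
  by measurable

lemma distr_shear:
  fixes e :: "'a::euclidean_space"
  shows "distr (lborel \<Otimes>\<^sub>M lborel) (lborel \<Otimes>\<^sub>M lborel) (\<lambda>(x, s). (x + s *\<^sub>R e, s)) = lborel \<Otimes>\<^sub>M lborel"
    (is "distr ?P ?P ?T = ?P")
proof (rule measure_eqI)
  fix A assume "A \<in> sets (distr ?P ?P ?T)"
  then have A [measurable]: "A \<in> sets ?P" by simp
  have "emeasure (distr ?P ?P ?T) A = (\<integral>\<^sup>+z. indicator A z \<partial>distr ?P ?P ?T)"
    by (rule nn_integral_indicator[symmetric]) (use A in simp)
  also have "\<dots> = (\<integral>\<^sup>+z. indicator A (?T z) \<partial>?P)"
    by (rule nn_integral_distr) measurable
  also have "\<dots> = (\<integral>\<^sup>+s. \<integral>\<^sup>+x. indicator A (x + s *\<^sub>R e, s) \<partial>lborel \<partial>lborel)"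
    by (subst lborel_pair.nn_integral_snd[symmetric]) (auto simp: case_prod_beta)
  also have "\<dots> = (\<integral>\<^sup>+s. \<integral>\<^sup>+x. indicator A (x, s) \<partial>lborel \<partial>lborel)"
    by (intro nn_integral_cong nn_integral_lborel_translate) measurable
  also have "\<dots> = (\<integral>\<^sup>+z. indicator A z \<partial>?P)"
    by (subst lborel_pair.nn_integral_snd[symmetric]) (auto simp: case_prod_beta)
  also have "\<dots> = emeasure ?P A" by (rule nn_integral_indicator) (rule A)
  finally show "emeasure (distr ?P ?P ?T) A = emeasure ?P A" .
qed simp

lemma
  fixes h :: "'a::euclidean_space \<times> real \<Rightarrow> 'b::{banach, second_countable_topology}"
  assumes h: "integrable (lborel \<Otimes>\<^sub>M lborel) h"
  shows integrable_shear: "integrable (lborel \<Otimes>\<^sub>M lborel) (\<lambda>(x, s). h (x + s *\<^sub>R e, s))"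
    and integral_shear: "(\<integral>(x, s). h (x + s *\<^sub>R e, s) \<partial>(lborel \<Otimes>\<^sub>M lborel)) = (\<integral>z. h z \<partial>(lborel \<Otimes>\<^sub>M lborel))"
proof -
  let ?P = "lborel \<Otimes>\<^sub>M lborel :: ('a \<times> real) measure" and ?T = "\<lambda>(x, s). (x + s *\<^sub>R e, s)"
  have "integrable (distr ?P ?P ?T) h" using h by (simp add: distr_shear)
  then show "integrable ?P (\<lambda>(x, s). h (x + s *\<^sub>R e, s))"
    using integrable_distr[OF shear_measurable, where f = h and e1 = e] by (simp add: case_prod_beta')
  have "(\<integral>z. h z \<partial>distr ?P ?P ?T) = (\<integral>z. h (?T z) \<partial>?P)"
    by (rule integral_distr) (use h in auto)
  then show "(\<integral>(x, s). h (x + s *\<^sub>R e, s) \<partial>?P) = (\<integral>z. h z \<partial>?P)"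
    unfolding distr_shear by (simp add: case_prod_beta')
qed

lemma
  fixes a :: "'a::euclidean_space"
  assumes l: "l \<noteq> 0"
  shows lebesgue_measurable_dilation: "(\<lambda>x. a + l *\<^sub>R x) \<in> lebesgue \<rightarrow>\<^sub>M lebesgue"
    and lebesgue_eq_density_dilation:
      "lebesgue = density (distr lebesgue lebesgue (\<lambda>x. a + l *\<^sub>R x)) (\<lambda>_. ennreal (\<bar>l\<bar> ^ DIM('a)))"
proof -
  have eq: "(\<lambda>x. a + (\<Sum>j\<in>Basis. (l * (x \<bullet> j)) *\<^sub>R j)) = (\<lambda>x. a + l *\<^sub>R x)"
    unfolding scaleR_scaleR[symmetric] scaleR_sum_right[symmetric] euclidean_representation ..
  show "(\<lambda>x. a + l *\<^sub>R x) \<in> lebesgue \<rightarrow>\<^sub>M lebesgue"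
    using lebesgue_affine_measurable[of "\<lambda>_. l" a] l unfolding eq by simp
  show "lebesgue = density (distr lebesgue lebesgue (\<lambda>x. a + l *\<^sub>R x)) (\<lambda>_. ennreal (\<bar>l\<bar> ^ DIM('a)))"
    using lebesgue_affine_euclidean[of "\<lambda>_. l" a] l unfolding eq by simp
qed

lemma
  fixes f :: "'a::euclidean_space \<Rightarrow> 'b::{banach, second_countable_topology}"
  assumes l: "l \<noteq> 0" and f [measurable]: "f \<in> borel_measurable lebesgue"
  shows integrable_dilation_iff: "integrable lebesgue (\<lambda>x. f (a + l *\<^sub>R x)) \<longleftrightarrow> integrable lebesgue f"
    and integral_dilation: "(\<integral>x. f (a + l *\<^sub>R x) \<partial>lebesgue) = (\<integral>x. f x \<partial>lebesgue) /\<^sub>R \<bar>l\<bar> ^ DIM('a)"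
proof -
  let ?T = "\<lambda>x. a + l *\<^sub>R x" and ?D = "\<bar>l\<bar> ^ DIM('a)"
  note T [measurable] = lebesgue_measurable_dilation[OF l, of a]
  note density = lebesgue_eq_density_dilation[OF l, of a]
  have "integrable lebesgue f \<longleftrightarrow> integrable (density (distr lebesgue lebesgue ?T) (\<lambda>_. ennreal ?D)) f"
    using density by simp
  also have "\<dots> \<longleftrightarrow> integrable (distr lebesgue lebesgue ?T) (\<lambda>x. ?D *\<^sub>R f x)"
    by (rule integrable_density) auto
  also have "\<dots> \<longleftrightarrow> integrable lebesgue (\<lambda>x. ?D *\<^sub>R f (?T x))" by (rule integrable_distr_eq) auto
  also have "\<dots> \<longleftrightarrow> integrable lebesgue (\<lambda>x. f (?T x))"
    using l integrable_scaleR_right[of "1 / ?D" lebesgue "\<lambda>x. ?D *\<^sub>R f (?T x)"] by auto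
  finally show "integrable lebesgue (\<lambda>x. f (a + l *\<^sub>R x)) \<longleftrightarrow> integrable lebesgue f" ..
  have "(\<integral>x. f x \<partial>lebesgue) = (\<integral>x. f x \<partial>density (distr lebesgue lebesgue ?T) (\<lambda>_. ennreal ?D))"
    using density by simp
  also have "\<dots> = (\<integral>x. ?D *\<^sub>R f x \<partial>distr lebesgue lebesgue ?T)"
    by (rule integral_density) auto
  also have "\<dots> = (\<integral>x. ?D *\<^sub>R f (?T x) \<partial>lebesgue)" by (rule integral_distr) auto
  finally show "(\<integral>x. f (a + l *\<^sub>R x) \<partial>lebesgue) = (\<integral>x. f x \<partial>lebesgue) /\<^sub>R ?D" using l by simp
qed

lemma AE_lborel_not_hyperplane: "AE x :: real ^ 'n in lborel. x $ i \<noteq> c"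
proof -
  have "negligible {x :: real ^ 'n. x $ i = c}"
    using negligible_standard_hyperplane[of "axis i 1 :: real ^ 'n" c] by (simp add: inner_axis axis_in_Basis_iff)
  then have "{x :: real ^ 'n. x $ i = c} \<in> null_sets lebesgue" by (simp add: negligible_iff_null_sets)
  then have "AE x :: real ^ 'n in lebesgue. x \<notin> {x. x $ i = c}" by (rule AE_not_in)
  then show ?thesis by (simp add: AE_completion_iff)
qed

lemma ex_translate_overlap_pos:
  fixes Z P :: "'a::euclidean_space set"
  assumes [measurable]: "Z \<in> sets borel" "P \<in> sets borel" and pos: "0 < emeasure lborel Z" "0 < emeasure lborel P"
  shows "\<exists>a. 0 < emeasure lborel {x \<in> Z. x + a \<in> P}"
proof -
  have "(\<integral>\<^sup>+a. emeasure lborel {x \<in> Z. x + a \<in> P} \<partial>lborel) =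
      (\<integral>\<^sup>+a. \<integral>\<^sup>+x. indicator Z x * indicator P (x + a) \<partial>lborel \<partial>lborel)"
  proof (rule nn_integral_cong)
    fix a :: 'a
    have "emeasure lborel {x \<in> Z. x + a \<in> P} = (\<integral>\<^sup>+x. indicator {x \<in> Z. x + a \<in> P} x \<partial>lborel)"
      by (rule nn_integral_indicator[symmetric]) simp
    also have "\<dots> = (\<integral>\<^sup>+x. indicator Z x * indicator P (x + a) \<partial>lborel)"
      by (intro nn_integral_cong) (auto split: split_indicator)
    finally show "emeasure lborel {x \<in> Z. x + a \<in> P} = (\<integral>\<^sup>+x. indicator Z x * indicator P (x + a) \<partial>lborel)" .
  qed
  also have "\<dots> = (\<integral>\<^sup>+x. \<integral>\<^sup>+a. indicator Z x * indicator P (x + a) \<partial>lborel \<partial>lborel)"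
    by (rule lborel_pair.Fubini') measurable
  also have "\<dots> = (\<integral>\<^sup>+x. indicator Z x * (\<integral>\<^sup>+a. indicator P (a + x) \<partial>lborel) \<partial>lborel)"
    by (subst nn_integral_cmult) (auto simp: add.commute)
  also have "\<dots> = (\<integral>\<^sup>+x. emeasure lborel P * indicator Z x \<partial>lborel)"
    by (subst nn_integral_lborel_translate) (auto simp: mult.commute)
  also have "\<dots> = emeasure lborel P * emeasure lborel Z" by (simp add: nn_integral_cmult_indicator)
  finally have pos_average: "(\<integral>\<^sup>+a. emeasure lborel {x \<in> Z. x + a \<in> P} \<partial>lborel) \<noteq> 0"
    using pos by (simp add: zero_less_iff_neq_zero)
  show ?thesis
  proof (rule ccontr)
    assume "\<not> ?thesis"
    then have "(\<lambda>a. emeasure lborel {x \<in> Z. x + a \<in> P}) = (\<lambda>a. 0)" by (simp add: zero_less_iff_neq_zero)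
    with pos_average show False by simp
  qed
qed

lemma integral_mult_indicator_escaping_ball_tendsto:
  fixes h :: "'a::euclidean_space \<Rightarrow> real"
  assumes h: "integrable lborel h" and e: "norm e = 1"
  shows "(\<lambda>n. \<integral>x. h x * indicator (ball 0 r) (x - real n *\<^sub>R e) \<partial>lborel) \<longlonglongrightarrow> 0"
proof -
  have [measurable]: "ball (0::'a) r \<in> sets borel" by simp
  note [measurable] = borel_measurable_integrable[OF h]
  have "(\<lambda>n. \<integral>x. h x * indicator (ball 0 r) (x - real n *\<^sub>R e) \<partial>lborel) \<longlonglongrightarrow> (\<integral>x. 0 \<partial>(lborel :: 'a measure))"
  proof (rule integral_dominated_convergence[where w = "\<lambda>x. \<bar>h x\<bar>"])
    show "AE x in lborel. (\<lambda>n. h x * indicator (ball 0 r) (x - real n *\<^sub>R e)) \<longlonglongrightarrow> 0"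
    proof (rule AE_I2, rule tendsto_eventually)
      fix x :: 'a
      show "\<forall>\<^sub>F n in sequentially. h x * indicator (ball 0 r) (x - real n *\<^sub>R e) = 0"
        using eventually_ge_at_top[of "nat \<lceil>norm x + r\<rceil>"]
      proof eventually_elim
        case (elim n)
        have "norm (real n *\<^sub>R e) - norm x \<le> norm (x - real n *\<^sub>R e)"
          by (metis norm_minus_commute norm_triangle_ineq2)
        with elim have "r \<le> norm (x - real n *\<^sub>R e)" by (simp add: e nat_le_iff ceiling_le_iff)
        then show ?case by simp
      qed
    qed
    show "(\<lambda>x. h x * indicator (ball 0 r) (x - real n *\<^sub>R e)) \<in> borel_measurable lborel" for n by measurable
  qed (use h in \<open>auto split: split_indicator\<close>)
  then show ?thesis by simp
qed

lemma AE_eq_0_of_periodic: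
  fixes h :: "'a::euclidean_space \<Rightarrow> real"
  assumes h: "integrable lborel h" and e: "norm e = 1"
    and periodic: "\<And>n::nat. AE x in lborel. h (x + real n *\<^sub>R e) = h x"
  shows "AE x in lborel. h x = 0"
proof (rule AE_of_countable_cover[where A = "\<lambda>m. ball 0 (real m)"])
  fix m :: nat
  let ?B = "ball (0::'a) (real m)"
  have [measurable]: "?B \<in> sets borel" by simp
  note [measurable] = borel_measurable_integrable[OF h]
  have "(\<lambda>n. \<integral>x. \<bar>h x\<bar> * indicator ?B (x - real n *\<^sub>R e) \<partial>lborel) \<longlonglongrightarrow> 0"
    by (rule integral_mult_indicator_escaping_ball_tendsto[OF integrable_abs[OF h] e])
  moreover have "(\<integral>x. \<bar>h x\<bar> * indicator ?B (x - real n *\<^sub>R e) \<partial>lborel) = (\<integral>x. \<bar>h x\<bar> * indicator ?B x \<partial>lborel)" for n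
  proof -
    have "(\<integral>x. \<bar>h x\<bar> * indicator ?B (x - real n *\<^sub>R e) \<partial>lborel) = (\<integral>x. \<bar>h (x + real n *\<^sub>R e)\<bar> * indicator ?B x \<partial>lborel)"
      by (rule integral_lborel_translate_mult[symmetric])
    also have "\<dots> = (\<integral>x. \<bar>h x\<bar> * indicator ?B x \<partial>lborel)"
      by (rule integral_cong_AE) (use periodic[of n] in auto)
    finally show ?thesis .
  qed
  ultimately have "(\<integral>x. \<bar>h x\<bar> * indicator ?B x \<partial>lborel) = 0" by (simp add: LIMSEQ_const_iff)
  moreover have "integrable lborel (\<lambda>x. \<bar>h x\<bar> * indicator ?B x)"
    using integrable_mult_indicator[OF _ integrable_abs[OF h], of ?B] by (simp add: mult.commute)
  ultimately have "AE x in lborel. \<bar>h x\<bar> * indicator ?B x = 0"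
    by (subst (asm) integral_nonneg_eq_0_iff_AE) auto
  then show "AE x in lborel. x \<in> ?B \<longrightarrow> h x = 0" by eventually_elim auto
next
  show "(\<Union>m. ball (0::'a) (real m)) = UNIV" using reals_Archimedean2 by auto
qed

lemma AE_tendsto_0_of_summable_nn_integral:
  fixes h :: "nat \<Rightarrow> 'a \<Rightarrow> real"
  assumes [measurable]: "\<And>n. h n \<in> borel_measurable M" and nonneg: "\<And>n x. 0 \<le> h n x"
    and bound: "\<And>n. (\<integral>\<^sup>+x. ennreal (h n x) \<partial>M) \<le> ennreal (c n)" and c: "summable c" "\<And>n. 0 \<le> c n"
  shows "AE x in M. (\<lambda>n. h n x) \<longlonglongrightarrow> 0"
proof -
  have "(\<integral>\<^sup>+x. (\<Sum>n. ennreal (h n x)) \<partial>M) = (\<Sum>n. \<integral>\<^sup>+x. ennreal (h n x) \<partial>M)"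
    by (rule nn_integral_suminf) measurable
  also have "\<dots> \<le> (\<Sum>n. ennreal (c n))" by (intro suminf_le bound) auto
  also have "\<dots> = ennreal (\<Sum>n. c n)" by (rule suminf_ennreal2[OF c(2,1)])
  finally have "(\<integral>\<^sup>+x. (\<Sum>n. ennreal (h n x)) \<partial>M) \<noteq> \<infinity>"
    using neq_top_trans[OF ennreal_neq_top] by auto
  then have "AE x in M. (\<Sum>n. ennreal (h n x)) \<noteq> \<infinity>"
    by (rule nn_integral_noteq_infinite[rotated]) measurable
  then show ?thesis
  proof eventually_elim
    case (elim x)
    then have "summable (\<lambda>n. h n x)" using nonneg by (intro summable_suminf_not_top) auto
    then show ?case by (rule summable_LIMSEQ_zero)
  qed
qed

lemma abs_integral_diff_le:
  fixes u v y :: "'a \<Rightarrow> real"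
  assumes "integrable M u" "integrable M v" "integrable M y" and bound: "\<And>x. \<bar>u x - v x\<bar> \<le> y x"
  shows "\<bar>(\<integral>x. u x \<partial>M) - (\<integral>x. v x \<partial>M)\<bar> \<le> (\<integral>x. y x \<partial>M)"
proof -
  have "\<bar>(\<integral>x. u x \<partial>M) - (\<integral>x. v x \<partial>M)\<bar> = \<bar>\<integral>x. u x - v x \<partial>M\<bar>" using assms by simp
  also have "\<dots> \<le> (\<integral>x. \<bar>u x - v x\<bar> \<partial>M)" by (rule integral_abs_bound)
  also have "\<dots> \<le> (\<integral>x. y x \<partial>M)" using assms by (intro integral_mono) auto
  finally show ?thesis .
qed

lemma nn_integral_Icc_ex_le:
  fixes c :: real
  assumes bound: "(\<integral>\<^sup>+t. h t * indicator {c..c + 1} t \<partial>lborel) \<le> ennreal a" and "0 \<le> a" "0 < \<delta>"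
  shows "\<exists>t\<in>{c..c + 1}. h t \<le> ennreal (a + \<delta>)"
proof (rule ccontr)
  assume large: "\<not> ?thesis"
  have "ennreal (a + \<delta>) = (\<integral>\<^sup>+t. ennreal (a + \<delta>) * indicator {c..c + 1} t \<partial>lborel)"
    by (simp add: nn_integral_cmult_indicator)
  also have "\<dots> \<le> (\<integral>\<^sup>+t. h t * indicator {c..c + 1} t \<partial>lborel)"
    using large by (intro nn_integral_mono) (force split: split_indicator)
  also note bound
  finally show False using assms by (simp add: ennreal_le_iff)
qed

lemma power2_integral_Icc_le_nn_integral:
  fixes h :: "real \<Rightarrow> real"
  assumes [measurable]: "h \<in> borel_measurable borel"
  shows "ennreal ((\<integral>s. h s * indicator {0..1} s \<partial>lborel)\<^sup>2) \<le> (\<integral>\<^sup>+s. ennreal ((h s)\<^sup>2) * indicator {0..1} s \<partial>lborel)"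
proof (cases "integrable lborel (\<lambda>s. h s * indicator {0..1} s)")
  case True
  have "ennreal ((\<integral>s. h s * indicator {0..1} s \<partial>lborel)\<^sup>2) = (ennreal (norm (\<integral>s. h s * indicator {0..1} s \<partial>lborel)))\<^sup>2"
    by (simp add: ennreal_power)
  also have "\<dots> \<le> (\<integral>\<^sup>+s. ennreal \<bar>h s * indicator {0..1} s\<bar> \<partial>lborel)\<^sup>2"
    using integral_norm_bound_ennreal[OF True] by (intro power_mono) auto
  also have "\<dots> = (\<integral>\<^sup>+s. ennreal \<bar>h s * indicator {0..1} s\<bar> * indicator {0..1} s \<partial>lborel)\<^sup>2"
    by (intro arg_cong[where f = "\<lambda>t. t\<^sup>2"] nn_integral_cong) (auto split: split_indicator)
  also have "\<dots> \<le> (\<integral>\<^sup>+s. (ennreal \<bar>h s * indicator {0..1} s\<bar>)\<^sup>2 \<partial>lborel) * (\<integral>\<^sup>+s. (indicator {0..1::real} s)\<^sup>2 \<partial>lborel)"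
    by (rule Cauchy_Schwarz_nn_integral) measurable
  also have "(\<lambda>s. (indicator {0..1::real} s)\<^sup>2 :: ennreal) = indicator {0..1}"
    by (auto split: split_indicator)
  also have "(\<lambda>s. (ennreal \<bar>h s * indicator {0..1} s\<bar>)\<^sup>2) = (\<lambda>s. ennreal ((h s)\<^sup>2) * indicator {0..1} s)"
    by (auto simp: ennreal_power split: split_indicator)
  finally show ?thesis by simp
qed (simp add: not_integrable_integral_eq)

subsection \<open>Bounded functions with bounded support\<close>

definition dominated_on_ball :: "real \<Rightarrow> real \<Rightarrow> ('a::real_normed_vector \<Rightarrow> 'b::real_normed_vector) \<Rightarrow> bool" where
  "dominated_on_ball M R \<xi> \<longleftrightarrow> 0 \<le> M \<and> (\<forall>x. norm (\<xi> x) \<le> M * indicator (ball 0 R) x)"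

lemma dominated_on_ballD: "dominated_on_ball M R \<xi> \<Longrightarrow> norm (\<xi> x) \<le> M * indicator (ball 0 R) x"
  by (simp add: dominated_on_ball_def)

lemma dominated_on_ball_bound: "dominated_on_ball M R \<xi> \<Longrightarrow> norm (\<xi> x) \<le> M"
  using dominated_on_ballD[of M R \<xi> x] by (auto simp: dominated_on_ball_def split: split_indicator_asm)

lemma dominated_on_ball_eq_0: "dominated_on_ball M R \<xi> \<Longrightarrow> R \<le> norm x \<Longrightarrow> \<xi> x = 0"
  using dominated_on_ballD[of M R \<xi> x] by simp

lemma dominated_on_ballI:
  assumes "0 \<le> M" "\<And>x. norm (\<xi> x) \<le> M" "\<And>x. R \<le> norm x \<Longrightarrow> \<xi> x = 0"
  shows "dominated_on_ball M R \<xi>"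
  using assms by (auto simp: dominated_on_ball_def split: split_indicator)

lemma dominated_on_ball_mono:
  assumes \<xi>: "dominated_on_ball M R \<xi>" and "0 \<le> K" and bound: "\<And>x. norm (\<eta> x) \<le> K * norm (\<xi> x)"
  shows "dominated_on_ball (K * M) R \<eta>"
  unfolding dominated_on_ball_def
proof (intro conjI allI)
  show "norm (\<eta> x) \<le> K * M * indicator (ball 0 R) x" for x
    using bound[of x] mult_left_mono[OF dominated_on_ballD[OF \<xi>, of x] \<open>0 \<le> K\<close>] by (simp add: mult.assoc)
qed (use assms in \<open>simp add: dominated_on_ball_def\<close>)

lemma dominated_on_ball_translate:
  assumes \<xi>: "dominated_on_ball M R \<xi>" and y: "norm y \<le> r"
  shows "dominated_on_ball M (R + r) (\<lambda>x. \<xi> (x - y))"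
proof (rule dominated_on_ballI)
  show "\<xi> (x - y) = 0" if "R + r \<le> norm x" for x
    using that y norm_triangle_ineq2[of x y] by (intro dominated_on_ball_eq_0[OF \<xi>]) simp
qed (use \<xi> dominated_on_ball_bound[OF \<xi>] in \<open>auto simp: dominated_on_ball_def\<close>)

lemma square_integrable_dominated_on_ball:
  fixes \<xi> :: "'a::euclidean_space \<Rightarrow> 'b::real_normed_vector"
  assumes [measurable]: "\<xi> \<in> borel_measurable borel" and \<xi>: "dominated_on_ball M R \<xi>"
  shows "square_integrable lborel \<xi>"
proof (rule square_integrable_dominated)
  have "(\<lambda>x::'a. (norm (indicator (ball 0 R) x :: real))\<^sup>2) = indicator (ball 0 R)"
    by (auto split: split_indicator)
  then show "square_integrable lborel (indicator (ball (0::'a) R) :: 'a \<Rightarrow> real)"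
    by (simp add: square_integrable_def borel_measurable_indicator
        integrable_real_indicator[OF _ emeasure_bounded_finite])
  show "norm (\<xi> x) \<le> M * norm (indicator (ball 0 R) x :: real)" for x
    using dominated_on_ballD[OF \<xi>, of x] by simp
qed simp

lemma integrable_mult_dominated_on_ball:
  fixes u \<xi> :: "'a::euclidean_space \<Rightarrow> real"
  assumes "square_integrable lborel u" "\<xi> \<in> borel_measurable borel" "dominated_on_ball M R \<xi>"
  shows "integrable lborel (\<lambda>x. u x * \<xi> x)"
  by (rule integrable_mult_square_integrable[OF assms(1) square_integrable_dominated_on_ball[OF assms(2,3)]])

lemma integrable_mult_indicator_ball:
  fixes u :: "'a::euclidean_space \<Rightarrow> real"
  assumes "square_integrable lborel u"
  shows "integrable lborel (\<lambda>x. u x * (M * indicator (ball 0 R) x))"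
proof -
  have "integrable lborel (\<lambda>x. u x * indicator (ball 0 R) x)"
    by (rule integrable_mult_dominated_on_ball[OF assms, of _ 1 R])
       (auto simp: dominated_on_ball_def borel_measurable_indicator)
  from integrable_mult_right[OF this, of M] show ?thesis by (simp add: mult.left_commute)
qed

lemma continuous_compact_support_dominated_on_ball:
  fixes h :: "'a::euclidean_space \<Rightarrow> 'b::real_normed_vector"
  assumes h: "continuous_on UNIV h" and K: "compact K" and zero: "\<And>x. x \<notin> K \<Longrightarrow> h x = 0"
  obtains M R where "dominated_on_ball M R h"
proof -
  have "bounded (h ` K)"
    using h K by (intro compact_imp_bounded compact_continuous_image) (auto intro: continuous_on_subset)
  then obtain M where M: "0 < M" "\<And>x. x \<in> K \<Longrightarrow> norm (h x) \<le> M" by (auto simp: bounded_pos)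
  obtain R where R: "\<And>x. x \<in> K \<Longrightarrow> norm x < R"
    using compact_imp_bounded[OF K] by (metis bounded_pos_less)
  have "dominated_on_ball M R h"
  proof (rule dominated_on_ballI)
    show "norm (h x) \<le> M" for x using M zero by (cases "x \<in> K") auto
    show "h x = 0" if "R \<le> norm x" for x using that R[of x] zero by force
  qed (use M in simp)
  then show ?thesis by (rule that)
qed

subsection \<open>Smooth functions on the plane\<close>

lemma smooth2_differentiable: "smooth2 \<phi> \<Longrightarrow> \<phi> differentiable (at x)"
  by (erule smooth2.cases) auto

lemma smooth2_frechet_derivative: "smooth2 \<phi> \<Longrightarrow> smooth2 (\<lambda>x. frechet_derivative \<phi> (at x) v)"
  by (erule smooth2.cases) auto

lemma smooth2_continuous: "smooth2 \<phi> \<Longrightarrow> continuous_on UNIV \<phi>"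
  by (meson continuous_at_imp_continuous_on differentiable_imp_continuous_within smooth2_differentiable)

lemma cgrad_eqI:
  assumes "(\<phi> has_derivative (\<lambda>v. w \<bullet> v)) (at x)"
  shows "cgrad \<phi> x = w"
  by (simp add: cgrad_def vec_eq_iff inner_axis frechet_derivative_at[OF assms, symmetric])

lemma smooth2_has_derivative_cgrad:
  assumes "smooth2 \<phi>"
  shows "(\<phi> has_derivative (\<lambda>v. cgrad \<phi> x \<bullet> v)) (at x)"
proof -
  have D: "(\<phi> has_derivative frechet_derivative \<phi> (at x)) (at x)"
    using smooth2_differentiable[OF assms] frechet_derivative_works by blast
  interpret linear "frechet_derivative \<phi> (at x)" by (rule has_derivative_linear[OF D])
  have "frechet_derivative \<phi> (at x) v = cgrad \<phi> x \<bullet> v" for v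
  proof -
    have "v = v $ 1 *\<^sub>R axis 1 1 + v $ 2 *\<^sub>R axis 2 1" by (simp add: vec_eq_iff forall_2 axis_def)
    then have "frechet_derivative \<phi> (at x) v = frechet_derivative \<phi> (at x) (v $ 1 *\<^sub>R axis 1 1 + v $ 2 *\<^sub>R axis 2 1)"
      by simp
    then show ?thesis by (simp add: add scale cgrad_def inner_vec_def sum_2 mult.commute)
  qed
  then have "frechet_derivative \<phi> (at x) = (\<lambda>v. cgrad \<phi> x \<bullet> v)" ..
  with D show ?thesis by simp
qed

lemma smooth2_continuous_cgrad:
  assumes "smooth2 \<phi>"
  shows "continuous_on UNIV (cgrad \<phi>)"
  unfolding cgrad_def[abs_def]
  by (intro continuous_on_vec_lambda smooth2_continuous smooth2_frechet_derivative assms)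

lemma has_real_derivative_0_of_quadratic_bound:
  fixes h :: "real \<Rightarrow> real"
  assumes "\<And>t. \<bar>h t - h a\<bar> \<le> K * (t - a)\<^sup>2"
  shows "(h has_real_derivative 0) (at a)"
  unfolding has_field_derivative_iff
proof (rule Lim_null_comparison)
  show "\<forall>\<^sub>F t in at a. norm ((h t - h a) / (t - a)) \<le> K * \<bar>t - a\<bar>"
    unfolding eventually_at_filter
  proof (intro always_eventually allI impI)
    fix t assume "t \<noteq> a"
    then show "norm ((h t - h a) / (t - a)) \<le> K * \<bar>t - a\<bar>"
      using assms[of t] by (simp add: divide_le_eq power2_eq_square abs_mult mult.assoc)
  qed
  have "((\<lambda>t. K * \<bar>t - a\<bar>) \<longlongrightarrow> K * \<bar>a - a\<bar>) (at a)" by (intro tendsto_intros)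
  then show "((\<lambda>t. K * \<bar>t - a\<bar>) \<longlongrightarrow> 0) (at a)" by simp
qed

definition flat_exp :: "nat \<Rightarrow> real \<Rightarrow> real" where
  "flat_exp q t = (if t \<le> 0 then 0 else exp (- 1 / t) * (1 / t) ^ q)"

lemma power_le_fact_exp:
  fixes y :: real assumes "0 \<le> y"
  shows "y ^ n \<le> fact n * exp y"
proof -
  have exp: "(\<lambda>k. y ^ k /\<^sub>R fact k) sums exp y" by (rule exp_converges)
  have "sum (\<lambda>k. y ^ k /\<^sub>R fact k) {n} \<le> suminf (\<lambda>k. y ^ k /\<^sub>R fact k)"
    by (rule sum_le_suminf) (use exp assms in \<open>auto simp: sums_iff\<close>)
  then have "y ^ n /\<^sub>R fact n \<le> exp y" using exp by (simp add: sums_iff)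
  then show ?thesis by (simp add: field_simps)
qed

lemma flat_exp_le_power2: "\<bar>flat_exp q t\<bar> \<le> fact (q + 2) * t\<^sup>2"
proof (cases "t \<le> 0")
  case False
  then have t: "0 < t" by simp
  have "(1 / t) ^ (q + 2) * (exp (- (1/t)) * t\<^sup>2) \<le> fact (q + 2) * exp (1 / t) * (exp (- (1/t)) * t\<^sup>2)"
    using t by (intro mult_right_mono power_le_fact_exp) auto
  also have "\<dots> = fact (q + 2) * t\<^sup>2"
    by (simp add: exp_minus field_simps)
  also have "(1 / t) ^ (q + 2) * (exp (- (1/t)) * t\<^sup>2) = flat_exp q t"
    using t by (simp add: flat_exp_def power_add power_divide power2_eq_square field_simps)
  finally show ?thesis using t by (simp add: flat_exp_def)
qed (simp add: flat_exp_def)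

lemma exp_minus_inverse_mult_power_derivative:
  fixes t :: real assumes t: "0 < t"
  shows "((\<lambda>t. exp (- 1 / t) * (1 / t) ^ q) has_real_derivative
           exp (- 1 / t) * ((1 / t) ^ (q + 2) - real q * (1 / t) ^ (q + 1))) (at t)"
proof (cases q)
  case 0
  then show ?thesis using t
    by (auto intro!: derivative_eq_intros simp: field_simps power2_eq_square)
next
  case (Suc m)
  then show ?thesis using t
    by (auto intro!: derivative_eq_intros simp: field_simps power2_eq_square)
       (use power_minus_mult[of m t] in \<open>auto simp: mult.commute\<close>)
qed

lemma flat_exp_has_derivative:
  "(flat_exp q has_real_derivative flat_exp (q + 2) t - real q * flat_exp (q + 1) t) (at t)"
proof (cases t "0 :: real" rule: linorder_cases)
  case less
  have "((\<lambda>_. 0) has_real_derivative 0) (at t)" by simp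
  then have "(flat_exp q has_real_derivative 0) (at t)"
    by (rule has_field_derivative_transform_within_open[where S = "{..<0}"])
       (use less in \<open>auto simp: flat_exp_def\<close>)
  then show ?thesis using less by (simp add: flat_exp_def)
next
  case equal
  have "(flat_exp q has_real_derivative 0) (at 0)"
    by (rule has_real_derivative_0_of_quadratic_bound[where K = "fact (q + 2)"])
       (use flat_exp_le_power2[of q] in \<open>simp add: flat_exp_def del: fact_Suc\<close>)
  then show ?thesis using equal by (simp add: flat_exp_def)
next
  case greater
  have "(flat_exp q has_real_derivative exp (- 1 / t) * ((1 / t) ^ (q + 2) - real q * (1 / t) ^ (q + 1))) (at t)"
    by (rule has_field_derivative_transform_within_open[where S = "{0<..}",
          OF exp_minus_inverse_mult_power_derivative[OF greater]])
       (use greater in \<open>auto simp: flat_exp_def\<close>)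
  then show ?thesis using greater by (simp add: flat_exp_def right_diff_distrib mult_ac)
qed

lemma flat_exp_0_bounds:
  "0 \<le> flat_exp 0 t" "flat_exp 0 t \<le> 1" "t \<le> 0 \<Longrightarrow> flat_exp 0 t = 0" "0 < t \<Longrightarrow> 0 < flat_exp 0 t"
  by (auto simp: flat_exp_def)

text \<open>Smoothness is coinductive; this inductive closure is stable under directional derivatives, so that one
  coinduction gives all the closure properties of \<^const>\<open>smooth2\<close> at once.\<close>

inductive smooth_closure :: "(R2 \<Rightarrow> real) \<Rightarrow> bool" where
  smooth2: "smooth2 \<phi> \<Longrightarrow> smooth_closure \<phi>"
| const: "smooth_closure (\<lambda>x. c)"
| flat_exp: "smooth_closure (\<lambda>x. flat_exp q (c * x $ i + d))"
| add: "smooth_closure \<phi> \<Longrightarrow> smooth_closure \<psi> \<Longrightarrow> smooth_closure (\<lambda>x. \<phi> x + \<psi> x)"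
| mult: "smooth_closure \<phi> \<Longrightarrow> smooth_closure \<psi> \<Longrightarrow> smooth_closure (\<lambda>x. \<phi> x * \<psi> x)"
| affine: "smooth_closure \<phi> \<Longrightarrow> smooth_closure (\<lambda>x. \<phi> (l *\<^sub>R x + a))"

lemma flat_exp_vec_nth_has_derivative:
  fixes x :: "real ^ 'n"
  shows "((\<lambda>x. flat_exp q (c * x $ i + d)) has_derivative
           (\<lambda>v. (flat_exp (q + 2) (c * x $ i + d) - real q * flat_exp (q + 1) (c * x $ i + d)) * (c * v $ i))) (at x)"
proof -
  have "((\<lambda>x. c * x $ i + d) has_derivative (\<lambda>v. c * v $ i)) (at x)"
    by (auto intro!: derivative_eq_intros bounded_linear_imp_has_derivative bounded_linear_vec_nth)
  from diff_chain_at[OF this flat_exp_has_derivative[unfolded has_field_derivative_def]]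
  show ?thesis by (simp add: o_def)
qed

lemma smooth_closure_has_derivative:
  "smooth_closure \<phi> \<Longrightarrow> \<exists>D. (\<forall>x. (\<phi> has_derivative (\<lambda>v. D v x)) (at x)) \<and> (\<forall>v. smooth_closure (D v))"
proof (induction rule: smooth_closure.induct)
  case (smooth2 \<phi>)
  then show ?case
    by (intro exI[of _ "\<lambda>v x. frechet_derivative \<phi> (at x) v"])
       (use smooth2_differentiable frechet_derivative_works smooth2_frechet_derivative smooth_closure.smooth2 in blast)
next
  case (const c)
  show ?case by (rule exI[of _ "\<lambda>v x. 0"]) (auto intro: smooth_closure.const)
next
  case (flat_exp q c i d)
  let ?D = "\<lambda>v x. (flat_exp (q + 2) (c * x $ i + d) + (- real q) * flat_exp (q + 1) (c * x $ i + d)) * (c * v $ i)"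
  have "smooth_closure (?D v)" for v by (intro smooth_closure.intros(2-5))
  then show ?case
    using flat_exp_vec_nth_has_derivative[of q c i d] by (intro exI[of _ ?D]) simp
next
  case (add \<phi> \<psi>)
  then obtain D E where "\<And>x. (\<phi> has_derivative (\<lambda>v. D v x)) (at x)" "\<And>v. smooth_closure (D v)"
    "\<And>x. (\<psi> has_derivative (\<lambda>v. E v x)) (at x)" "\<And>v. smooth_closure (E v)" by metis
  then show ?case
    by (intro exI[of _ "\<lambda>v x. D v x + E v x"]) (auto intro!: smooth_closure.add has_derivative_add)
next
  case (mult \<phi> \<psi>)
  then obtain D E where "\<And>x. (\<phi> has_derivative (\<lambda>v. D v x)) (at x)" "\<And>v. smooth_closure (D v)"
    "\<And>x. (\<psi> has_derivative (\<lambda>v. E v x)) (at x)" "\<And>v. smooth_closure (E v)" by metis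
  then show ?case using mult
    by (intro exI[of _ "\<lambda>v x. \<phi> x * E v x + D v x * \<psi> x"])
       (auto intro!: smooth_closure.add smooth_closure.mult has_derivative_mult)
next
  case (affine \<phi> l a)
  then obtain D where D: "\<And>x. (\<phi> has_derivative (\<lambda>v. D v x)) (at x)" "\<And>v. smooth_closure (D v)" by metis
  have "((\<lambda>x. l *\<^sub>R x + a) has_derivative (\<lambda>v. l *\<^sub>R v)) (at x)" for x :: R2
    by (auto intro!: derivative_eq_intros)
  from diff_chain_at[OF this D(1)] show ?case
    by (intro exI[of _ "\<lambda>v x. D (l *\<^sub>R v) (l *\<^sub>R x + a)"]) (auto simp: o_def intro: smooth_closure.affine D)
qed

lemma smooth_closure_imp_smooth2:
  assumes "smooth_closure \<phi>"
  shows "smooth2 \<phi>"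
  using assms
proof (coinduct rule: smooth2.coinduct)
  case (smooth2 \<phi>)
  then obtain D where D: "\<And>x. (\<phi> has_derivative (\<lambda>v. D v x)) (at x)" "\<And>v. smooth_closure (D v)"
    using smooth_closure_has_derivative by metis
  have "(\<lambda>x. frechet_derivative \<phi> (at x) v) = D v" for v
    by (simp add: frechet_derivative_at[OF D(1), symmetric])
  then show ?case using D unfolding differentiable_def by auto
qed

lemma smooth2_add: "smooth2 \<phi> \<Longrightarrow> smooth2 \<psi> \<Longrightarrow> smooth2 (\<lambda>x. \<phi> x + \<psi> x)"
  by (rule smooth_closure_imp_smooth2) (intro smooth_closure.add smooth_closure.smooth2)

lemma smooth2_mult: "smooth2 \<phi> \<Longrightarrow> smooth2 \<psi> \<Longrightarrow> smooth2 (\<lambda>x. \<phi> x * \<psi> x)"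
  by (rule smooth_closure_imp_smooth2) (intro smooth_closure.mult smooth_closure.smooth2)

lemma smooth2_affine: "smooth2 \<phi> \<Longrightarrow> smooth2 (\<lambda>x. \<phi> (l *\<^sub>R x + a))"
  by (rule smooth_closure_imp_smooth2) (intro smooth_closure.affine smooth_closure.smooth2)

subsection \<open>Test functions\<close>

lemma test_funI:
  assumes "smooth2 \<phi>" "compact K" and zero: "\<And>x. x \<notin> K \<Longrightarrow> \<phi> x = 0"
  shows "test_fun UNIV \<phi>"
proof -
  have "supp2 \<phi> \<subseteq> K"
    unfolding supp2_def using zero compact_imp_closed[OF \<open>compact K\<close>] by (intro closure_minimal) auto
  moreover have "closed (supp2 \<phi>)" by (simp add: supp2_def)
  ultimately have "compact (supp2 \<phi>)"
    using \<open>compact K\<close> by (meson bounded_subset compact_eq_bounded_closed)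
  with assms show ?thesis by (simp add: test_fun_def)
qed

lemma test_fun_smooth2: "test_fun UNIV \<phi> \<Longrightarrow> smooth2 \<phi>"
  by (simp add: test_fun_def)

lemma test_fun_compact_supp2: "test_fun UNIV \<phi> \<Longrightarrow> compact (supp2 \<phi>)"
  by (simp add: test_fun_def)

lemma eq_0_outside_supp2: "x \<notin> supp2 \<phi> \<Longrightarrow> \<phi> x = 0"
  using closure_subset[of "{x. \<phi> x \<noteq> 0}"] by (auto simp: supp2_def)

lemma cgrad_eq_0_outside_supp2:
  assumes "x \<notin> supp2 \<phi>"
  shows "cgrad \<phi> x = 0"
proof (rule cgrad_eqI)
  have "((\<lambda>_. 0) has_derivative (\<lambda>v. 0 \<bullet> v)) (at x)" by simp
  then show "(\<phi> has_derivative (\<lambda>v. 0 \<bullet> v)) (at x)"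
  proof (rule has_derivative_transform_within_open)
    show "open (- supp2 \<phi>)" by (simp add: supp2_def open_Compl)
  qed (use assms in \<open>auto simp: eq_0_outside_supp2\<close>)
qed

lemmas test_fun_has_derivative = smooth2_has_derivative_cgrad[OF test_fun_smooth2]
  and test_fun_continuous = smooth2_continuous[OF test_fun_smooth2]
  and test_fun_continuous_cgrad = smooth2_continuous_cgrad[OF test_fun_smooth2]

lemma test_fun_borel: "test_fun UNIV \<phi> \<Longrightarrow> \<phi> \<in> borel_measurable borel"
  by (rule borel_measurable_continuous_onI[OF test_fun_continuous])

lemma cgrad_borel: "test_fun UNIV \<phi> \<Longrightarrow> cgrad \<phi> \<in> borel_measurable borel"
  by (rule borel_measurable_continuous_onI[OF test_fun_continuous_cgrad])

lemma test_fun_dominated_on_ball: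
  assumes "test_fun UNIV \<phi>"
  obtains M R where "dominated_on_ball M R \<phi>"
  by (rule continuous_compact_support_dominated_on_ball[OF test_fun_continuous[OF assms]
        test_fun_compact_supp2[OF assms] eq_0_outside_supp2[of _ \<phi>]])

lemma cgrad_dominated_on_ball:
  assumes "test_fun UNIV \<phi>"
  obtains M R where "dominated_on_ball M R (cgrad \<phi>)"
  by (rule continuous_compact_support_dominated_on_ball[OF test_fun_continuous_cgrad[OF assms]
        test_fun_compact_supp2[OF assms] cgrad_eq_0_outside_supp2])

lemma test_fun_square_integrable:
  assumes "test_fun UNIV \<phi>"
  shows "square_integrable lborel \<phi>" and "square_integrable lborel (cgrad \<phi>)"
  using assms test_fun_dominated_on_ball[OF assms] cgrad_dominated_on_ball[OF assms]
  by (metis square_integrable_dominated_on_ball test_fun_borel cgrad_borel)+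

lemma test_fun_lipschitz:
  assumes "test_fun UNIV \<phi>" and "\<And>x. norm (cgrad \<phi> x) \<le> L"
  shows "L-lipschitz_on UNIV \<phi>"
proof (rule lipschitz_onI)
  show "0 \<le> L" using assms(2) norm_ge_zero order_trans by blast
  have "onorm (\<lambda>v. cgrad \<phi> x \<bullet> v) \<le> L" for x
  proof (rule onorm_le)
    show "norm (cgrad \<phi> x \<bullet> v) \<le> L * norm v" for v
      using Cauchy_Schwarz_ineq2[of "cgrad \<phi> x" v] mult_right_mono[OF assms(2)[of x] norm_ge_zero[of v]] by simp
  qed
  then show "dist (\<phi> x) (\<phi> y) \<le> L * dist x y" for x y
    unfolding dist_norm
    by (intro differentiable_bound[OF convex_UNIV
          has_derivative_at_withinI[OF test_fun_has_derivative[OF assms(1)]]]) auto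
qed

lemma test_fun_add:
  assumes "test_fun UNIV \<phi>" "test_fun UNIV \<psi>"
  shows "test_fun UNIV (\<lambda>x. \<phi> x + \<psi> x)"
  using assms by (intro test_funI[of _ "supp2 \<phi> \<union> supp2 \<psi>"] smooth2_add compact_Un)
    (auto simp: test_fun_def eq_0_outside_supp2)

lemma test_fun_affine:
  assumes \<phi>: "test_fun UNIV \<phi>" and l: "l \<noteq> 0"
  shows "test_fun UNIV (\<lambda>x. \<phi> (l *\<^sub>R x + a))"
proof (rule test_funI)
  let ?K = "(\<lambda>y. (1 / l) *\<^sub>R (y - a)) ` supp2 \<phi>"
  show "compact ?K" by (intro compact_continuous_image continuous_intros test_fun_compact_supp2 \<phi>)
  show "\<phi> (l *\<^sub>R x + a) = 0" if "x \<notin> ?K" for x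
  proof (rule eq_0_outside_supp2)
    have "x = (1 / l) *\<^sub>R ((l *\<^sub>R x + a) - a)" using l by simp
    with that show "l *\<^sub>R x + a \<notin> supp2 \<phi>" by blast
  qed
qed (intro smooth2_affine test_fun_smooth2 \<phi>)

lemma cgrad_affine:
  assumes "test_fun UNIV \<phi>"
  shows "cgrad (\<lambda>x. \<phi> (l *\<^sub>R x + a)) x = l *\<^sub>R cgrad \<phi> (l *\<^sub>R x + a)"
proof (rule cgrad_eqI)
  have "((\<lambda>x. l *\<^sub>R x + a) has_derivative (\<lambda>v. l *\<^sub>R v)) (at x)"
    by (auto intro!: derivative_eq_intros)
  from diff_chain_at[OF this test_fun_has_derivative[OF assms]]
  show "((\<lambda>x. \<phi> (l *\<^sub>R x + a)) has_derivative (\<lambda>v. (l *\<^sub>R cgrad \<phi> (l *\<^sub>R x + a)) \<bullet> v)) (at x)"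
    by (simp add: o_def)
qed

definition bump :: "R2 \<Rightarrow> R2 \<Rightarrow> real \<Rightarrow> R2 \<Rightarrow> real" where
  "bump a b k x = (\<Prod>i\<in>UNIV. flat_exp 0 (k * (x $ i - a $ i)) * flat_exp 0 (k * (b $ i - x $ i)))"

lemma smooth2_bump: "smooth2 (bump a b k)"
proof -
  have "bump a b k = (\<lambda>x. (flat_exp 0 (k * x $ 1 + (- k * a $ 1)) * flat_exp 0 ((- k) * x $ 1 + k * b $ 1)) *
      (flat_exp 0 (k * x $ 2 + (- k * a $ 2)) * flat_exp 0 ((- k) * x $ 2 + k * b $ 2)))"
    by (auto simp: bump_def UNIV_2 algebra_simps fun_eq_iff)
  then show ?thesis by (simp only:) (rule smooth_closure_imp_smooth2, intro smooth_closure.intros(2-5))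
qed

lemma bump_nonneg: "0 \<le> bump a b k x"
  unfolding bump_def by (intro prod_nonneg mult_nonneg_nonneg ballI flat_exp_0_bounds)

lemma bump_le_1: "bump a b k x \<le> 1"
  unfolding bump_def by (intro prod_le_1 conjI mult_nonneg_nonneg mult_le_one flat_exp_0_bounds)

lemma bump_eq_0:
  assumes "0 \<le> k" "x \<notin> box a b"
  shows "bump a b k x = 0"
proof -
  obtain i where "x $ i \<le> a $ i \<or> b $ i \<le> x $ i" using assms(2) by (auto simp: mem_box_cart not_less)
  then have "flat_exp 0 (k * (x $ i - a $ i)) * flat_exp 0 (k * (b $ i - x $ i)) = 0"
    using assms(1) flat_exp_0_bounds(3) by (auto simp: mult_le_0_iff)
  then show ?thesis unfolding bump_def by (intro prod_zero) auto
qed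

lemma bump_pos: "0 < k \<Longrightarrow> x \<in> box a b \<Longrightarrow> 0 < bump a b k x"
  unfolding bump_def by (intro prod_pos ballI mult_pos_pos flat_exp_0_bounds(4)) (auto simp: mem_box_cart)

lemma bump_eq_0_outside_cbox: "0 \<le> k \<Longrightarrow> x \<notin> cbox a b \<Longrightarrow> bump a b k x = 0"
  using box_subset_cbox by (blast intro: bump_eq_0)

lemma bump_test_fun: "0 \<le> k \<Longrightarrow> test_fun UNIV (bump a b k)"
  by (rule test_funI[OF smooth2_bump compact_cbox bump_eq_0_outside_cbox])

lemma flat_exp_0_tendsto_1:
  assumes "0 < s"
  shows "(\<lambda>k. flat_exp 0 (real k * s)) \<longlonglongrightarrow> 1"
proof (rule Lim_transform_eventually)
  have "(\<lambda>k. exp (- (1 / s) * (1 / real k))) \<longlonglongrightarrow> exp (- (1 / s) * 0)"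
    by (intro tendsto_intros lim_1_over_n)
  then show "(\<lambda>k. exp (- (1 / s) * (1 / real k))) \<longlonglongrightarrow> 1" by simp
  show "\<forall>\<^sub>F k in sequentially. exp (- (1 / s) * (1 / real k)) = flat_exp 0 (real k * s)"
    using eventually_gt_at_top[of "0::nat"]
    by eventually_elim (use assms in \<open>auto simp: flat_exp_def mult_le_0_iff field_simps\<close>)
qed

lemma bump_tendsto: "(\<lambda>k. bump a b (real k) x) \<longlonglongrightarrow> indicator (box a b) x"
proof (cases "x \<in> box a b")
  case True
  have "(\<lambda>k. bump a b (real k) x) \<longlonglongrightarrow> (\<Prod>i::2\<in>UNIV. 1 * 1)"
    unfolding bump_def using True
    by (intro tendsto_prod tendsto_mult flat_exp_0_tendsto_1) (auto simp: mem_box_cart)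
  then show ?thesis using True by simp
next
  case False
  then show ?thesis by (simp add: bump_eq_0)
qed

lemma bump_bounded_below:
  obtains c where "0 < c" "\<And>x. x \<in> box a b \<Longrightarrow> c \<le> bump (a - 1) (b + 1) 1 x"
proof (cases "cbox a b = {}")
  case True
  then show ?thesis using that[of 1] box_subset_cbox by fastforce
next
  case False
  have "continuous_on (cbox a b) (bump (a - 1) (b + 1) 1)"
    using smooth2_continuous[OF smooth2_bump] continuous_on_subset by blast
  then obtain x where x: "x \<in> cbox a b" "\<And>y. y \<in> cbox a b \<Longrightarrow> bump (a - 1) (b + 1) 1 x \<le> bump (a - 1) (b + 1) 1 y"
    using continuous_attains_inf[OF compact_cbox False] by blast
  have "cbox a b \<subseteq> box (a - 1) (b + 1)"
  proof
    fix y assume "y \<in> cbox a b"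
    then have bounds: "a $ i \<le> y $ i" "y $ i \<le> b $ i" for i by (auto simp: mem_box_cart)
    have "a $ i - 1 < y $ i \<and> y $ i < b $ i + 1" for i using bounds[of i] by auto
    then show "y \<in> box (a - 1) (b + 1)" by (simp add: mem_box_cart)
  qed
  with x(1) have "0 < bump (a - 1) (b + 1) 1 x" by (intro bump_pos) auto
  then show ?thesis using x(2) box_subset_cbox by (intro that[of "bump (a - 1) (b + 1) 1 x"]) blast+
qed

lemma cgrad_power2:
  assumes "test_fun UNIV \<eta>"
  shows "cgrad (\<lambda>x. (\<eta> x)\<^sup>2) x = (2 * \<eta> x) *\<^sub>R cgrad \<eta> x"
proof (rule cgrad_eqI)
  show "((\<lambda>x. (\<eta> x)\<^sup>2) has_derivative (\<lambda>v. ((2 * \<eta> x) *\<^sub>R cgrad \<eta> x) \<bullet> v)) (at x)"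
    by (rule has_derivative_eq_rhs[OF has_derivative_power[OF test_fun_has_derivative[OF assms], of 2]])
       (simp add: algebra_simps)
qed

lemma cutoff_exists:
  fixes a b :: R2
  obtains \<phi> c K where "test_fun UNIV \<phi>" "\<And>x. 0 \<le> \<phi> x" "\<And>x. \<phi> x \<le> 1" "0 < c" "\<And>x. x \<in> box a b \<Longrightarrow> c \<le> \<phi> x"
    "0 \<le> K" "\<And>x. (norm (cgrad \<phi> x))\<^sup>2 \<le> K * \<phi> x" "\<And>x. x \<notin> cbox (a - 1) (b + 1) \<Longrightarrow> \<phi> x = 0"
proof -
  define \<eta> where "\<eta> = bump (a - 1) (b + 1) 1"
  have \<eta>: "test_fun UNIV \<eta>" unfolding \<eta>_def by (rule bump_test_fun) simp
  have \<eta>_bounds: "0 \<le> \<eta> x" "\<eta> x \<le> 1" for x by (auto simp: \<eta>_def bump_nonneg bump_le_1)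
  have \<eta>_0: "\<eta> x = 0" if "x \<notin> cbox (a - 1) (b + 1)" for x
    using that by (simp add: \<eta>_def bump_eq_0_outside_cbox)
  obtain c where c: "0 < c" "\<And>x. x \<in> box a b \<Longrightarrow> c \<le> \<eta> x" using bump_bounded_below unfolding \<eta>_def by blast
  obtain L R where "dominated_on_ball L R (cgrad \<eta>)" using cgrad_dominated_on_ball[OF \<eta>] .
  then have L: "norm (cgrad \<eta> x) \<le> L" for x by (rule dominated_on_ball_bound)
  have "smooth2 (\<lambda>x. (\<eta> x)\<^sup>2)"
    unfolding power2_eq_square using \<eta> by (intro smooth2_mult test_fun_smooth2)
  then have "test_fun UNIV (\<lambda>x. (\<eta> x)\<^sup>2)"
    by (rule test_funI[OF _ compact_cbox[of "a - 1" "b + 1"]]) (simp add: \<eta>_0)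
  then show ?thesis
  proof (rule that[where c = "c\<^sup>2" and K = "4 * L\<^sup>2"])
    show "(norm (cgrad (\<lambda>x. (\<eta> x)\<^sup>2) x))\<^sup>2 \<le> 4 * L\<^sup>2 * (\<eta> x)\<^sup>2" for x
      using mult_left_mono[OF power_mono[OF L[of x] norm_ge_zero, of 2], of "4 * (\<eta> x)\<^sup>2"]
      by (simp add: cgrad_power2[OF \<eta>] power_mult_distrib mult_ac)
    show "c\<^sup>2 \<le> (\<eta> x)\<^sup>2" if "x \<in> box a b" for x using c that by (intro power_mono) auto
  qed (use c \<eta>_bounds \<eta>_0 in \<open>auto simp: power_le_one\<close>)
qed

subsection \<open>The fundamental lemma of the calculus of variations\<close>

context
  fixes k :: "R2 \<Rightarrow> real"
  assumes k [measurable]: "k \<in> borel_measurable borel"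
    and integrable_test: "\<And>\<phi>. test_fun UNIV \<phi> \<Longrightarrow> integrable lborel (\<lambda>x. k x * \<phi> x)"
begin

lemma integrable_on_box_of_integrable_test: "integrable lborel (\<lambda>x. indicator (box a b) x * k x)"
proof -
  obtain c where c: "0 < c" "\<And>x. x \<in> box a b \<Longrightarrow> c \<le> bump (a - 1) (b + 1) 1 x"
    using bump_bounded_below by blast
  have "integrable lborel (\<lambda>x. (1/c) * (k x * bump (a - 1) (b + 1) 1 x))"
    by (intro integrable_mult_right integrable_test bump_test_fun) simp
  then show ?thesis
  proof (rule Bochner_Integration.integrable_bound)
    have "\<bar>indicator (box a b) x * k x\<bar> \<le> \<bar>(1/c) * (k x * bump (a - 1) (b + 1) 1 x)\<bar>" for x
    proof (cases "x \<in> box a b")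
      case True
      then have "\<bar>k x\<bar> * c \<le> \<bar>k x\<bar> * bump (a - 1) (b + 1) 1 x" using c by (intro mult_left_mono) auto
      then show ?thesis using c True by (simp add: abs_mult bump_nonneg field_simps)
    qed simp
    then show "AE x in lborel. norm (indicator (box a b) x * k x) \<le> norm ((1/c) * (k x * bump (a - 1) (b + 1) 1 x))"
      by simp
  qed measurable
qed

context
  assumes integral_test: "\<And>\<phi>. test_fun UNIV \<phi> \<Longrightarrow> (\<integral>x. k x * \<phi> x \<partial>lborel) = 0"
begin

lemma integral_on_box_of_integral_test: "(\<integral>x. indicator (box a b) x * k x \<partial>lborel) = 0"
proof (rule LIMSEQ_unique)
  show "(\<lambda>n. \<integral>x. k x * bump a b (real n) x \<partial>lborel) \<longlonglongrightarrow> 0"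
    using integral_test[OF bump_test_fun] by simp
  show "(\<lambda>n. \<integral>x. k x * bump a b (real n) x \<partial>lborel) \<longlonglongrightarrow> (\<integral>x. indicator (box a b) x * k x \<partial>lborel)"
  proof (rule integral_dominated_convergence[where w = "\<lambda>x. \<bar>indicator (box a b) x * k x\<bar>"])
    show "AE x in lborel. (\<lambda>n. k x * bump a b (real n) x) \<longlonglongrightarrow> indicator (box a b) x * k x"
      using tendsto_mult_left[OF bump_tendsto] by (auto simp: mult.commute)
    show "AE x in lborel. norm (k x * bump a b (real n) x) \<le> \<bar>indicator (box a b) x * k x\<bar>" for n
      by (rule AE_I2) (auto simp: abs_mult bump_nonneg bump_eq_0 intro!: mult_left_le bump_le_1 split: split_indicator)
    show "(\<lambda>x. k x * bump a b (real n) x) \<in> borel_measurable lborel" for n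
      using test_fun_borel[OF bump_test_fun[of "real n" a b]] by measurable
  qed (use integrable_on_box_of_integrable_test[of a b] in auto)
qed

lemma fundamental_lemma_borel: "AE x in lborel. k x = 0"
proof (rule AE_of_countable_cover[OF _ UN_centred_box])
  fix n :: nat
  have "AE x in lborel. indicator (centred_box n) x * k x = 0"
  proof (rule AE_eq_0_of_box_integrals)
    show "integrable lborel (\<lambda>x. indicator (centred_box n) x * k x)"
      unfolding centred_box_def by (rule integrable_on_box_of_integrable_test)
    fix a b :: R2
    obtain a' b' where box: "box a b \<inter> centred_box n = box a' b'"
      unfolding centred_box_def by (simp only: box_Int_box)
    have "(LINT x:box a b|lborel. indicator (centred_box n) x * k x) =
        (\<integral>x. indicator (box a b \<inter> centred_box n) x * k x \<partial>lborel)"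
      unfolding set_lebesgue_integral_def by (intro Bochner_Integration.integral_cong) (auto split: split_indicator)
    then show "(LINT x:box a b|lborel. indicator (centred_box n) x * k x) = 0"
      unfolding box integral_on_box_of_integral_test .
  qed
  then show "AE x in lborel. x \<in> centred_box n \<longrightarrow> k x = 0" by eventually_elim auto
qed

end

end

lemma fundamental_lemma:
  fixes k :: "R2 \<Rightarrow> real"
  assumes k: "k \<in> borel_measurable lebesgue"
    and integrable_test: "\<And>\<phi>. test_fun UNIV \<phi> \<Longrightarrow> integrable lebesgue (\<lambda>x. k x * \<phi> x)"
    and zero: "\<And>\<phi>. test_fun UNIV \<phi> \<Longrightarrow> (\<integral>x. k x * \<phi> x \<partial>lebesgue) = 0"
  shows "AE x in lebesgue. k x = 0"
proof -
  obtain k' where k' [measurable]: "k' \<in> borel_measurable borel" and eq: "AE x in lborel. k x = k' x"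
    using ex_borel_representative[OF k] .
  note [measurable] = k borel_measurable_lebesgueI[OF k']
  have "AE x in lborel. k' x = 0"
  proof (rule fundamental_lemma_borel[OF k'])
    fix \<phi> assume \<phi>: "test_fun UNIV \<phi>"
    note [measurable] = test_fun_borel[OF \<phi>] borel_measurable_lebesgueI[OF test_fun_borel[OF \<phi>]]
    have "integrable lebesgue (\<lambda>x. k' x * \<phi> x)"
      by (rule integrable_cong_AE_imp[OF integrable_test[OF \<phi>]]) (use eq in \<open>auto simp: AE_completion_iff\<close>)
    then show "integrable lborel (\<lambda>x. k' x * \<phi> x)" by (simp add: integrable_completion)
    have "(\<integral>x. k x * \<phi> x \<partial>lebesgue) = (\<integral>x. k' x * \<phi> x \<partial>lebesgue)"
      by (rule integral_cong_AE) (use eq in \<open>auto simp: AE_completion_iff\<close>)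
    then show "(\<integral>x. k' x * \<phi> x \<partial>lborel) = 0" using zero[OF \<phi>] by (simp add: integral_completion)
  qed
  then have "AE x in lborel. k x = 0" using eq by eventually_elim simp
  then show ?thesis by (rule AE_completion)
qed

subsection \<open>Weak directional derivatives and translations\<close>

definition weak_dir_deriv :: "R2 \<Rightarrow> (R2 \<Rightarrow> real) \<Rightarrow> (R2 \<Rightarrow> real) \<Rightarrow> bool" where
  "weak_dir_deriv e u g \<longleftrightarrow> (\<forall>\<phi>. test_fun UNIV \<phi> \<longrightarrow>
     (\<integral>x. u x * (cgrad \<phi> x \<bullet> e) \<partial>lborel) = - (\<integral>x. g x * \<phi> x \<partial>lborel))"

lemma weak_dir_derivD:
  "weak_dir_deriv e u g \<Longrightarrow> test_fun UNIV \<phi> \<Longrightarrow>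
    (\<integral>x. u x * (cgrad \<phi> x \<bullet> e) \<partial>lborel) = - (\<integral>x. g x * \<phi> x \<partial>lborel)"
  by (simp add: weak_dir_deriv_def)

lemma weak_dir_deriv_scaleR:
  assumes "weak_dir_deriv e u g"
  shows "weak_dir_deriv (t *\<^sub>R e) u (\<lambda>x. t * g x)"
  unfolding weak_dir_deriv_def
proof (intro allI impI)
  fix \<phi> assume \<phi>: "test_fun UNIV \<phi>"
  have "(\<integral>x. u x * (cgrad \<phi> x \<bullet> (t *\<^sub>R e)) \<partial>lborel) = (\<integral>x. t * (u x * (cgrad \<phi> x \<bullet> e)) \<partial>lborel)"
    by (simp add: mult_ac)
  also have "\<dots> = t * - (\<integral>x. g x * \<phi> x \<partial>lborel)" using weak_dir_derivD[OF assms \<phi>] by simp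
  also have "\<dots> = - (\<integral>x. t * g x * \<phi> x \<partial>lborel)" by (simp add: mult.assoc)
  finally show "(\<integral>x. u x * (cgrad \<phi> x \<bullet> (t *\<^sub>R e)) \<partial>lborel) = - (\<integral>x. t * g x * \<phi> x \<partial>lborel)" .
qed

lemma weak_dir_deriv_translate:
  assumes "weak_dir_deriv e u g" "test_fun UNIV \<phi>"
  shows "(\<integral>x. u x * (cgrad \<phi> (x - a) \<bullet> e) \<partial>lborel) = - (\<integral>x. g x * \<phi> (x - a) \<partial>lborel)"
  using weak_dir_derivD[OF assms(1) test_fun_affine[OF assms(2), of 1 "- a"]] cgrad_affine[OF assms(2), of 1 "- a"]
  by simp

lemma dir_deriv_dominated_on_ball:
  assumes "test_fun UNIV \<phi>"
  obtains M R where "dominated_on_ball M R (\<lambda>x. cgrad \<phi> x \<bullet> e)"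
proof -
  obtain M R where "dominated_on_ball M R (cgrad \<phi>)" using cgrad_dominated_on_ball[OF assms] .
  then have "dominated_on_ball (norm e * M) R (\<lambda>x. cgrad \<phi> x \<bullet> e)"
    by (rule dominated_on_ball_mono) (use Cauchy_Schwarz_ineq2[of _ e] in \<open>auto simp: mult.commute[of "norm e"]\<close>)
  then show ?thesis by (rule that)
qed

lemma dir_deriv_borel: "test_fun UNIV \<phi> \<Longrightarrow> (\<lambda>x. cgrad \<phi> x \<bullet> e) \<in> borel_measurable borel"
  by (intro borel_measurable_inner cgrad_borel borel_measurable_const)

lemma has_real_derivative_along_line:
  fixes \<phi> :: "'a::real_inner \<Rightarrow> real"
  assumes "(\<phi> has_derivative (\<lambda>v. w \<bullet> v)) (at (x + s *\<^sub>R e))"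
  shows "((\<lambda>s. \<phi> (x + s *\<^sub>R e)) has_real_derivative w \<bullet> e) (at s)"
proof -
  have "((\<lambda>s. x + s *\<^sub>R e) has_derivative (\<lambda>h. h *\<^sub>R e)) (at s)" by (auto intro!: derivative_eq_intros)
  from diff_chain_at[OF this assms] show ?thesis
    by (simp add: has_field_derivative_def o_def mult_commute_abs)
qed

lemma test_fun_diff_eq_integral:
  assumes \<phi>: "test_fun UNIV \<phi>"
  shows "\<phi> (x - e) - \<phi> x = - (\<integral>s. (cgrad \<phi> (x - s *\<^sub>R e) \<bullet> e) * indicator {0..1} s \<partial>lborel)"
proof -
  have deriv: "((\<lambda>s. \<phi> (x - s *\<^sub>R e)) has_vector_derivative - (cgrad \<phi> (x - s *\<^sub>R e) \<bullet> e)) (at s within {0..1})" for s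
    using has_real_derivative_along_line[OF test_fun_has_derivative[OF \<phi>], where x = x and s = s and e = "- e"]
    by (simp add: has_real_derivative_iff_has_vector_derivative has_vector_derivative_at_within)
  have "continuous_on {0..1} (\<lambda>s. - (cgrad \<phi> (x - s *\<^sub>R e) \<bullet> e))"
    by (intro continuous_intros continuous_on_compose2[OF test_fun_continuous_cgrad[OF \<phi>]]) auto
  then have "(\<integral>s. - (cgrad \<phi> (x - s *\<^sub>R e) \<bullet> e) * indicator {0..1} s \<partial>lborel) = \<phi> (x - 1 *\<^sub>R e) - \<phi> (x - 0 *\<^sub>R e)"
    using integral_FTC_atLeastAtMost[of 0 1 "\<lambda>s. \<phi> (x - s *\<^sub>R e)" "\<lambda>s. - (cgrad \<phi> (x - s *\<^sub>R e) \<bullet> e)"] deriv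
    by (simp add: mult.commute)
  then show ?thesis by simp
qed

context
  fixes g \<xi> :: "'a::euclidean_space \<Rightarrow> real" and M R :: real
  assumes g: "square_integrable lborel g" and \<xi>: "\<xi> \<in> borel_measurable borel" "dominated_on_ball M R \<xi>"
begin

lemma integrable_mult_sheared: "integrable (lborel \<Otimes>\<^sub>M lborel) (\<lambda>(x, s). g x * \<xi> (x - s *\<^sub>R e) * indicator {0..1} s)"
proof (rule Bochner_Integration.integrable_bound)
  note [measurable] = \<xi>(1) square_integrable_lborel_measurable[OF g]
  let ?w = "\<lambda>x. M * indicator (ball 0 (R + norm e)) x"
  show "integrable (lborel \<Otimes>\<^sub>M lborel) (\<lambda>(x, s). g x * ?w x * indicator {0..1} (s::real))"
    by (intro lborel_pair.integrable_mult_pair_measure integrable_mult_indicator_ball g) simp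
  have "\<bar>g x * \<xi> (x - s *\<^sub>R e) * indicator {0..1} s\<bar> \<le> \<bar>g x * ?w x * indicator {0..1} s\<bar>" for x s
  proof (cases "s \<in> {0..1}")
    case True
    then have "norm (s *\<^sub>R e) \<le> norm e" by (simp add: mult_left_le_one_le)
    then have "\<bar>\<xi> (x - s *\<^sub>R e)\<bar> \<le> \<bar>?w x\<bar>"
      using dominated_on_ballD[OF dominated_on_ball_translate[OF \<xi>(2)], of "s *\<^sub>R e" "norm e" x] by simp
    then show ?thesis using True by (simp only: abs_mult mult_left_mono mult_right_mono abs_ge_zero)
  qed simp
  then show "AE z in lborel \<Otimes>\<^sub>M lborel. norm (case z of (x, s) \<Rightarrow> g x * \<xi> (x - s *\<^sub>R e) * indicator {0..1} s)
        \<le> norm (case z of (x, s) \<Rightarrow> g x * ?w x * indicator {0..1} s)"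
    by (intro AE_I2) (auto simp: case_prod_beta)
  show "(\<lambda>(x, s). g x * \<xi> (x - s *\<^sub>R e) * indicator {0..1} s) \<in> borel_measurable (lborel \<Otimes>\<^sub>M lborel)" by measurable
qed

lemma integrable_sheared_mult: "integrable (lborel \<Otimes>\<^sub>M lborel) (\<lambda>(x, s). g (x + s *\<^sub>R e) * \<xi> x * indicator {0..1} s)"
  using integrable_shear[OF integrable_mult_sheared[of e], of e] by simp

lemma integral_sheared_mult:
  "(\<integral>(x, s). g (x + s *\<^sub>R e) * \<xi> x * indicator {0..1} s \<partial>(lborel \<Otimes>\<^sub>M lborel)) =
   (\<integral>(x, s). g x * \<xi> (x - s *\<^sub>R e) * indicator {0..1} s \<partial>(lborel \<Otimes>\<^sub>M lborel))"
  using integral_shear[OF integrable_mult_sheared[of e], of e] by simp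

end

context
  fixes u g :: "R2 \<Rightarrow> real" and e :: R2
  assumes u: "square_integrable lborel u" and g: "square_integrable lborel g" and deriv: "weak_dir_deriv e u g"
begin

lemma integral_mult_translation_diff:
  assumes \<phi>: "test_fun UNIV \<phi>"
  shows "(\<integral>x. u x * (\<phi> (x - e) - \<phi> x) \<partial>lborel) =
         (\<integral>(x, s). g x * \<phi> (x - s *\<^sub>R e) * indicator {0..1} s \<partial>(lborel \<Otimes>\<^sub>M lborel))"
proof -
  let ?D = "\<lambda>x. cgrad \<phi> x \<bullet> e"
  obtain M R where dom: "dominated_on_ball M R \<phi>" using test_fun_dominated_on_ball[OF \<phi>] .
  obtain M' R' where dom': "dominated_on_ball M' R' ?D" using dir_deriv_dominated_on_ball[OF \<phi>] .
  have "(\<integral>x. u x * (\<phi> (x - e) - \<phi> x) \<partial>lborel) =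
        - (\<integral>x. (\<integral>s. u x * ?D (x - s *\<^sub>R e) * indicator {0..1} s \<partial>lborel) \<partial>lborel)"
    by (simp add: test_fun_diff_eq_integral[OF \<phi>] mult.assoc)
  also have "\<dots> = - (\<integral>s. (\<integral>x. u x * ?D (x - s *\<^sub>R e) * indicator {0..1} s \<partial>lborel) \<partial>lborel)"
    by (subst lborel_pair.Fubini_integral[OF integrable_mult_sheared[OF u dir_deriv_borel[OF \<phi>] dom', of e]]) simp
  also have "\<dots> = (\<integral>s. (\<integral>x. g x * \<phi> (x - s *\<^sub>R e) * indicator {0..1} s \<partial>lborel) \<partial>lborel)"
    by (simp add: weak_dir_deriv_translate[OF deriv \<phi>])
  also have "\<dots> = (\<integral>(x, s). g x * \<phi> (x - s *\<^sub>R e) * indicator {0..1} s \<partial>(lborel \<Otimes>\<^sub>M lborel))"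
    by (rule lborel_pair.integral_snd[OF integrable_mult_sheared[OF g test_fun_borel[OF \<phi>] dom]])
  finally show ?thesis .
qed

lemma translation_identity:
  "AE x in lborel. u (x + e) - u x = (\<integral>s. g (x + s *\<^sub>R e) * indicator {0..1} s \<partial>lborel)"
proof -
  note [measurable] = square_integrable_lborel_measurable[OF u] square_integrable_lborel_measurable[OF g]
  let ?I = "\<lambda>x. \<integral>s. g (x + s *\<^sub>R e) * indicator {0..1} s \<partial>lborel"
  have "AE x in lborel. u (x + e) - u x - ?I x = 0"
  proof (rule fundamental_lemma_borel)
    show "(\<lambda>x. u (x + e) - u x - ?I x) \<in> borel_measurable borel" by measurable
    fix \<phi> assume \<phi>: "test_fun UNIV \<phi>"
    obtain M R where dom: "dominated_on_ball M R \<phi>" using test_fun_dominated_on_ball[OF \<phi>] .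
    note sheared = integrable_sheared_mult[OF g test_fun_borel[OF \<phi>] dom, of e]
    note \<phi>_L2 = test_fun_square_integrable(1)[OF \<phi>]
    have u_\<phi>: "integrable lborel (\<lambda>x. u x * \<phi> x)" "integrable lborel (\<lambda>x. u x * \<phi> (x - e))"
      "integrable lborel (\<lambda>x. u (x + e) * \<phi> x)"
      using integrable_mult_square_integrable[OF u \<phi>_L2]
        integrable_mult_square_integrable[OF u square_integrable_translate[OF \<phi>_L2, of "- e"]]
        integrable_mult_square_integrable[OF square_integrable_translate[OF u] \<phi>_L2] by auto
    have I_\<phi>: "(\<lambda>x. \<integral>s. g (x + s *\<^sub>R e) * \<phi> x * indicator {0..1} s \<partial>lborel) = (\<lambda>x. ?I x * \<phi> x)"
      by (rule ext, subst Bochner_Integration.integral_mult_left_zero[symmetric]) (simp add: mult_ac)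
    have I_\<phi>_integrable: "integrable lborel (\<lambda>x. ?I x * \<phi> x)"
      using lborel_pair.integrable_fst[OF sheared] unfolding I_\<phi> .
    have expand: "(\<lambda>x. (u (x + e) - u x - ?I x) * \<phi> x) = (\<lambda>x. u (x + e) * \<phi> x - u x * \<phi> x - ?I x * \<phi> x)"
      by (simp add: algebra_simps)
    show "integrable lborel (\<lambda>x. (u (x + e) - u x - ?I x) * \<phi> x)"
      unfolding expand by (intro Bochner_Integration.integrable_diff u_\<phi> I_\<phi>_integrable)
    have "(\<integral>x. ?I x * \<phi> x \<partial>lborel) = (\<integral>x. u x * (\<phi> (x - e) - \<phi> x) \<partial>lborel)"
      using lborel_pair.integral_fst[OF sheared]
      unfolding I_\<phi> integral_sheared_mult[OF g test_fun_borel[OF \<phi>] dom] integral_mult_translation_diff[OF \<phi>] .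
    also have "\<dots> = (\<integral>x. u (x + e) * \<phi> x \<partial>lborel) - (\<integral>x. u x * \<phi> x \<partial>lborel)"
      using u_\<phi> by (simp add: right_diff_distrib integral_lborel_translate_mult)
    finally show "(\<integral>x. (u (x + e) - u x - ?I x) * \<phi> x \<partial>lborel) = 0"
      unfolding expand using u_\<phi> I_\<phi>_integrable by simp
  qed
  then show ?thesis by eventually_elim simp
qed

lemma translation_estimate:
  assumes [measurable]: "E \<in> sets borel" "B \<in> sets borel"
    and segment: "\<And>x s. x \<in> E \<Longrightarrow> 0 \<le> s \<Longrightarrow> s \<le> 1 \<Longrightarrow> x + s *\<^sub>R e \<in> B"
  shows "(\<integral>\<^sup>+x. ennreal ((u (x + e) - u x)\<^sup>2) * indicator E x \<partial>lborel)
         \<le> (\<integral>\<^sup>+x. ennreal ((g x)\<^sup>2) * indicator B x \<partial>lborel)"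
proof -
  note [measurable] = square_integrable_lborel_measurable[OF u] square_integrable_lborel_measurable[OF g]
  have "(\<integral>\<^sup>+x. ennreal ((u (x + e) - u x)\<^sup>2) * indicator E x \<partial>lborel)
      \<le> (\<integral>\<^sup>+x. (\<integral>\<^sup>+s. ennreal ((g (x + s *\<^sub>R e))\<^sup>2) * indicator {0..1} s \<partial>lborel) * indicator E x \<partial>lborel)"
  proof (rule nn_integral_mono_AE)
    show "AE x in lborel. ennreal ((u (x + e) - u x)\<^sup>2) * indicator E x
        \<le> (\<integral>\<^sup>+s. ennreal ((g (x + s *\<^sub>R e))\<^sup>2) * indicator {0..1} s \<partial>lborel) * indicator E x"
      using translation_identity
    proof eventually_elim
      case (elim x)
      then show ?case using power2_integral_Icc_le_nn_integral[of "\<lambda>s. g (x + s *\<^sub>R e)"]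
        by (auto split: split_indicator)
    qed
  qed
  also have "\<dots> = (\<integral>\<^sup>+x. \<integral>\<^sup>+s. ennreal ((g (x + s *\<^sub>R e))\<^sup>2) * indicator {0..1} s * indicator E x \<partial>lborel \<partial>lborel)"
    by (subst nn_integral_multc) auto
  also have "\<dots> = (\<integral>\<^sup>+s. \<integral>\<^sup>+x. ennreal ((g (x + s *\<^sub>R e))\<^sup>2) * indicator {0..1} s * indicator E x \<partial>lborel \<partial>lborel)"
    by (rule lborel_pair.Fubini') measurable
  also have "\<dots> \<le> (\<integral>\<^sup>+s. \<integral>\<^sup>+x.
      (ennreal ((g (x + s *\<^sub>R e))\<^sup>2) * indicator B (x + s *\<^sub>R e)) * indicator {0..1} s \<partial>lborel \<partial>lborel)"
    using segment by (intro nn_integral_mono) (auto split: split_indicator)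
  also have "\<dots> = (\<integral>\<^sup>+s.
      (\<integral>\<^sup>+x. ennreal ((g (x + s *\<^sub>R e))\<^sup>2) * indicator B (x + s *\<^sub>R e) \<partial>lborel) * indicator {0..1} s \<partial>lborel)"
    by (subst nn_integral_multc) auto
  also have "\<dots> = (\<integral>\<^sup>+s. (\<integral>\<^sup>+x. ennreal ((g x)\<^sup>2) * indicator B x \<partial>lborel) * indicator {0..1::real} s \<partial>lborel)"
    by (simp add: nn_integral_lborel_translate[where f = "\<lambda>x. ennreal ((g x)\<^sup>2) * indicator B x"])
  also have "\<dots> = (\<integral>\<^sup>+x. ennreal ((g x)\<^sup>2) * indicator B x \<partial>lborel)"
    by (simp add: nn_integral_cmult_indicator)
  finally show ?thesis .
qed

end

lemma nn_integral_translation_diff_le: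
  assumes u: "square_integrable lborel u" and g: "square_integrable lborel g" and deriv: "weak_dir_deriv e u g"
  shows "(\<integral>\<^sup>+x. ennreal ((u (x + t *\<^sub>R e) - u x)\<^sup>2) \<partial>lborel) \<le> ennreal (t\<^sup>2 * (\<integral>x. (g x)\<^sup>2 \<partial>lborel))"
proof -
  have scaled_g: "square_integrable lborel (\<lambda>x. t * g x)" using square_integrable_scaleR[OF g, of t] by simp
  have "(\<integral>\<^sup>+x. ennreal ((u (x + t *\<^sub>R e) - u x)\<^sup>2) \<partial>lborel) \<le> (\<integral>\<^sup>+x. ennreal ((t * g x)\<^sup>2) \<partial>lborel)"
    using translation_estimate[OF u scaled_g weak_dir_deriv_scaleR[OF deriv], of UNIV UNIV] by simp
  also have "\<dots> = ennreal (\<integral>x. (t * g x)\<^sup>2 \<partial>lborel)"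
    by (rule nn_integral_eq_integral) (use integrable_power2[OF scaled_g] in auto)
  finally show ?thesis by (simp add: power_mult_distrib)
qed

subsection \<open>Difference quotients\<close>

definition mesh :: "nat \<Rightarrow> real" where "mesh n = 1 / (real n + 1)"

lemma mesh_pos: "0 < mesh n" and mesh_le_1: "mesh n \<le> 1"
  by (auto simp: mesh_def)

lemma mesh_tendsto_0: "mesh \<longlonglongrightarrow> 0"
  unfolding mesh_def using LIMSEQ_inverse_real_of_nat by (simp add: inverse_eq_divide add.commute)

lemma summable_mesh_power2: "summable (\<lambda>n. (mesh n)\<^sup>2)"
proof -
  have "summable (\<lambda>n. inverse (real (Suc n) ^ 2))"
    by (rule inverse_power_summable[THEN summable_Suc_iff[THEN iffD2]]) simp
  then show ?thesis by (simp add: mesh_def power_divide inverse_eq_divide add.commute)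
qed

lemma norm_mesh_scaleR_le: "norm (mesh n *\<^sub>R e) \<le> norm e"
  using mesh_pos[of n] mesh_le_1[of n] by (simp add: mult_left_le_one_le)

lemma mesh_difference_quotient_tendsto:
  assumes "(h has_real_derivative D) (at 0)" "c \<noteq> 0"
  shows "(\<lambda>n. (h (c * mesh n) - h 0) / mesh n) \<longlonglongrightarrow> c * D"
proof -
  have "(\<lambda>n. c * mesh n) \<longlonglongrightarrow> c * 0" by (intro tendsto_intros mesh_tendsto_0)
  then have "filterlim (\<lambda>n. c * mesh n) (at 0) sequentially"
    using mesh_pos assms(2) by (intro filterlim_atI) (auto simp: less_imp_neq[symmetric])
  then have "(\<lambda>n. (h (c * mesh n) - h 0) / (c * mesh n - 0)) \<longlonglongrightarrow> D"
    using assms(1) unfolding has_field_derivative_iff by (rule filterlim_compose[rotated])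
  then have "(\<lambda>n. c * ((h (c * mesh n) - h 0) / (c * mesh n - 0))) \<longlonglongrightarrow> c * D" by (intro tendsto_intros)
  moreover have "c * ((h (c * mesh n) - h 0) / (c * mesh n - 0)) = (h (c * mesh n) - h 0) / mesh n" for n
    using assms(2) mesh_pos[of n] by (simp add: field_simps)
  ultimately show ?thesis by simp
qed

lemma directional_quotient_tendsto:
  fixes \<phi> :: "'a::real_inner \<Rightarrow> real"
  assumes "(\<phi> has_derivative (\<lambda>v. w \<bullet> v)) (at x)" "c \<noteq> 0"
  shows "(\<lambda>n. (\<phi> (x + (c * mesh n) *\<^sub>R e) - \<phi> x) / mesh n) \<longlonglongrightarrow> c * (w \<bullet> e)"
  using mesh_difference_quotient_tendsto[OF has_real_derivative_along_line[of \<phi> w x 0 e] assms(2)] assms(1) by simp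

text \<open>Since the increments are square summable along \<^const>\<open>mesh\<close>, no subsequence is needed.\<close>

lemma AE_translation_tendsto:
  fixes r :: "real \<Rightarrow> real"
  assumes u: "square_integrable lborel u" and g: "square_integrable lborel g" and deriv: "weak_dir_deriv e u g"
    and r [measurable]: "r \<in> borel_measurable borel" and r_le: "\<And>s. s \<in> {0..1} \<Longrightarrow> \<bar>r s\<bar> \<le> 1"
  shows "AE (x, s) in lborel \<Otimes>\<^sub>M lborel. s \<in> {0..1} \<longrightarrow> (\<lambda>n. u (x + (mesh n * r s) *\<^sub>R e)) \<longlonglongrightarrow> u x"
proof -
  note [measurable] = square_integrable_lborel_measurable[OF u]
  let ?D = "\<lambda>n x s. (u (x + (mesh n * r s) *\<^sub>R e) - u x)\<^sup>2"
  define K where "K = (\<integral>x. (g x)\<^sup>2 \<partial>lborel)"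
  have K: "0 \<le> K" by (simp add: K_def)
  have slice_le: "(\<integral>\<^sup>+x. ennreal (?D n x s) \<partial>lborel) \<le> ennreal ((mesh n)\<^sup>2 * K)" if "s \<in> {0..1}" for n s
  proof -
    have "(r s)\<^sup>2 \<le> 1" using r_le[OF that] by (simp add: abs_square_le_1)
    then have "(mesh n)\<^sup>2 * (r s)\<^sup>2 * K \<le> (mesh n)\<^sup>2 * 1 * K" by (intro mult_right_mono mult_left_mono K) auto
    then have "ennreal ((mesh n * r s)\<^sup>2 * K) \<le> ennreal ((mesh n)\<^sup>2 * K)"
      by (intro ennreal_leI) (simp add: power_mult_distrib)
    with nn_integral_translation_diff_le[OF u g deriv, of "mesh n * r s"] show ?thesis
      unfolding K_def by (rule order_trans)
  qed
  have total_le: "(\<integral>\<^sup>+z. ennreal (case z of (x, s) \<Rightarrow> ?D n x s * indicator {0..1} s) \<partial>(lborel \<Otimes>\<^sub>M lborel))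
      \<le> ennreal ((mesh n)\<^sup>2 * K)" for n
  proof -
    have "(\<integral>\<^sup>+z. ennreal (case z of (x, s) \<Rightarrow> ?D n x s * indicator {0..1} s) \<partial>(lborel \<Otimes>\<^sub>M lborel))
        = (\<integral>\<^sup>+(x, s). ennreal (?D n x s) * indicator {0..1} s \<partial>(lborel \<Otimes>\<^sub>M lborel))"
      by (intro nn_integral_cong) (auto split: split_indicator)
    also have "\<dots> = (\<integral>\<^sup>+s. (\<integral>\<^sup>+x. ennreal (?D n x s) \<partial>lborel) * indicator {0..1} s \<partial>lborel)"
      by (subst lborel_pair.nn_integral_snd[symmetric]) (auto simp: nn_integral_multc)
    also have "\<dots> \<le> (\<integral>\<^sup>+s. ennreal ((mesh n)\<^sup>2 * K) * indicator {0..1::real} s \<partial>lborel)"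
      using slice_le by (intro nn_integral_mono) (auto split: split_indicator)
    also have "\<dots> = ennreal ((mesh n)\<^sup>2 * K)" by (simp add: nn_integral_cmult_indicator)
    finally show ?thesis .
  qed
  have "AE z in lborel \<Otimes>\<^sub>M lborel. (\<lambda>n. case z of (x, s) \<Rightarrow> ?D n x s * indicator {0..1} s) \<longlonglongrightarrow> 0"
    by (rule AE_tendsto_0_of_summable_nn_integral[OF _ _ total_le summable_mult2[OF summable_mesh_power2]])
       (use K in auto)
  then show ?thesis
  proof eventually_elim
    case (elim z)
    have "(\<lambda>n. u (x + (mesh n * r s) *\<^sub>R e)) \<longlonglongrightarrow> u x" if "z = (x, s)" "s \<in> {0..1}" for x s
      using tendsto_real_sqrt[OF elim] that by (simp add: tendsto_rabs_zero_iff LIM_zero_iff)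
    then show ?case by auto
  qed
qed

lemma integral_difference_quotient_mult:
  assumes u: "square_integrable lborel u" and g: "square_integrable lborel g" and deriv: "weak_dir_deriv e u g"
    and \<xi>: "\<xi> \<in> borel_measurable borel" "dominated_on_ball M R \<xi>" and t: "t \<noteq> 0"
  shows "(\<integral>x. (u (x + t *\<^sub>R e) - u x) / t * \<xi> x \<partial>lborel) =
         (\<integral>(x, s). g x * \<xi> (x - (t * s) *\<^sub>R e) * indicator {0..1} s \<partial>(lborel \<Otimes>\<^sub>M lborel))"
proof -
  note [measurable] = square_integrable_lborel_measurable[OF u] square_integrable_lborel_measurable[OF g] \<xi>(1)
  have scaled_g: "square_integrable lborel (\<lambda>x. t * g x)" using square_integrable_scaleR[OF g, of t] by simp
  have "(\<integral>x. (u (x + t *\<^sub>R e) - u x) / t * \<xi> x \<partial>lborel) =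
        (\<integral>x. (\<integral>s. g (x + s *\<^sub>R (t *\<^sub>R e)) * \<xi> x * indicator {0..1} s \<partial>lborel) \<partial>lborel)"
  proof (rule integral_cong_AE)
    show "AE x in lborel. (u (x + t *\<^sub>R e) - u x) / t * \<xi> x =
        (\<integral>s. g (x + s *\<^sub>R (t *\<^sub>R e)) * \<xi> x * indicator {0..1} s \<partial>lborel)"
      using translation_identity[OF u scaled_g weak_dir_deriv_scaleR[OF deriv]]
    proof eventually_elim
      case (elim x)
      let ?G = "\<lambda>s. g (x + s *\<^sub>R (t *\<^sub>R e)) * indicator {0..1} s"
      have "u (x + t *\<^sub>R e) - u x = t * (\<integral>s. ?G s \<partial>lborel)" using elim by (simp add: mult.assoc)
      moreover have "(\<integral>s. g (x + s *\<^sub>R (t *\<^sub>R e)) * \<xi> x * indicator {0..1} s \<partial>lborel) = (\<integral>s. ?G s \<partial>lborel) * \<xi> x"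
        by (subst Bochner_Integration.integral_mult_left_zero[symmetric]) (simp add: mult_ac)
      ultimately show ?case using t by simp
    qed
  qed measurable
  also have "\<dots> = (\<integral>(x, s). g (x + s *\<^sub>R (t *\<^sub>R e)) * \<xi> x * indicator {0..1} s \<partial>(lborel \<Otimes>\<^sub>M lborel))"
    by (rule lborel_pair.integral_fst[OF integrable_sheared_mult[OF g \<xi>]])
  also have "\<dots> = (\<integral>(x, s). g x * \<xi> (x - s *\<^sub>R (t *\<^sub>R e)) * indicator {0..1} s \<partial>(lborel \<Otimes>\<^sub>M lborel))"
    by (rule integral_sheared_mult[OF g \<xi>])
  finally show ?thesis by (simp add: mult.commute)
qed

lemma integral_difference_quotient_mult_tendsto:
  assumes u: "square_integrable lborel u" and g: "square_integrable lborel g" and deriv: "weak_dir_deriv e u g"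
    and [measurable]: "\<And>n. \<xi> n \<in> borel_measurable borel" "\<eta> \<in> borel_measurable borel"
    and dom: "\<And>n. dominated_on_ball M R (\<xi> n)"
    and lim: "AE (x, s) in lborel \<Otimes>\<^sub>M lborel. s \<in> {0..1} \<longrightarrow> (\<lambda>n. \<xi> n (x - (mesh n * s) *\<^sub>R e)) \<longlonglongrightarrow> \<eta> x"
  shows "(\<lambda>n. \<integral>x. (u (x + mesh n *\<^sub>R e) - u x) / mesh n * \<xi> n x \<partial>lborel) \<longlonglongrightarrow> (\<integral>x. g x * \<eta> x \<partial>lborel)"
proof -
  note [measurable] = square_integrable_lborel_measurable[OF g]
  let ?P = "lborel \<Otimes>\<^sub>M lborel :: (R2 \<times> real) measure"
  let ?h = "\<lambda>n. \<lambda>(x, s). g x * \<xi> n (x - (mesh n * s) *\<^sub>R e) * indicator {0..1} s"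
  let ?H = "\<lambda>(x, s::real). g x * \<eta> x * indicator {0..1} s"
  let ?w = "\<lambda>x::R2. M * indicator (ball 0 (R + norm e)) x"
  have w_integrable: "integrable ?P (\<lambda>z. \<bar>case z of (x, s) \<Rightarrow> g x * ?w x * indicator {0..1} s\<bar>)"
    by (intro integrable_abs lborel_pair.integrable_mult_pair_measure integrable_mult_indicator_ball g) simp
  have limit: "AE z in ?P. (\<lambda>n. ?h n z) \<longlonglongrightarrow> ?H z"
    using lim
  proof eventually_elim
    case (elim z)
    then show ?case by (cases z, cases "snd z \<in> {0..1}") (auto intro!: tendsto_intros)
  qed
  have "\<bar>g x * \<xi> n (x - (mesh n * s) *\<^sub>R e) * indicator {0..1} s\<bar> \<le> \<bar>g x * ?w x * indicator {0..1} s\<bar>" for x s n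
  proof (cases "s \<in> {0..1}")
    case True
    then have "norm ((mesh n * s) *\<^sub>R e) \<le> norm e"
      using mesh_pos[of n] mesh_le_1[of n] by (simp add: abs_mult mult_le_one mult_left_le_one_le)
    then have "\<bar>\<xi> n (x - (mesh n * s) *\<^sub>R e)\<bar> \<le> \<bar>?w x\<bar>"
      using dominated_on_ballD[OF dominated_on_ball_translate[OF dom], of "(mesh n * s) *\<^sub>R e" "norm e" n x] by simp
    then show ?thesis using True by (simp only: abs_mult mult_left_mono mult_right_mono abs_ge_zero)
  qed simp
  then have bound: "AE z in ?P. norm (?h n z) \<le> \<bar>case z of (x, s) \<Rightarrow> g x * ?w x * indicator {0..1} s\<bar>" for n
    by (intro AE_I2) (auto simp: case_prod_beta)
  have "?H \<in> borel_measurable ?P" "?h n \<in> borel_measurable ?P" for n by measurable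
  note convergence = this w_integrable limit bound
  note H_integrable = integrable_dominated_convergence[OF convergence]
  have "(\<lambda>n. \<integral>z. ?h n z \<partial>?P) \<longlonglongrightarrow> (\<integral>z. ?H z \<partial>?P)"
    by (rule integral_dominated_convergence[OF convergence])
  also have "(\<integral>z. ?H z \<partial>?P) = (\<integral>x. g x * \<eta> x \<partial>lborel)"
    using lborel_pair.integral_fst[OF H_integrable] by simp
  finally show ?thesis
    unfolding integral_difference_quotient_mult[OF u g deriv assms(4) dom less_imp_neq[OF mesh_pos, symmetric]] .
qed

lemma integral_diff_translate_mult:
  fixes z \<psi> :: "'a::euclidean_space \<Rightarrow> real"
  assumes "square_integrable lborel z" "square_integrable lborel \<psi>"
  shows "(\<integral>x. (z (x + a) - z x) * \<psi> x \<partial>lborel) = (\<integral>x. z x * (\<psi> (x - a) - \<psi> x) \<partial>lborel)"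
proof -
  have "(\<integral>x. (z (x + a) - z x) * \<psi> x \<partial>lborel) = (\<integral>x. z (x + a) * \<psi> x \<partial>lborel) - (\<integral>x. z x * \<psi> x \<partial>lborel)"
    using integrable_mult_square_integrable[OF square_integrable_translate[OF assms(1)] assms(2)]
      integrable_mult_square_integrable[OF assms] by (simp add: left_diff_distrib)
  also have "\<dots> = (\<integral>x. z x * (\<psi> (x - a) - \<psi> x) \<partial>lborel)"
    using integrable_mult_square_integrable[OF assms(1) square_integrable_translate[OF assms(2), of "- a"]]
      integrable_mult_square_integrable[OF assms] by (simp add: right_diff_distrib integral_lborel_translate_mult)
  finally show ?thesis .
qed

lemma lipschitz_difference_quotient_dominated_on_ball:
  fixes \<psi> :: "'a::real_normed_vector \<Rightarrow> real"
  assumes lip: "L-lipschitz_on UNIV \<psi>" and zero: "\<And>x. R \<le> norm x \<Longrightarrow> \<psi> x = 0"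
  shows "dominated_on_ball (L * norm e) (R + norm e) (\<lambda>x. (\<psi> (x - mesh n *\<^sub>R e) - \<psi> x) / mesh n)"
proof (rule dominated_on_ballI)
  show "0 \<le> L * norm e" using lipschitz_on_nonneg[OF lip] by simp
  show "norm ((\<psi> (x - mesh n *\<^sub>R e) - \<psi> x) / mesh n) \<le> L * norm e" for x
    using lipschitz_on_normD[OF lip, of "x - mesh n *\<^sub>R e" x] mesh_pos[of n] by (simp add: divide_le_eq mult_ac)
  show "(\<psi> (x - mesh n *\<^sub>R e) - \<psi> x) / mesh n = 0" if "R + norm e \<le> norm x" for x
  proof -
    have "R \<le> norm (x - mesh n *\<^sub>R e)"
      using that norm_mesh_scaleR_le[of n e] norm_triangle_ineq2[of x "mesh n *\<^sub>R e"] by simp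
    moreover have "R \<le> norm x" using that norm_ge_zero[of e] by linarith
    ultimately show ?thesis by (simp add: zero)
  qed
qed

lemma difference_quotient_mult_test_fun_tendsto:
  assumes z: "square_integrable lborel z" and \<psi>: "test_fun UNIV \<psi>"
  shows "(\<lambda>n. \<integral>x. (z (x + mesh n *\<^sub>R e) - z x) / mesh n * \<psi> x \<partial>lborel) \<longlonglongrightarrow> - (\<integral>x. z x * (cgrad \<psi> x \<bullet> e) \<partial>lborel)"
proof -
  note [measurable] = square_integrable_lborel_measurable[OF z] test_fun_borel[OF \<psi>] dir_deriv_borel[OF \<psi>]
  let ?q = "\<lambda>n x. (\<psi> (x - mesh n *\<^sub>R e) - \<psi> x) / mesh n"
  obtain L R' where "dominated_on_ball L R' (cgrad \<psi>)" using cgrad_dominated_on_ball[OF \<psi>] .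
  then have lip: "L-lipschitz_on UNIV \<psi>" by (intro test_fun_lipschitz[OF \<psi>] dominated_on_ball_bound)
  obtain M R where "dominated_on_ball M R \<psi>" using test_fun_dominated_on_ball[OF \<psi>] .
  then have "dominated_on_ball (L * norm e) (R + norm e) (?q n)" for n
    by (intro lipschitz_difference_quotient_dominated_on_ball[OF lip] dominated_on_ball_eq_0)
  note q_le = dominated_on_ballD[OF this]
  let ?w = "\<lambda>x::R2. L * norm e * indicator (ball 0 (R + norm e)) x"
  have w_integrable: "integrable lborel (\<lambda>x. \<bar>z x * ?w x\<bar>)"
    by (intro integrable_abs integrable_mult_indicator_ball z)
  have "(\<lambda>n. \<integral>x. z x * ?q n x \<partial>lborel) \<longlonglongrightarrow> (\<integral>x. z x * - (cgrad \<psi> x \<bullet> e) \<partial>lborel)"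
  proof (rule integral_dominated_convergence[OF _ _ w_integrable])
    show "AE x in lborel. (\<lambda>n. z x * ?q n x) \<longlonglongrightarrow> z x * - (cgrad \<psi> x \<bullet> e)"
      using directional_quotient_tendsto[OF test_fun_has_derivative[OF \<psi>], of "- 1" _ e]
      by (intro AE_I2 tendsto_intros) simp
    show "AE x in lborel. norm (z x * ?q n x) \<le> \<bar>z x * ?w x\<bar>" for n
      unfolding real_norm_def abs_mult[of "z _"]
      using q_le by (intro AE_I2 mult_left_mono) (auto intro: order_trans[OF _ abs_ge_self])
  qed measurable
  then have lim: "(\<lambda>n. \<integral>x. z x * ?q n x \<partial>lborel) \<longlonglongrightarrow> - (\<integral>x. z x * (cgrad \<psi> x \<bullet> e) \<partial>lborel)" by simp
  have by_parts: "(\<integral>x. (z (x + mesh n *\<^sub>R e) - z x) / mesh n * \<psi> x \<partial>lborel) = (\<integral>x. z x * ?q n x \<partial>lborel)" for n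
    using integral_diff_translate_mult[OF z test_fun_square_integrable(1)[OF \<psi>], of "mesh n *\<^sub>R e"] by simp
  show ?thesis unfolding by_parts by (rule lim)
qed

lemma weak_dir_deriv_of_difference_quotients:
  assumes "square_integrable lborel z"
    and "\<And>\<psi>. test_fun UNIV \<psi> \<Longrightarrow>
      (\<lambda>n. \<integral>x. (z (x + mesh n *\<^sub>R e) - z x) / mesh n * \<psi> x \<partial>lborel) \<longlonglongrightarrow> (\<integral>x. h x * \<psi> x \<partial>lborel)"
  shows "weak_dir_deriv e z h"
  unfolding weak_dir_deriv_def
proof (intro allI impI)
  fix \<psi> assume \<psi>: "test_fun UNIV \<psi>"
  from LIMSEQ_unique[OF difference_quotient_mult_test_fun_tendsto[OF assms(1) \<psi>] assms(2)[OF \<psi>]]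
  show "(\<integral>x. z x * (cgrad \<psi> x \<bullet> e) \<partial>lborel) = - (\<integral>x. h x * \<psi> x \<partial>lborel)" by simp
qed

subsection \<open>Chain rule and product rule for weak directional derivatives\<close>

definition divided_difference :: "(real \<Rightarrow> real) \<Rightarrow> (real \<Rightarrow> real) \<Rightarrow> real \<Rightarrow> real \<Rightarrow> real" where
  "divided_difference T T' a b = (if a = b then T' a else (T b - T a) / (b - a))"

lemma divided_difference_mult: "divided_difference T T' a b * (b - a) = T b - T a"
  by (simp add: divided_difference_def)

lemma divided_difference_commute: "divided_difference T T' a b = divided_difference T T' b a"
  unfolding divided_difference_def by (metis minus_diff_eq minus_divide_divide)

definition bounded_C1_on :: "real set \<Rightarrow> real \<Rightarrow> (real \<Rightarrow> real) \<Rightarrow> (real \<Rightarrow> real) \<Rightarrow> bool" where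
  "bounded_C1_on I L T T' \<longleftrightarrow> is_interval I \<and> I \<in> sets borel \<and>
     (\<forall>s\<in>I. (T has_real_derivative T' s) (at s within I)) \<and> continuous_on I T' \<and> (\<forall>s\<in>I. \<bar>T' s\<bar> \<le> L) \<and>
     T \<in> borel_measurable borel \<and> T' \<in> borel_measurable borel"

lemma bounded_C1_onD:
  assumes "bounded_C1_on I L T T'"
  shows "is_interval I" "I \<in> sets borel" "\<And>s. s \<in> I \<Longrightarrow> (T has_real_derivative T' s) (at s within I)"
    "continuous_on I T'" "\<And>s. s \<in> I \<Longrightarrow> \<bar>T' s\<bar> \<le> L" "T \<in> borel_measurable borel" "T' \<in> borel_measurable borel"
  using assms by (auto simp: bounded_C1_on_def)

lemma bounded_C1_on_UNIV_I:
  assumes deriv: "\<And>s. (T has_real_derivative T' s) (at s)" and T': "continuous_on UNIV T'" "\<And>s. \<bar>T' s\<bar> \<le> L"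
  shows "bounded_C1_on UNIV L T T'"
proof -
  have "continuous_on UNIV T" using deriv by (meson DERIV_isCont continuous_at_imp_continuous_on)
  then show ?thesis
    using assms by (auto simp: bounded_C1_on_def intro: borel_measurable_continuous_onI)
qed

lemma bounded_C1_on_abs_le:
  assumes "bounded_C1_on I L T T'" "0 \<in> I" "T 0 = 0" "s \<in> I"
  shows "\<bar>T s\<bar> \<le> L * \<bar>s\<bar>"
  using field_differentiable_bound[of I T T' L s 0] bounded_C1_onD[OF assms(1)] assms(2-4)
  by (simp add: is_interval_convex)

lemma divided_difference_mean_value:
  assumes T: "bounded_C1_on I L T T'" and ab: "a \<in> I" "b \<in> I"
  shows "\<exists>c\<in>I. min a b \<le> c \<and> c \<le> max a b \<and> divided_difference T T' a b = T' c"
  using ab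
proof (induction a b rule: linorder_wlog)
  case (le a b)
  show ?case
  proof (cases "a = b")
    case True
    then show ?thesis using le by (auto simp: divided_difference_def)
  next
    case False
    with le have "a < b" by simp
    have sub: "{a..b} \<subseteq> I" using mem_is_interval_1_I[OF bounded_C1_onD(1)[OF T] le(2,3)] by auto
    have "\<exists>c\<in>{a<..<b}. T b - T a = T' c * (b - a)"
    proof (rule mvt_simple[OF \<open>a < b\<close>])
      fix c assume "a \<le> c" "c \<le> b"
      then have "(T has_real_derivative T' c) (at c within I)" using sub by (intro bounded_C1_onD(3)[OF T]) auto
      from DERIV_subset[OF this sub] show "(T has_derivative (*) (T' c)) (at c within {a..b})"
        by (simp add: has_field_derivative_def)
    qed
    then obtain c where "a < c" "c < b" "T b - T a = T' c * (b - a)" by auto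
    then show ?thesis using sub \<open>a < b\<close> by (intro bexI[of _ c]) (auto simp: divided_difference_def)
  qed
next
  case (sym a b)
  then show ?case by (simp add: divided_difference_commute[of T T' b a] min.commute max.commute)
qed

lemma divided_difference_abs_le:
  assumes "bounded_C1_on I L T T'" "a \<in> I" "b \<in> I"
  shows "\<bar>divided_difference T T' a b\<bar> \<le> L"
  using divided_difference_mean_value[OF assms] bounded_C1_onD(5)[OF assms(1)] by metis

lemma divided_difference_tendsto:
  assumes T: "bounded_C1_on I L T T'" and I: "\<And>n. a n \<in> I" "\<And>n. b n \<in> I" "d \<in> I"
    and lim: "a \<longlonglongrightarrow> d" "b \<longlonglongrightarrow> d"
  shows "(\<lambda>n. divided_difference T T' (a n) (b n)) \<longlonglongrightarrow> T' d"
proof -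
  have "\<exists>c. c \<in> I \<and> min (a n) (b n) \<le> c \<and> c \<le> max (a n) (b n) \<and> divided_difference T T' (a n) (b n) = T' c" for n
    using divided_difference_mean_value[OF T I(1)[of n] I(2)[of n]] by blast
  then obtain c where c: "\<And>n. c n \<in> I" "\<And>n. min (a n) (b n) \<le> c n" "\<And>n. c n \<le> max (a n) (b n)"
    "\<And>n. divided_difference T T' (a n) (b n) = T' (c n)" by metis
  have "c \<longlonglongrightarrow> d"
  proof (rule tendsto_sandwich)
    show "(\<lambda>n. min (a n) (b n)) \<longlonglongrightarrow> d" "(\<lambda>n. max (a n) (b n)) \<longlonglongrightarrow> d"
      using tendsto_min[OF lim] tendsto_max[OF lim] by simp_all
  qed (use c in auto)
  then have "(\<lambda>n. T' (c n)) \<longlonglongrightarrow> T' d"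
    using I(3) c(1) by (intro continuous_on_tendsto_compose[OF bounded_C1_onD(4)[OF T]]) auto
  then show ?thesis by (simp add: c(4))
qed

lemma square_integrable_chain:
  assumes u: "square_integrable M u" and I: "\<And>x. u x \<in> I" "0 \<in> I" and T: "bounded_C1_on I L T T'" "T 0 = 0"
  shows "square_integrable M (\<lambda>x. T (u x))"
proof (rule square_integrable_dominated[OF u])
  show "(\<lambda>x. T (u x)) \<in> borel_measurable M"
    using square_integrable_measurable[OF u] bounded_C1_onD(6)[OF T(1)] by measurable
  show "norm (T (u x)) \<le> L * norm (u x)" for x
    using bounded_C1_on_abs_le[OF T(1) I(2) T(2) I(1)] by simp
qed

lemma continuous_mesh_tendsto:
  fixes \<phi> :: "'a::real_normed_vector \<Rightarrow> 'b::topological_space"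
  assumes "continuous_on UNIV \<phi>"
  shows "(\<lambda>n. \<phi> (x + (mesh n * c) *\<^sub>R e)) \<longlonglongrightarrow> \<phi> x"
proof -
  have "(\<lambda>n. x + (mesh n * c) *\<^sub>R e) \<longlonglongrightarrow> x + (0 * c) *\<^sub>R e" by (intro tendsto_intros mesh_tendsto_0)
  then have "(\<lambda>n. x + (mesh n * c) *\<^sub>R e) \<longlonglongrightarrow> x" by simp
  from continuous_on_tendsto_compose[OF assms this] show ?thesis by simp
qed

lemma weak_dir_deriv_chain:
  assumes u: "square_integrable lborel u" and g: "square_integrable lborel g" and deriv: "weak_dir_deriv e u g"
    and I: "\<And>x. u x \<in> I" "0 \<in> I" and T: "bounded_C1_on I L T T'" "T 0 = 0"
  shows "weak_dir_deriv e (\<lambda>x. T (u x)) (\<lambda>x. T' (u x) * g x)"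
proof (rule weak_dir_deriv_of_difference_quotients[OF square_integrable_chain[OF u I T]])
  fix \<psi> assume \<psi>: "test_fun UNIV \<psi>"
  note [measurable] = square_integrable_lborel_measurable[OF u] test_fun_borel[OF \<psi>] bounded_C1_onD(6,7)[OF T(1)]
  obtain M R where dom: "dominated_on_ball M R \<psi>" using test_fun_dominated_on_ball[OF \<psi>] .
  define \<xi> where "\<xi> n x = divided_difference T T' (u x) (u (x + mesh n *\<^sub>R e)) * \<psi> x" for n x
  have \<xi>_borel: "\<xi> n \<in> borel_measurable borel" for n unfolding \<xi>_def divided_difference_def by measurable
  have "0 \<le> L" using bounded_C1_onD(5)[OF T(1) I(2)] by linarith
  have \<xi>_dom: "dominated_on_ball (L * M) R (\<xi> n)" for n
    by (rule dominated_on_ball_mono[OF dom \<open>0 \<le> L\<close>])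
       (simp add: \<xi>_def abs_mult mult_right_mono divided_difference_abs_le[OF T(1)] I(1))
  have "(\<lambda>n. \<integral>x. (u (x + mesh n *\<^sub>R e) - u x) / mesh n * \<xi> n x \<partial>lborel) \<longlonglongrightarrow> (\<integral>x. g x * (T' (u x) * \<psi> x) \<partial>lborel)"
  proof (rule integral_difference_quotient_mult_tendsto[OF u g deriv \<xi>_borel _ \<xi>_dom])
    have "AE (x, s) in lborel \<Otimes>\<^sub>M lborel. s \<in> {0..1} \<longrightarrow> (\<lambda>n. u (x + (mesh n * (- s)) *\<^sub>R e)) \<longlonglongrightarrow> u x"
      "AE (x, s) in lborel \<Otimes>\<^sub>M lborel. s \<in> {0..1} \<longrightarrow> (\<lambda>n. u (x + (mesh n * (1 - s)) *\<^sub>R e)) \<longlonglongrightarrow> u x"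
      by (rule AE_translation_tendsto[OF u g deriv]; auto)+
    then show "AE (x, s) in lborel \<Otimes>\<^sub>M lborel. s \<in> {0..1} \<longrightarrow> (\<lambda>n. \<xi> n (x - (mesh n * s) *\<^sub>R e)) \<longlonglongrightarrow> T' (u x) * \<psi> x"
    proof eventually_elim
      case (elim z)
      have "(\<lambda>n. \<xi> n (x - (mesh n * s) *\<^sub>R e)) \<longlonglongrightarrow> T' (u x) * \<psi> x" if z: "z = (x, s)" "s \<in> {0..1}" for x s
      proof -
        have shift: "x - (mesh n * s) *\<^sub>R e + mesh n *\<^sub>R e = x + (mesh n * (1 - s)) *\<^sub>R e" for n
          by (simp add: algebra_simps)
        have "(\<lambda>n. divided_difference T T' (u (x - (mesh n * s) *\<^sub>R e)) (u (x + (mesh n * (1 - s)) *\<^sub>R e))) \<longlonglongrightarrow> T' (u x)"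
          using elim z by (intro divided_difference_tendsto[OF T(1)] I(1)) auto
        moreover have "(\<lambda>n. \<psi> (x - (mesh n * s) *\<^sub>R e)) \<longlonglongrightarrow> \<psi> x"
          using continuous_mesh_tendsto[OF test_fun_continuous[OF \<psi>], of x "- s" e] by simp
        ultimately show ?thesis unfolding \<xi>_def shift by (rule tendsto_mult)
      qed
      then show ?case by auto
    qed
  qed measurable
  moreover have "(T (u (x + mesh n *\<^sub>R e)) - T (u x)) / mesh n * \<psi> x =
      (u (x + mesh n *\<^sub>R e) - u x) / mesh n * \<xi> n x" for n x
    unfolding \<xi>_def divided_difference_mult[of T T' "u x" "u (x + mesh n *\<^sub>R e)", symmetric] by (simp add: mult_ac)
  ultimately show "(\<lambda>n. \<integral>x. (T (u (x + mesh n *\<^sub>R e)) - T (u x)) / mesh n * \<psi> x \<partial>lborel)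
      \<longlonglongrightarrow> (\<integral>x. T' (u x) * g x * \<psi> x \<partial>lborel)"
    by (simp only: mult_ac)
qed

definition bounded_lipschitz_grad :: "('a::euclidean_space \<Rightarrow> real) \<Rightarrow> ('a \<Rightarrow> 'a) \<Rightarrow> bool" where
  "bounded_lipschitz_grad \<phi> \<Phi> \<longleftrightarrow> bounded (range \<phi>) \<and> bounded (range \<Phi>) \<and> (\<exists>L. L-lipschitz_on UNIV \<phi>) \<and>
     \<Phi> \<in> borel_measurable borel \<and> (AE x in lborel. (\<phi> has_derivative (\<lambda>v. \<Phi> x \<bullet> v)) (at x))"

lemma bounded_lipschitz_gradE:
  assumes "bounded_lipschitz_grad \<phi> \<Phi>"
  obtains M N L where "0 \<le> M" "\<forall>x. \<bar>\<phi> x\<bar> \<le> M" "\<forall>x. norm (\<Phi> x) \<le> N" "L-lipschitz_on UNIV \<phi>"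
proof -
  obtain M N where "0 < M" "\<forall>x. \<bar>\<phi> x\<bar> \<le> M" "\<forall>x. norm (\<Phi> x) \<le> N"
    using assms by (auto simp: bounded_lipschitz_grad_def bounded_pos)
  with that show ?thesis using assms less_imp_le unfolding bounded_lipschitz_grad_def by metis
qed

lemma bounded_lipschitz_grad_continuous: "bounded_lipschitz_grad \<phi> \<Phi> \<Longrightarrow> continuous_on UNIV \<phi>"
  by (auto simp: bounded_lipschitz_grad_def intro: lipschitz_on_continuous_on)

lemma bounded_lipschitz_grad_borel:
  assumes "bounded_lipschitz_grad \<phi> \<Phi>"
  shows "\<phi> \<in> borel_measurable borel" "\<Phi> \<in> borel_measurable borel"
  using assms borel_measurable_continuous_onI[OF bounded_lipschitz_grad_continuous[OF assms]]
  by (auto simp: bounded_lipschitz_grad_def)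

lemma test_fun_bounded_lipschitz_grad:
  assumes \<phi>: "test_fun UNIV \<phi>"
  shows "bounded_lipschitz_grad \<phi> (cgrad \<phi>)"
  unfolding bounded_lipschitz_grad_def
proof (intro conjI)
  obtain M R where "dominated_on_ball M R \<phi>" using test_fun_dominated_on_ball[OF \<phi>] .
  from dominated_on_ball_bound[OF this] show "bounded (range \<phi>)" unfolding bounded_iff by blast
  obtain L R where "dominated_on_ball L R (cgrad \<phi>)" using cgrad_dominated_on_ball[OF \<phi>] .
  note L = dominated_on_ball_bound[OF this]
  show "bounded (range (cgrad \<phi>))" unfolding bounded_iff using L by blast
  show "\<exists>L. L-lipschitz_on UNIV \<phi>" using test_fun_lipschitz[OF \<phi> L] by blast
  show "AE x in lborel. (\<phi> has_derivative (\<lambda>v. cgrad \<phi> x \<bullet> v)) (at x)"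
    using test_fun_has_derivative[OF \<phi>] by simp
qed (rule cgrad_borel[OF \<phi>])

lemma square_integrable_bounded_lipschitz_mult:
  fixes v :: "'a::euclidean_space \<Rightarrow> 'b::{real_normed_vector, second_countable_topology}"
  assumes \<phi>: "bounded_lipschitz_grad \<phi> \<Phi>" and v: "square_integrable lborel v"
  shows "square_integrable lborel (\<lambda>x. \<phi> x *\<^sub>R v x)"
proof -
  obtain M N L where "0 \<le> M" "\<forall>x. \<bar>\<phi> x\<bar> \<le> M" "\<forall>x. norm (\<Phi> x) \<le> N" "L-lipschitz_on UNIV \<phi>"
    using bounded_lipschitz_gradE[OF \<phi>] .
  then show ?thesis
    using bounded_lipschitz_grad_borel(1)[OF \<phi>] by (intro square_integrable_bounded_scaleR[OF v]) auto
qed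

lemma square_integrable_mult_bounded_lipschitz_grad:
  fixes v :: "'a::euclidean_space \<Rightarrow> real"
  assumes \<phi>: "bounded_lipschitz_grad \<phi> \<Phi>" and v: "square_integrable lborel v"
  shows "square_integrable lborel (\<lambda>x. v x *\<^sub>R \<Phi> x)"
proof -
  note [measurable] = bounded_lipschitz_grad_borel(2)[OF \<phi>] square_integrable_lborel_measurable[OF v]
  obtain M N L where "0 \<le> M" "\<forall>x. \<bar>\<phi> x\<bar> \<le> M" "\<forall>x. norm (\<Phi> x) \<le> N" "L-lipschitz_on UNIV \<phi>"
    using bounded_lipschitz_gradE[OF \<phi>] .
  then have "norm (v x *\<^sub>R \<Phi> x) \<le> N * norm (v x)" for x by (simp add: mult.commute[of N] mult_left_mono)
  then show ?thesis by (intro square_integrable_dominated[OF v]) auto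
qed

context
  fixes u \<psi> \<phi> :: "'a::euclidean_space \<Rightarrow> real" and \<Phi> :: "'a \<Rightarrow> 'a"
  assumes u: "square_integrable lborel u" and \<psi>: "square_integrable lborel \<psi>" and \<phi>: "bounded_lipschitz_grad \<phi> \<Phi>"
begin

lemma lipschitz_quotient_bounded: "\<exists>K. \<forall>n x. \<bar>(\<phi> (x + mesh n *\<^sub>R e) - \<phi> x) / mesh n\<bar> \<le> K"
proof -
  obtain L where "L-lipschitz_on UNIV \<phi>" using \<phi> by (auto simp: bounded_lipschitz_grad_def)
  then have "\<bar>(\<phi> (x + mesh n *\<^sub>R e) - \<phi> x) / mesh n\<bar> \<le> L * norm e" for n x
    using lipschitz_on_normD[of L UNIV \<phi> "x + mesh n *\<^sub>R e" x] mesh_pos[of n] by (simp add: divide_le_eq mult_ac)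
  then show ?thesis by blast
qed

lemma integral_mult_lipschitz_quotient_tendsto:
  "(\<lambda>n. \<integral>x. u x * ((\<phi> (x + mesh n *\<^sub>R e) - \<phi> x) / mesh n * \<psi> x) \<partial>lborel)
    \<longlonglongrightarrow> (\<integral>x. u x * ((\<Phi> x \<bullet> e) * \<psi> x) \<partial>lborel)"
proof -
  note [measurable] = square_integrable_lborel_measurable[OF u] square_integrable_lborel_measurable[OF \<psi>]
    bounded_lipschitz_grad_borel[OF \<phi>]
  let ?q = "\<lambda>n x. (\<phi> (x + mesh n *\<^sub>R e) - \<phi> x) / mesh n"
  obtain K where K: "\<And>n x. \<bar>?q n x\<bar> \<le> K" using lipschitz_quotient_bounded by blast
  have "AE x in lborel. (\<phi> has_derivative (\<lambda>v. \<Phi> x \<bullet> v)) (at x)" using \<phi> by (simp add: bounded_lipschitz_grad_def)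
  then have quotient: "AE x in lborel. (\<lambda>n. ?q n x) \<longlonglongrightarrow> \<Phi> x \<bullet> e"
  proof eventually_elim
    case (elim x)
    then show ?case using directional_quotient_tendsto[of \<phi> "\<Phi> x" x 1 e] by simp
  qed
  show ?thesis
  proof (rule integral_dominated_convergence[where w = "\<lambda>x. \<bar>u x * (K * \<psi> x)\<bar>"])
    show "integrable lborel (\<lambda>x. \<bar>u x * (K * \<psi> x)\<bar>)"
      using square_integrable_scaleR[OF \<psi>, of K] by (intro integrable_abs integrable_mult_square_integrable u) simp
    show "AE x in lborel. (\<lambda>n. u x * (?q n x * \<psi> x)) \<longlonglongrightarrow> u x * ((\<Phi> x \<bullet> e) * \<psi> x)"
      using quotient by eventually_elim (intro tendsto_intros)
    have "\<bar>u x * (?q n x * \<psi> x)\<bar> \<le> \<bar>u x * (K * \<psi> x)\<bar>" for n x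
      using order_trans[OF K[of x n] abs_ge_self] by (simp only: abs_mult mult_left_mono mult_right_mono abs_ge_zero)
    then show "AE x in lborel. norm (u x * (?q n x * \<psi> x)) \<le> \<bar>u x * (K * \<psi> x)\<bar>" for n
      by simp
  qed measurable
qed

lemma integrable_mult_bounded_lipschitz_grad_inner: "integrable lborel (\<lambda>x. u x * ((\<Phi> x \<bullet> e) * \<psi> x))"
proof (rule integrable_mult_square_integrable[OF u], rule square_integrable_dominated)
  note [measurable] = square_integrable_lborel_measurable[OF \<psi>] bounded_lipschitz_grad_borel[OF \<phi>]
  show "square_integrable lborel (\<lambda>x. \<psi> x *\<^sub>R \<Phi> x)" by (rule square_integrable_mult_bounded_lipschitz_grad[OF \<phi> \<psi>])
  show "norm ((\<Phi> x \<bullet> e) * \<psi> x) \<le> norm e * norm (\<psi> x *\<^sub>R \<Phi> x)" for x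
    using mult_left_mono[OF Cauchy_Schwarz_ineq2[of "\<Phi> x" e] abs_ge_zero[of "\<psi> x"]] by (simp add: abs_mult mult_ac)
  show "(\<lambda>x. (\<Phi> x \<bullet> e) * \<psi> x) \<in> borel_measurable lborel" by measurable
qed

lemma integral_product_quotient:
  "(\<integral>x. (\<phi> (x + mesh n *\<^sub>R e) * u (x + mesh n *\<^sub>R e) - \<phi> x * u x) / mesh n * \<psi> x \<partial>lborel) =
   (\<integral>x. (u (x + mesh n *\<^sub>R e) - u x) / mesh n * (\<phi> (x + mesh n *\<^sub>R e) * \<psi> x) \<partial>lborel) +
   (\<integral>x. u x * ((\<phi> (x + mesh n *\<^sub>R e) - \<phi> x) / mesh n * \<psi> x) \<partial>lborel)"
proof -
  note [measurable] = bounded_lipschitz_grad_borel[OF \<phi>]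
  let ?q = "\<lambda>x. (\<phi> (x + mesh n *\<^sub>R e) - \<phi> x) / mesh n"
  obtain K where K: "\<And>x. \<bar>?q x\<bar> \<le> K" using lipschitz_quotient_bounded by blast
  have quotient_u: "square_integrable lborel (\<lambda>x. (u (x + mesh n *\<^sub>R e) - u x) / mesh n)"
    using square_integrable_scaleR[OF square_integrable_add[OF square_integrable_translate[OF u, of "mesh n *\<^sub>R e"]
        square_integrable_scaleR[OF u, of "- 1"]], of "1 / mesh n"] by simp
  have "square_integrable lborel (\<lambda>x. \<phi> (x + mesh n *\<^sub>R e) * \<psi> x)"
    using square_integrable_translate[OF square_integrable_bounded_lipschitz_mult[OF \<phi>
          square_integrable_translate[OF \<psi>, of "- (mesh n *\<^sub>R e)"]], of "mesh n *\<^sub>R e"] by simp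
  with quotient_u have "integrable lborel (\<lambda>x. (u (x + mesh n *\<^sub>R e) - u x) / mesh n * (\<phi> (x + mesh n *\<^sub>R e) * \<psi> x))"
    by (rule integrable_mult_square_integrable)
  moreover have "integrable lborel (\<lambda>x. u x * (?q x * \<psi> x))"
    using square_integrable_bounded_scaleR[OF \<psi> _ K] by (intro integrable_mult_square_integrable u) simp
  moreover have "(\<phi> (x + mesh n *\<^sub>R e) * u (x + mesh n *\<^sub>R e) - \<phi> x * u x) / mesh n * \<psi> x =
      (u (x + mesh n *\<^sub>R e) - u x) / mesh n * (\<phi> (x + mesh n *\<^sub>R e) * \<psi> x) + u x * (?q x * \<psi> x)" for x
    using mesh_pos[of n] by (simp add: field_simps)
  ultimately show ?thesis by simp
qed

end

lemma weak_dir_deriv_mult: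
  assumes u: "square_integrable lborel u" and g: "square_integrable lborel g" and deriv: "weak_dir_deriv e u g"
    and \<phi>: "bounded_lipschitz_grad \<phi> \<Phi>"
  shows "weak_dir_deriv e (\<lambda>x. \<phi> x * u x) (\<lambda>x. \<phi> x * g x + u x * (\<Phi> x \<bullet> e))"
proof (rule weak_dir_deriv_of_difference_quotients)
  show "square_integrable lborel (\<lambda>x. \<phi> x * u x)" using square_integrable_bounded_lipschitz_mult[OF \<phi> u] by simp
  fix \<psi> assume \<psi>: "test_fun UNIV \<psi>"
  note [measurable] = bounded_lipschitz_grad_borel[OF \<phi>] test_fun_borel[OF \<psi>]
    and \<psi>_L2 = test_fun_square_integrable(1)[OF \<psi>]
  let ?\<xi> = "\<lambda>n x. \<phi> (x + mesh n *\<^sub>R e) * \<psi> x"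
  obtain M N L where "0 \<le> M" and M: "\<forall>x. \<bar>\<phi> x\<bar> \<le> M" and "\<forall>x. norm (\<Phi> x) \<le> N" "L-lipschitz_on UNIV \<phi>"
    using bounded_lipschitz_gradE[OF \<phi>] .
  obtain K R where dom: "dominated_on_ball K R \<psi>" using test_fun_dominated_on_ball[OF \<psi>] .
  have \<xi>_dom: "dominated_on_ball (M * K) R (?\<xi> n)" for n
    by (rule dominated_on_ball_mono[OF dom \<open>0 \<le> M\<close>]) (simp add: abs_mult mult_right_mono M)
  have "(\<lambda>n. ?\<xi> n (x - (mesh n * s) *\<^sub>R e)) \<longlonglongrightarrow> \<phi> x * \<psi> x" for x s
  proof -
    have shift: "x - (mesh n * s) *\<^sub>R e + mesh n *\<^sub>R e = x + (mesh n * (1 - s)) *\<^sub>R e" for n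
      by (simp add: algebra_simps)
    show ?thesis
      unfolding shift
      using tendsto_mult[OF continuous_mesh_tendsto[OF bounded_lipschitz_grad_continuous[OF \<phi>], of x "1 - s" e]
          continuous_mesh_tendsto[OF test_fun_continuous[OF \<psi>], of x "- s" e]] by simp
  qed
  then have "(\<lambda>n. \<integral>x. (u (x + mesh n *\<^sub>R e) - u x) / mesh n * ?\<xi> n x \<partial>lborel) \<longlonglongrightarrow> (\<integral>x. g x * (\<phi> x * \<psi> x) \<partial>lborel)"
    by (intro integral_difference_quotient_mult_tendsto[OF u g deriv _ _ \<xi>_dom]) auto
  from tendsto_add[OF this integral_mult_lipschitz_quotient_tendsto[OF u \<psi>_L2 \<phi>]]
  have "(\<lambda>n. \<integral>x. (\<phi> (x + mesh n *\<^sub>R e) * u (x + mesh n *\<^sub>R e) - \<phi> x * u x) / mesh n * \<psi> x \<partial>lborel)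
      \<longlonglongrightarrow> (\<integral>x. g x * (\<phi> x * \<psi> x) \<partial>lborel) + (\<integral>x. u x * ((\<Phi> x \<bullet> e) * \<psi> x) \<partial>lborel)"
    unfolding integral_product_quotient[OF u \<psi>_L2 \<phi>] .
  also have "(\<integral>x. g x * (\<phi> x * \<psi> x) \<partial>lborel) + (\<integral>x. u x * ((\<Phi> x \<bullet> e) * \<psi> x) \<partial>lborel) =
      (\<integral>x. g x * (\<phi> x * \<psi> x) + u x * ((\<Phi> x \<bullet> e) * \<psi> x) \<partial>lborel)"
    using square_integrable_bounded_lipschitz_mult[OF \<phi> \<psi>_L2]
    by (intro Bochner_Integration.integral_add[symmetric] integrable_mult_square_integrable[OF g]
        integrable_mult_bounded_lipschitz_grad_inner[OF u \<psi>_L2 \<phi>]) simp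
  also have "\<dots> = (\<integral>x. (\<phi> x * g x + u x * (\<Phi> x \<bullet> e)) * \<psi> x \<partial>lborel)"
    by (simp add: algebra_simps)
  finally show "(\<lambda>n. \<integral>x. (\<phi> (x + mesh n *\<^sub>R e) * u (x + mesh n *\<^sub>R e) - \<phi> x * u x) / mesh n * \<psi> x \<partial>lborel)
      \<longlonglongrightarrow> (\<integral>x. (\<phi> x * g x + u x * (\<Phi> x \<bullet> e)) * \<psi> x \<partial>lborel)" .
qed

lemma test_fun_weak_dir_deriv:
  assumes \<phi>: "test_fun UNIV \<phi>"
  shows "weak_dir_deriv e \<phi> (\<lambda>x. cgrad \<phi> x \<bullet> e)"
proof (rule weak_dir_deriv_of_difference_quotients)
  fix \<psi> assume \<psi>: "test_fun UNIV \<psi>"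
  have "(\<integral>x. (\<phi> (x + mesh n *\<^sub>R e) - \<phi> x) / mesh n * \<psi> x \<partial>lborel) =
      (\<integral>x. (\<psi> (x + mesh n *\<^sub>R - e) - \<psi> x) / mesh n * \<phi> x \<partial>lborel)" for n
    using integral_diff_translate_mult[OF test_fun_square_integrable(1)[OF \<phi>] test_fun_square_integrable(1)[OF \<psi>],
        of "mesh n *\<^sub>R e"]
    by (simp add: mult.commute)
  then show "(\<lambda>n. \<integral>x. (\<phi> (x + mesh n *\<^sub>R e) - \<phi> x) / mesh n * \<psi> x \<partial>lborel) \<longlonglongrightarrow> (\<integral>x. (cgrad \<phi> x \<bullet> e) * \<psi> x \<partial>lborel)"
    using difference_quotient_mult_test_fun_tendsto[OF test_fun_square_integrable(1)[OF \<psi>] \<phi>, of "- e"]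
    by (simp only:) (simp add: mult.commute)
qed (rule test_fun_square_integrable[OF \<phi>])

subsection \<open>Functions with square integrable weak gradient\<close>

definition H1_with_grad :: "(R2 \<Rightarrow> real) \<Rightarrow> (R2 \<Rightarrow> R2) \<Rightarrow> bool" where
  "H1_with_grad u g \<longleftrightarrow> square_integrable lebesgue u \<and> square_integrable lebesgue g \<and> has_weak_grad u g"

lemma H1_with_gradD:
  assumes "H1_with_grad u g"
  shows "square_integrable lebesgue u" "square_integrable lebesgue g" "has_weak_grad u g"
  using assms by (auto simp: H1_with_grad_def)

lemma H1_with_grad_measurable:
  assumes "H1_with_grad u g"
  shows "u \<in> borel_measurable lebesgue" "g \<in> borel_measurable lebesgue"
  using assms by (auto simp: H1_with_grad_def square_integrable_def)

lemma H1_iff: "u \<in> H1 \<longleftrightarrow> (\<exists>g. H1_with_grad u g)"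
  by (auto simp: H1_def H1_with_grad_def square_integrable_def)

lemma has_weak_gradD:
  "has_weak_grad u g \<Longrightarrow> test_fun UNIV \<phi> \<Longrightarrow>
    (\<integral>x. u x * cgrad \<phi> x $ i \<partial>lebesgue) = - (\<integral>x. g x $ i * \<phi> x \<partial>lebesgue)"
  by (simp add: has_weak_grad_def)

lemma test_fun_square_integrable_lebesgue:
  assumes "test_fun UNIV \<phi>"
  shows "square_integrable lebesgue \<phi>" "square_integrable lebesgue (\<lambda>x. cgrad \<phi> x $ i)"
  using test_fun_square_integrable[OF assms]
  by (auto intro: square_integrable_lborel_imp_lebesgue square_integrable_vec_nth)

lemma H1_integrable_mult_test_fun:
  assumes "H1_with_grad u g" "test_fun UNIV \<phi>"
  shows "integrable lebesgue (\<lambda>x. u x * cgrad \<phi> x $ i)" "integrable lebesgue (\<lambda>x. g x $ i * \<phi> x)"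
  using H1_with_gradD[OF assms(1)] test_fun_square_integrable_lebesgue[OF assms(2)]
  by (auto intro: integrable_mult_square_integrable square_integrable_vec_nth)

lemma H1_with_grad_cong_AE:
  assumes H1_grad: "H1_with_grad u g" and [measurable]: "u' \<in> borel_measurable lebesgue" "g' \<in> borel_measurable lebesgue"
    and eq: "AE x in lebesgue. u x = u' x" "AE x in lebesgue. g x = g' x"
  shows "H1_with_grad u' g'"
  unfolding H1_with_grad_def has_weak_grad_def
proof (intro conjI allI impI)
  show "square_integrable lebesgue u'" "square_integrable lebesgue g'"
    using square_integrable_cong_AE[OF H1_with_gradD(1)[OF H1_grad] _ eq(1)]
      square_integrable_cong_AE[OF H1_with_gradD(2)[OF H1_grad] _ eq(2)] by simp_all
  fix \<phi> i assume \<phi>: "test_fun UNIV \<phi>"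
  note [measurable] = H1_with_grad_measurable[OF H1_grad]
    test_fun_square_integrable_lebesgue[OF \<phi>, THEN square_integrable_measurable]
  have "(\<integral>x. u' x * cgrad \<phi> x $ i \<partial>lebesgue) = (\<integral>x. u x * cgrad \<phi> x $ i \<partial>lebesgue)"
    by (rule integral_cong_AE) (use eq in auto)
  also have "\<dots> = - (\<integral>x. g x $ i * \<phi> x \<partial>lebesgue)" by (rule has_weak_gradD[OF H1_with_gradD(3)[OF H1_grad] \<phi>])
  also have "(\<integral>x. g x $ i * \<phi> x \<partial>lebesgue) = (\<integral>x. g' x $ i * \<phi> x \<partial>lebesgue)"
    by (rule integral_cong_AE) (use eq in auto)
  finally show "(\<integral>x. u' x * cgrad \<phi> x $ i \<partial>lebesgue) = - (\<integral>x. g' x $ i * \<phi> x \<partial>lebesgue)" .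
qed

lemma H1_with_grad_borel_iff:
  assumes [measurable]: "u \<in> borel_measurable borel" "g \<in> borel_measurable borel"
  shows "H1_with_grad u g \<longleftrightarrow> square_integrable lborel u \<and> square_integrable lborel g \<and>
    (\<forall>i. weak_dir_deriv (axis i 1) u (\<lambda>x. g x $ i))"
proof -
  have "(\<integral>x. u x * cgrad \<phi> x $ i \<partial>lebesgue) = (\<integral>x. u x * (cgrad \<phi> x \<bullet> axis i 1) \<partial>lborel)"
    "(\<integral>x. g x $ i * \<phi> x \<partial>lebesgue) = (\<integral>x. g x $ i * \<phi> x \<partial>lborel)" if "test_fun UNIV \<phi>" for \<phi> i
  proof -
    note [measurable] = test_fun_borel[OF that] cgrad_borel[OF that]
    show "(\<integral>x. u x * cgrad \<phi> x $ i \<partial>lebesgue) = (\<integral>x. u x * (cgrad \<phi> x \<bullet> axis i 1) \<partial>lborel)"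
      "(\<integral>x. g x $ i * \<phi> x \<partial>lebesgue) = (\<integral>x. g x $ i * \<phi> x \<partial>lborel)"
      by (simp_all add: inner_axis integral_completion)
  qed
  then have "has_weak_grad u g \<longleftrightarrow> (\<forall>i. weak_dir_deriv (axis i 1) u (\<lambda>x. g x $ i))"
    unfolding has_weak_grad_def weak_dir_deriv_def by auto
  then show ?thesis by (simp add: H1_with_grad_def square_integrable_completion_iff)
qed

lemma H1_borel_representative:
  assumes H1_grad: "H1_with_grad u g" and I: "I \<in> sets borel" "\<And>x. u x \<in> I"
  obtains u' g' where "u' \<in> borel_measurable borel" "g' \<in> borel_measurable borel" "\<forall>x. u' x \<in> I"
    "AE x in lebesgue. u x = u' x" "AE x in lebesgue. g x = g' x" "H1_with_grad u' g'"
proof -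
  obtain v where v: "v \<in> borel_measurable borel" "AE x in lborel. u x = v x"
    using ex_borel_representative[OF H1_with_grad_measurable(1)[OF H1_grad]] .
  obtain g' where g': "g' \<in> borel_measurable borel" "AE x in lborel. g x = g' x"
    using ex_borel_representative[OF H1_with_grad_measurable(2)[OF H1_grad]] .
  define u' where "u' x = (if v x \<in> I then v x else u 0)" for x
  have u': "u' \<in> borel_measurable borel" unfolding u'_def using v(1) I(1) by measurable
  have "AE x in lborel. u x = u' x" using v(2) by eventually_elim (metis I(2) u'_def)
  note eq = AE_completion[OF this] AE_completion[OF g'(2)]
  show ?thesis
  proof (rule that[OF u' g'(1) _ eq])
    show "H1_with_grad u' g'"
      using u' g'(1) by (intro H1_with_grad_cong_AE[OF H1_grad _ _ eq] borel_measurable_lebesgueI)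
  qed (use I in \<open>simp add: u'_def\<close>)
qed

lemma H1_weak_dir_deriv:
  assumes [measurable]: "u \<in> borel_measurable borel" "g \<in> borel_measurable borel" and H1_grad: "H1_with_grad u g"
  shows "weak_dir_deriv a u (\<lambda>x. g x \<bullet> a)"
  unfolding weak_dir_deriv_def
proof (intro allI impI)
  fix \<phi> assume \<phi>: "test_fun UNIV \<phi>"
  have u: "square_integrable lborel u" and g: "square_integrable lborel g"
    and deriv: "\<And>i. weak_dir_deriv (axis i 1) u (\<lambda>x. g x $ i)"
    using H1_grad by (simp_all add: H1_with_grad_borel_iff)
  have "integrable lborel (\<lambda>x. u x * cgrad \<phi> x $ i)" "integrable lborel (\<lambda>x. g x $ i * \<phi> x)" for i
    using test_fun_square_integrable[OF \<phi>] u g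
    by (auto intro: integrable_mult_square_integrable square_integrable_vec_nth)
  note integrable = this
  have "(\<integral>x. u x * (cgrad \<phi> x \<bullet> a) \<partial>lborel) =
      (\<integral>x. a $ 1 * (u x * cgrad \<phi> x $ 1) + a $ 2 * (u x * cgrad \<phi> x $ 2) \<partial>lborel)"
    by (simp add: inner_vec_def sum_2 algebra_simps)
  also have "\<dots> = - (\<integral>x. a $ 1 * (g x $ 1 * \<phi> x) + a $ 2 * (g x $ 2 * \<phi> x) \<partial>lborel)"
    using integrable weak_dir_derivD[OF deriv \<phi>] by (simp add: inner_axis)
  also have "\<dots> = - (\<integral>x. (g x \<bullet> a) * \<phi> x \<partial>lborel)" by (simp add: inner_vec_def sum_2 algebra_simps)
  finally show "(\<integral>x. u x * (cgrad \<phi> x \<bullet> a) \<partial>lborel) = - (\<integral>x. (g x \<bullet> a) * \<phi> x \<partial>lborel)" .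
qed

lemma square_integrable_inner_const:
  fixes g :: "'a \<Rightarrow> 'b::{real_inner, second_countable_topology}"
  assumes "square_integrable M g"
  shows "square_integrable M (\<lambda>x. g x \<bullet> a)"
  by (rule square_integrable_dominated[OF assms, of _ "norm a"])
     (use Cauchy_Schwarz_ineq2[of _ a] square_integrable_measurable[OF assms] in \<open>auto simp: mult.commute[of "norm a"]\<close>)

lemma H1_translation_estimate:
  assumes "u \<in> borel_measurable borel" "g \<in> borel_measurable borel" "H1_with_grad u g"
    and "E \<in> sets borel" "B \<in> sets borel"
    and "convex B" and E: "E \<subseteq> B" "\<And>x. x \<in> E \<Longrightarrow> x + a \<in> B"
  shows "(\<integral>\<^sup>+x. ennreal ((u (x + a) - u x)\<^sup>2) * indicator E x \<partial>lborel)
         \<le> (\<integral>\<^sup>+x. ennreal ((g x \<bullet> a)\<^sup>2) * indicator B x \<partial>lborel)"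
proof (rule translation_estimate)
  show "square_integrable lborel u" "square_integrable lborel (\<lambda>x. g x \<bullet> a)"
    using assms(1-3) by (auto simp: H1_with_grad_borel_iff intro: square_integrable_inner_const)
  show "weak_dir_deriv a u (\<lambda>x. g x \<bullet> a)" by (rule H1_weak_dir_deriv) fact+
  show "x + s *\<^sub>R a \<in> B" if "x \<in> E" "0 \<le> s" "s \<le> 1" for x s
  proof -
    have "(1 - s) *\<^sub>R x + s *\<^sub>R (x + a) \<in> B" using that E by (intro convexD[OF \<open>convex B\<close>]) auto
    then show ?thesis by (simp add: algebra_simps)
  qed
qed fact+

lemma H1_chain:
  assumes H1_grad: "H1_with_grad u g" and I: "\<And>x. u x \<in> I" "0 \<in> I" and T: "bounded_C1_on I L T T'" "T 0 = 0"
  shows "H1_with_grad (\<lambda>x. T (u x)) (\<lambda>x. T' (u x) *\<^sub>R g x)"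
proof -
  obtain u' g' where u' [measurable]: "u' \<in> borel_measurable borel" and g' [measurable]: "g' \<in> borel_measurable borel"
    and I': "\<forall>x. u' x \<in> I" and eq: "AE x in lebesgue. u x = u' x" "AE x in lebesgue. g x = g' x"
    and H1_grad': "H1_with_grad u' g'"
    using H1_borel_representative[OF H1_grad bounded_C1_onD(2)[OF T(1)] I(1)] .
  note TT' [measurable] = bounded_C1_onD(6,7)[OF T(1)]
  have u'_L2: "square_integrable lborel u'" and g'_L2: "square_integrable lborel g'"
    and deriv: "\<And>i. weak_dir_deriv (axis i 1) u' (\<lambda>x. g' x $ i)"
    using H1_grad' by (simp_all add: H1_with_grad_borel_iff)
  have "square_integrable lborel (\<lambda>x. T (u' x))" using I' I(2) by (intro square_integrable_chain[OF u'_L2 _ _ T]) auto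
  moreover have "square_integrable lborel (\<lambda>x. T' (u' x) *\<^sub>R g' x)"
    by (rule square_integrable_bounded_scaleR[OF g'_L2]) (use I' bounded_C1_onD(5)[OF T(1)] in auto)
  moreover have "weak_dir_deriv (axis i 1) (\<lambda>x. T (u' x)) (\<lambda>x. T' (u' x) * g' x $ i)" for i
    using I' I(2) by (intro weak_dir_deriv_chain[OF u'_L2 square_integrable_vec_nth[OF g'_L2] deriv _ _ T]) auto
  ultimately have "H1_with_grad (\<lambda>x. T (u' x)) (\<lambda>x. T' (u' x) *\<^sub>R g' x)" by (simp add: H1_with_grad_borel_iff)
  then show ?thesis
  proof (rule H1_with_grad_cong_AE)
    note [measurable] = H1_with_grad_measurable[OF H1_grad]
    show "(\<lambda>x. T (u x)) \<in> borel_measurable lebesgue" "(\<lambda>x. T' (u x) *\<^sub>R g x) \<in> borel_measurable lebesgue"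
      by measurable
    show "AE x in lebesgue. T (u' x) = T (u x)" using eq(1) by eventually_elim simp
    show "AE x in lebesgue. T' (u' x) *\<^sub>R g' x = T' (u x) *\<^sub>R g x" using eq by eventually_elim simp
  qed
qed

lemma H1_mult_bounded_lipschitz:
  assumes H1_grad: "H1_with_grad u g" and \<phi>: "bounded_lipschitz_grad \<phi> \<Phi>"
  shows "H1_with_grad (\<lambda>x. \<phi> x * u x) (\<lambda>x. \<phi> x *\<^sub>R g x + u x *\<^sub>R \<Phi> x)"
proof -
  obtain u' g' where u' [measurable]: "u' \<in> borel_measurable borel" and g' [measurable]: "g' \<in> borel_measurable borel"
    and eq: "AE x in lebesgue. u x = u' x" "AE x in lebesgue. g x = g' x" and H1_grad': "H1_with_grad u' g'"
    using H1_borel_representative[OF H1_grad, of UNIV] by auto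
  note \<phi>_borel [measurable] = bounded_lipschitz_grad_borel[OF \<phi>]
  have u'_L2: "square_integrable lborel u'" and g'_L2: "square_integrable lborel g'"
    and deriv: "\<And>i. weak_dir_deriv (axis i 1) u' (\<lambda>x. g' x $ i)"
    using H1_grad' by (simp_all add: H1_with_grad_borel_iff)
  have "square_integrable lborel (\<lambda>x. \<phi> x * u' x)" using square_integrable_bounded_lipschitz_mult[OF \<phi> u'_L2] by simp
  moreover have "square_integrable lborel (\<lambda>x. \<phi> x *\<^sub>R g' x + u' x *\<^sub>R \<Phi> x)"
    by (intro square_integrable_add square_integrable_bounded_lipschitz_mult[OF \<phi> g'_L2]
        square_integrable_mult_bounded_lipschitz_grad[OF \<phi> u'_L2])
  moreover have "weak_dir_deriv (axis i 1) (\<lambda>x. \<phi> x * u' x) (\<lambda>x. \<phi> x * g' x $ i + u' x * \<Phi> x $ i)" for i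
    using weak_dir_deriv_mult[OF u'_L2 square_integrable_vec_nth[OF g'_L2] deriv \<phi>, of i] by (simp add: inner_axis)
  ultimately have "H1_with_grad (\<lambda>x. \<phi> x * u' x) (\<lambda>x. \<phi> x *\<^sub>R g' x + u' x *\<^sub>R \<Phi> x)"
    by (simp add: H1_with_grad_borel_iff)
  then show ?thesis
  proof (rule H1_with_grad_cong_AE)
    note [measurable] = H1_with_grad_measurable[OF H1_grad] \<phi>_borel[THEN borel_measurable_lebesgueI]
    show "(\<lambda>x. \<phi> x * u x) \<in> borel_measurable lebesgue"
      "(\<lambda>x. \<phi> x *\<^sub>R g x + u x *\<^sub>R \<Phi> x) \<in> borel_measurable lebesgue"
      by measurable
    show "AE x in lebesgue. \<phi> x * u' x = \<phi> x * u x" using eq(1) by eventually_elim simp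
    show "AE x in lebesgue. \<phi> x *\<^sub>R g' x + u' x *\<^sub>R \<Phi> x = \<phi> x *\<^sub>R g x + u x *\<^sub>R \<Phi> x" using eq by eventually_elim simp
  qed
qed

lemma test_fun_H1:
  assumes \<phi>: "test_fun UNIV \<phi>"
  shows "H1_with_grad \<phi> (cgrad \<phi>)"
proof -
  have "weak_dir_deriv (axis i 1) \<phi> (\<lambda>x. cgrad \<phi> x $ i)" for i
    using test_fun_weak_dir_deriv[OF \<phi>, of "axis i 1"] by (simp add: inner_axis)
  then show ?thesis
    using test_fun_square_integrable[OF \<phi>] H1_with_grad_borel_iff[OF test_fun_borel[OF \<phi>] cgrad_borel[OF \<phi>]] by blast
qed

lemma H1_lincomb:
  assumes u: "H1_with_grad u g" and v: "H1_with_grad v h"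
  shows "H1_with_grad (\<lambda>x. a * u x + c * v x) (\<lambda>x. a *\<^sub>R g x + c *\<^sub>R h x)"
  unfolding H1_with_grad_def has_weak_grad_def
proof (intro conjI allI impI)
  show "square_integrable lebesgue (\<lambda>x. a * u x + c * v x)"
    using square_integrable_add[OF square_integrable_scaleR[OF H1_with_gradD(1)[OF u]]
        square_integrable_scaleR[OF H1_with_gradD(1)[OF v]]] by simp
  show "square_integrable lebesgue (\<lambda>x. a *\<^sub>R g x + c *\<^sub>R h x)"
    by (intro square_integrable_add square_integrable_scaleR H1_with_gradD[OF u] H1_with_gradD[OF v])
  fix \<phi> i assume \<phi>: "test_fun UNIV \<phi>"
  note integrable = H1_integrable_mult_test_fun[OF u \<phi>, of i] H1_integrable_mult_test_fun[OF v \<phi>, of i]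
  have "(\<integral>x. (a * u x + c * v x) * cgrad \<phi> x $ i \<partial>lebesgue) =
      (\<integral>x. a * (u x * cgrad \<phi> x $ i) + c * (v x * cgrad \<phi> x $ i) \<partial>lebesgue)"
    by (simp add: algebra_simps)
  also have "\<dots> = - (\<integral>x. a * (g x $ i * \<phi> x) + c * (h x $ i * \<phi> x) \<partial>lebesgue)"
    using integrable has_weak_gradD[OF H1_with_gradD(3)[OF u] \<phi>] has_weak_gradD[OF H1_with_gradD(3)[OF v] \<phi>] by simp
  finally show "(\<integral>x. (a * u x + c * v x) * cgrad \<phi> x $ i \<partial>lebesgue) =
      - (\<integral>x. (a *\<^sub>R g x + c *\<^sub>R h x) $ i * \<phi> x \<partial>lebesgue)"
    by (simp add: algebra_simps)
qed

lemma H1_zero: "H1_with_grad (\<lambda>x. 0) (\<lambda>x. 0)"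
  by (simp add: H1_with_grad_def has_weak_grad_def square_integrable_def)

lemma square_integrable_dilation:
  fixes u :: "'a::euclidean_space \<Rightarrow> 'b::{real_normed_vector, second_countable_topology}"
  assumes u: "square_integrable lebesgue u" and l: "l \<noteq> 0"
  shows "square_integrable lebesgue (\<lambda>x. u (a + l *\<^sub>R x))"
proof -
  note [measurable] = square_integrable_measurable[OF u]
  have "(\<lambda>x. u (a + l *\<^sub>R x)) \<in> borel_measurable lebesgue"
    using measurable_compose[OF lebesgue_measurable_dilation[OF l] square_integrable_measurable[OF u]] .
  moreover have "integrable lebesgue (\<lambda>x. (norm (u (a + l *\<^sub>R x)))\<^sup>2)"
    using integrable_dilation_iff[OF l, of "\<lambda>x. (norm (u x))\<^sup>2" a] integrable_norm_power2[OF u] by simp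
  ultimately show ?thesis by (simp add: square_integrable_def)
qed

lemma H1_dilation:
  assumes u: "H1_with_grad u g" and l: "l \<noteq> 0"
  shows "H1_with_grad (\<lambda>x. u (a + l *\<^sub>R x)) (\<lambda>x. l *\<^sub>R g (a + l *\<^sub>R x))"
  unfolding H1_with_grad_def has_weak_grad_def
proof (intro conjI allI impI)
  show "square_integrable lebesgue (\<lambda>x. u (a + l *\<^sub>R x))" "square_integrable lebesgue (\<lambda>x. l *\<^sub>R g (a + l *\<^sub>R x))"
    by (intro square_integrable_dilation square_integrable_scaleR H1_with_gradD[OF u] l)+
  fix \<phi> i assume \<phi>: "test_fun UNIV \<phi>"
  define \<psi> where "\<psi> y = \<phi> ((1/l) *\<^sub>R y + (- (1/l) *\<^sub>R a))" for y
  have \<psi>: "test_fun UNIV \<psi>" unfolding \<psi>_def by (rule test_fun_affine[OF \<phi>]) (use l in simp)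
  note [measurable] = H1_with_grad_measurable[OF u]
    test_fun_square_integrable_lebesgue[OF \<psi>, THEN square_integrable_measurable]
  have inverse: "(1/l) *\<^sub>R (a + l *\<^sub>R x) + (- (1/l) *\<^sub>R a) = x" for x
    using l by (simp add: algebra_simps)
  have \<psi>_dilated: "\<psi> (a + l *\<^sub>R x) = \<phi> x" for x unfolding \<psi>_def inverse ..
  have cgrad_\<phi>: "cgrad \<phi> x = l *\<^sub>R cgrad \<psi> (a + l *\<^sub>R x)" for x
    unfolding \<psi>_def cgrad_affine[OF \<phi>] inverse using l by simp
  have "(\<integral>x. u (a + l *\<^sub>R x) * cgrad \<phi> x $ i \<partial>lebesgue) =
      l * (\<integral>x. u (a + l *\<^sub>R x) * cgrad \<psi> (a + l *\<^sub>R x) $ i \<partial>lebesgue)"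
    by (simp add: cgrad_\<phi> mult.left_commute)
  also have "\<dots> = l * ((\<integral>x. u x * cgrad \<psi> x $ i \<partial>lebesgue) / l\<^sup>2)"
    using integral_dilation[OF l, of "\<lambda>x. u x * cgrad \<psi> x $ i" a] by (simp add: divide_inverse mult.commute)
  also have "\<dots> = - (l * ((\<integral>x. g x $ i * \<psi> x \<partial>lebesgue) / l\<^sup>2))"
    using has_weak_gradD[OF H1_with_gradD(3)[OF u] \<psi>] by simp
  also have "(\<integral>x. g x $ i * \<psi> x \<partial>lebesgue) / l\<^sup>2 = (\<integral>x. g (a + l *\<^sub>R x) $ i * \<phi> x \<partial>lebesgue)"
    using integral_dilation[OF l, of "\<lambda>x. g x $ i * \<psi> x" a] by (simp add: \<psi>_dilated divide_inverse mult.commute)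
  finally show "(\<integral>x. u (a + l *\<^sub>R x) * cgrad \<phi> x $ i \<partial>lebesgue) = - (\<integral>x. (l *\<^sub>R g (a + l *\<^sub>R x)) $ i * \<phi> x \<partial>lebesgue)"
    by (simp add: mult.assoc)
qed

lemma integral_mult_dominated_tendsto:
  fixes V :: "nat \<Rightarrow> 'a \<Rightarrow> real"
  assumes [measurable]: "\<And>k. V k \<in> borel_measurable M" "v \<in> borel_measurable M"
    and w: "square_integrable M w" "\<And>k x. \<bar>V k x\<bar> \<le> \<bar>w x\<bar>" and \<psi>: "square_integrable M \<psi>"
    and lim: "\<And>x. (\<lambda>k. V k x) \<longlonglongrightarrow> v x"
  shows "(\<lambda>k. \<integral>x. V k x * \<psi> x \<partial>M) \<longlonglongrightarrow> (\<integral>x. v x * \<psi> x \<partial>M)"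
proof (rule integral_dominated_convergence[where w = "\<lambda>x. \<bar>w x * \<psi> x\<bar>"])
  note [measurable] = square_integrable_measurable[OF \<psi>]
  show "(\<lambda>x. v x * \<psi> x) \<in> borel_measurable M" "(\<lambda>x. V k x * \<psi> x) \<in> borel_measurable M" for k by measurable
  show "integrable M (\<lambda>x. \<bar>w x * \<psi> x\<bar>)" by (intro integrable_abs integrable_mult_square_integrable w \<psi>)
  show "AE x in M. (\<lambda>k. V k x * \<psi> x) \<longlonglongrightarrow> v x * \<psi> x" by (intro AE_I2 tendsto_intros lim)
  show "AE x in M. norm (V k x * \<psi> x) \<le> \<bar>w x * \<psi> x\<bar>" for k
    by (intro AE_I2) (simp add: abs_mult mult_right_mono w(2))
qed

lemma H1_limit:
  fixes u :: "R2 \<Rightarrow> real" and g :: "R2 \<Rightarrow> R2"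
  assumes H1_grad: "\<And>k. H1_with_grad (U k) (G k)" and b: "square_integrable lebesgue b" "\<And>k x. \<bar>U k x\<bar> \<le> \<bar>b x\<bar>"
    and c: "square_integrable lebesgue c" "\<And>k x. norm (G k x) \<le> \<bar>c x\<bar>"
    and lim: "\<And>x. (\<lambda>k. U k x) \<longlonglongrightarrow> u x" "\<And>x. (\<lambda>k. G k x) \<longlonglongrightarrow> g x"
  shows "H1_with_grad u g"
  unfolding H1_with_grad_def has_weak_grad_def
proof (intro conjI allI impI)
  note U_borel [measurable] = H1_with_grad_measurable[OF H1_grad]
  have u_borel [measurable]: "u \<in> borel_measurable lebesgue" and g_borel [measurable]: "g \<in> borel_measurable lebesgue"
    using borel_measurable_LIMSEQ_metric[OF U_borel(1) lim(1)] borel_measurable_LIMSEQ_metric[OF U_borel(2) lim(2)] .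
  have "\<bar>u x\<bar> \<le> 1 * norm (b x)" "norm (g x) \<le> 1 * norm (c x)" for x
    using LIMSEQ_le_const2[OF tendsto_rabs[OF lim(1)]] LIMSEQ_le_const2[OF tendsto_norm[OF lim(2)]] b(2) c(2)
    by auto
  then show "square_integrable lebesgue u" "square_integrable lebesgue g"
    using square_integrable_dominated[OF b(1) u_borel, of 1] square_integrable_dominated[OF c(1) g_borel, of 1] by auto
  fix \<phi> i assume \<phi>: "test_fun UNIV \<phi>"
  note \<phi>_L2 = test_fun_square_integrable_lebesgue[OF \<phi>]
  have "(\<lambda>k. \<integral>x. U k x * cgrad \<phi> x $ i \<partial>lebesgue) \<longlonglongrightarrow> (\<integral>x. u x * cgrad \<phi> x $ i \<partial>lebesgue)"
    by (rule integral_mult_dominated_tendsto[OF _ _ b \<phi>_L2(2) lim(1)]) measurable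
  moreover have "(\<lambda>k. \<integral>x. G k x $ i * \<phi> x \<partial>lebesgue) \<longlonglongrightarrow> (\<integral>x. g x $ i * \<phi> x \<partial>lebesgue)"
    by (rule integral_mult_dominated_tendsto[OF _ _ c(1) _ \<phi>_L2(1) tendsto_vec_nth[OF lim(2)]])
       (use order_trans[OF component_le_norm_cart c(2)] in auto)
  then have "(\<lambda>k. \<integral>x. U k x * cgrad \<phi> x $ i \<partial>lebesgue) \<longlonglongrightarrow> - (\<integral>x. g x $ i * \<phi> x \<partial>lebesgue)"
    using has_weak_gradD[OF H1_with_gradD(3)[OF H1_grad] \<phi>] by (simp add: tendsto_minus)
  ultimately show "(\<integral>x. u x * cgrad \<phi> x $ i \<partial>lebesgue) = - (\<integral>x. g x $ i * \<phi> x \<partial>lebesgue)"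
    by (rule LIMSEQ_unique)
qed

lemma H1_chain_limit:
  assumes H1_grad: "H1_with_grad u g" and T: "\<And>k. bounded_C1_on UNIV 1 (T k) (T' k)" "\<And>k. T k 0 = 0"
    and lim: "\<And>s. (\<lambda>k. T k s) \<longlonglongrightarrow> S s" "\<And>s. (\<lambda>k. T' k s) \<longlonglongrightarrow> S' s"
  shows "H1_with_grad (\<lambda>x. S (u x)) (\<lambda>x. S' (u x) *\<^sub>R g x)"
proof (rule H1_limit)
  show "H1_with_grad (\<lambda>x. T k (u x)) (\<lambda>x. T' k (u x) *\<^sub>R g x)" for k
    by (rule H1_chain[OF H1_grad _ _ T]) auto
  show "\<bar>T k (u x)\<bar> \<le> \<bar>u x\<bar>" for k x using bounded_C1_on_abs_le[OF T(1) _ T(2)] by simp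
  show "norm (T' k (u x) *\<^sub>R g x) \<le> \<bar>norm (g x)\<bar>" for k x
    using bounded_C1_onD(5)[OF T(1), of "u x" k] by (simp add: mult_left_le_one_le)
  show "square_integrable lebesgue (\<lambda>x. norm (g x))" by (rule square_integrable_norm[OF H1_with_gradD(2)[OF H1_grad]])
qed (auto intro!: tendsto_scaleR lim tendsto_const H1_with_gradD[OF H1_grad])

lemma has_weak_grad_AE_unique:
  assumes [measurable]: "g \<in> borel_measurable lebesgue" "h \<in> borel_measurable lebesgue"
    and weak: "has_weak_grad u g" "has_weak_grad u h"
    and integrable: "\<And>\<phi> i. test_fun UNIV \<phi> \<Longrightarrow> integrable lebesgue (\<lambda>x. g x $ i * \<phi> x)"
      "\<And>\<phi> i. test_fun UNIV \<phi> \<Longrightarrow> integrable lebesgue (\<lambda>x. h x $ i * \<phi> x)"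
  shows "AE x in lebesgue. g x = h x"
proof -
  have "AE x in lebesgue. g x $ i - h x $ i = 0" for i
  proof (rule fundamental_lemma)
    fix \<phi> assume \<phi>: "test_fun UNIV \<phi>"
    show "integrable lebesgue (\<lambda>x. (g x $ i - h x $ i) * \<phi> x)"
      using integrable[OF \<phi>, of i] by (simp add: left_diff_distrib)
    have "(\<integral>x. g x $ i * \<phi> x \<partial>lebesgue) = (\<integral>x. h x $ i * \<phi> x \<partial>lebesgue)"
      using has_weak_gradD[OF weak(1) \<phi>, of i] has_weak_gradD[OF weak(2) \<phi>, of i] by simp
    then show "(\<integral>x. (g x $ i - h x $ i) * \<phi> x \<partial>lebesgue) = 0"
      using integrable[OF \<phi>, of i] by (simp add: left_diff_distrib)
  qed measurable
  then have "AE x in lebesgue. \<forall>i. g x $ i - h x $ i = 0" by (simp add: AE_all_countable)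
  then show ?thesis by eventually_elim (simp add: vec_eq_iff)
qed

lemma H1_with_grad_unique:
  assumes "H1_with_grad u g" "H1_with_grad u h"
  shows "AE x in lebesgue. g x = h x"
  by (rule has_weak_grad_AE_unique[where u = u])
     (use assms H1_with_grad_measurable H1_with_gradD(3) H1_integrable_mult_test_fun(2) in blast)+

subsection \<open>Positive and negative parts\<close>

lemma H1_grad_eq_0_on_zero_level:
  assumes H1_grad: "H1_with_grad u g"
  shows "AE x in lebesgue. u x = 0 \<longrightarrow> g x = 0"
proof -
  let ?T = "\<lambda>k s. mesh k * arctan (s / mesh k)" and ?T' = "\<lambda>k s. inverse (1 + (s / mesh k)\<^sup>2)"
  have "H1_with_grad (\<lambda>x. 0) (\<lambda>x. (if u x = 0 then 1 else 0) *\<^sub>R g x)"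
  proof (rule H1_chain_limit[OF H1_grad, where T = ?T and T' = ?T'])
    show "bounded_C1_on UNIV 1 (?T k) (?T' k)" for k
    proof (rule bounded_C1_on_UNIV_I)
      show "(?T k has_real_derivative ?T' k s) (at s)" for s
        using mesh_pos[of k] by (auto intro!: derivative_eq_intros simp: divide_inverse)
      show "continuous_on UNIV (?T' k)"
        using mesh_pos[of k] by (intro continuous_intros) (auto simp: add_nonneg_eq_0_iff)
      show "\<bar>?T' k s\<bar> \<le> 1" for s by (auto simp: inverse_le_1_iff add_nonneg_nonneg)
    qed
    show "(\<lambda>k. ?T k s) \<longlonglongrightarrow> 0" for s
    proof (rule Lim_null_comparison)
      have "\<bar>arctan y\<bar> \<le> pi / 2" for y using arctan_bounded[of y] by linarith
      then have "\<bar>?T k s\<bar> \<le> mesh k * (pi / 2)" for k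
        using mesh_pos[of k] unfolding abs_mult by (intro mult_mono) auto
      then show "\<forall>\<^sub>F k in sequentially. norm (?T k s) \<le> mesh k * (pi / 2)" by simp
      show "(\<lambda>k. mesh k * (pi / 2)) \<longlonglongrightarrow> 0" using tendsto_mult_left_zero[OF mesh_tendsto_0] .
    qed
    show "(\<lambda>k. ?T' k s) \<longlonglongrightarrow> (if s = 0 then 1 else 0)" for s
    proof (cases "s = 0")
      case False
      then have "(\<lambda>k. (mesh k)\<^sup>2 / ((mesh k)\<^sup>2 + s\<^sup>2)) \<longlonglongrightarrow> 0\<^sup>2 / (0\<^sup>2 + s\<^sup>2)"
        by (intro tendsto_intros mesh_tendsto_0) auto
      moreover have "(mesh k)\<^sup>2 / ((mesh k)\<^sup>2 + s\<^sup>2) = ?T' k s" for k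
        using mesh_pos[of k] by (simp add: power_divide field_simps)
      ultimately show ?thesis using False by simp
    qed simp
  qed simp
  from H1_with_grad_unique[OF this H1_zero] show ?thesis by eventually_elim (simp split: if_splits)
qed

lemma H1_abs:
  assumes H1_grad: "H1_with_grad u g"
  shows "H1_with_grad (\<lambda>x. \<bar>u x\<bar>) (\<lambda>x. sgn (u x) *\<^sub>R g x)"
proof -
  let ?T = "\<lambda>k s. sqrt (s\<^sup>2 + (mesh k)\<^sup>2) - mesh k" and ?T' = "\<lambda>k s. s / sqrt (s\<^sup>2 + (mesh k)\<^sup>2)"
  have pos: "0 < s\<^sup>2 + (mesh k)\<^sup>2" for s k using mesh_pos[of k] by (simp add: add_nonneg_pos)
  have sqrt_lim: "(\<lambda>k. sqrt (s\<^sup>2 + (mesh k)\<^sup>2)) \<longlonglongrightarrow> \<bar>s\<bar>" for s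
  proof -
    have "(\<lambda>k. sqrt (s\<^sup>2 + (mesh k)\<^sup>2)) \<longlonglongrightarrow> sqrt (s\<^sup>2 + 0\<^sup>2)" by (intro tendsto_intros mesh_tendsto_0)
    then show ?thesis by simp
  qed
  show ?thesis
  proof (rule H1_chain_limit[OF H1_grad, where T = ?T and T' = ?T'])
    show "bounded_C1_on UNIV 1 (?T k) (?T' k)" for k
    proof (rule bounded_C1_on_UNIV_I)
      show "(?T k has_real_derivative ?T' k s) (at s)" for s
        using pos[of s k] by (auto intro!: derivative_eq_intros simp: field_simps)
      show "continuous_on UNIV (?T' k)"
        using pos[of _ k] by (intro continuous_intros) (auto simp: less_imp_neq[symmetric])
      have "sqrt (s\<^sup>2) \<le> sqrt (s\<^sup>2 + (mesh k)\<^sup>2)" for s by (intro real_sqrt_le_mono) auto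
      then show "\<bar>?T' k s\<bar> \<le> 1" for s using pos[of s k] by (simp add: divide_le_eq)
    qed
    show "?T k 0 = 0" for k using mesh_pos[of k] by simp
    show "(\<lambda>k. ?T k s) \<longlonglongrightarrow> \<bar>s\<bar>" for s using tendsto_diff[OF sqrt_lim mesh_tendsto_0] by simp
    show "(\<lambda>k. ?T' k s) \<longlonglongrightarrow> sgn s" for s
    proof (cases "s = 0")
      case False
      then have "(\<lambda>k. ?T' k s) \<longlonglongrightarrow> s / \<bar>s\<bar>" by (intro tendsto_divide sqrt_lim tendsto_const) auto
      then show ?thesis by (simp add: sgn_div_norm divide_inverse mult.commute)
    qed simp
  qed
qed

lemma H1_pos_part:
  assumes H1_grad: "H1_with_grad u g"
  shows "H1_with_grad (pos_part u) (\<lambda>x. if 0 < u x then g x else 0)"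
proof (rule H1_with_grad_cong_AE)
  note [measurable] = H1_with_grad_measurable[OF H1_grad]
  show "H1_with_grad (\<lambda>x. (1/2) * u x + (1/2) * \<bar>u x\<bar>) (\<lambda>x. (1/2) *\<^sub>R g x + (1/2) *\<^sub>R (sgn (u x) *\<^sub>R g x))"
    by (rule H1_lincomb[OF H1_grad H1_abs[OF H1_grad]])
  show "AE x in lebesgue. (1/2) *\<^sub>R g x + (1/2) *\<^sub>R (sgn (u x) *\<^sub>R g x) = (if 0 < u x then g x else 0)"
    using H1_grad_eq_0_on_zero_level[OF H1_grad]
    by eventually_elim (auto simp: sgn_real_def scaleR_add_left[symmetric])
  show "pos_part u \<in> borel_measurable lebesgue" "(\<lambda>x. if 0 < u x then g x else 0) \<in> borel_measurable lebesgue"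
    unfolding pos_part_def by measurable
qed (auto simp: pos_part_def max_def)

lemma H1_neg_part:
  assumes H1_grad: "H1_with_grad u g"
  shows "H1_with_grad (neg_part u) (\<lambda>x. if u x < 0 then g x else 0)"
proof -
  have "H1_with_grad (\<lambda>x. - u x) (\<lambda>x. - g x)" using H1_lincomb[OF H1_grad H1_zero, of "- 1" 0] by simp
  moreover have "neg_part u = (\<lambda>x. - pos_part (\<lambda>x. - u x) x)"
    by (auto simp: pos_part_def neg_part_def fun_eq_iff)
  moreover have "(\<lambda>x. if u x < 0 then g x else 0) = (\<lambda>x. - (if 0 < - u x then - g x else 0))" by auto
  ultimately show ?thesis
    using H1_lincomb[OF H1_pos_part H1_zero, of "\<lambda>x. - u x" "\<lambda>x. - g x" "- 1" 0] by simp
qed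

subsection \<open>The chosen weak gradient\<close>

lemma H1_eq_0_of_partial_eq_0:
  assumes H1_grad: "H1_with_grad u g" and zero: "AE x in lebesgue. g x $ i = 0"
  shows "AE x in lebesgue. u x = 0"
proof -
  obtain u' g' where u' [measurable]: "u' \<in> borel_measurable borel" and g': "g' \<in> borel_measurable borel"
    and eq: "AE x in lebesgue. u x = u' x" "AE x in lebesgue. g x = g' x" and H1_grad': "H1_with_grad u' g'"
    using H1_borel_representative[OF H1_grad, of UNIV] by auto
  have u'_L2: "square_integrable lborel u'" and g'_L2: "square_integrable lborel (\<lambda>x. g' x $ i)"
    and deriv: "weak_dir_deriv (axis i 1) u' (\<lambda>x. g' x $ i)"
    using H1_grad' by (simp_all add: H1_with_grad_borel_iff u' g' square_integrable_vec_nth)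
  have "AE x in lebesgue. g' x $ i = 0" using zero eq(2) by eventually_elim simp
  then have "AE x in lborel. (g' x $ i)\<^sup>2 = 0" by (simp add: AE_completion_iff)
  then have "(\<integral>x. (g' x $ i)\<^sup>2 \<partial>lborel) = 0" by (rule integral_eq_zero_AE)
  then have "(\<integral>\<^sup>+x. ennreal ((u' (x + t *\<^sub>R axis i 1) - u' x)\<^sup>2) \<partial>lborel) = 0" for t
    using nn_integral_translation_diff_le[OF u'_L2 g'_L2 deriv, of t] by simp
  then have translate: "AE x in lborel. u' (x + t *\<^sub>R axis i 1) = u' x" for t
    by (subst (asm) nn_integral_0_iff_AE) auto
  have periodic: "AE x in lborel. (u' (x + real n *\<^sub>R axis i 1))\<^sup>2 = (u' x)\<^sup>2" for n
    using translate[of "real n"] by eventually_elim simp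
  have "AE x in lborel. (u' x)\<^sup>2 = 0"
    by (rule AE_eq_0_of_periodic[OF integrable_power2[OF u'_L2] _ periodic]) simp
  from AE_completion[OF this] eq(1) show ?thesis by eventually_elim simp
qed

lemma wgrad_is_weak_grad:
  assumes "H1_with_grad u g"
  shows "wgrad u \<in> borel_measurable lebesgue" "has_weak_grad u (wgrad u)"
proof -
  have "wgrad u \<in> borel_measurable lebesgue \<and> has_weak_grad u (wgrad u)"
    unfolding wgrad_def by (rule someI[of _ g]) (use H1_with_grad_measurable[OF assms] H1_with_gradD[OF assms] in auto)
  then show "wgrad u \<in> borel_measurable lebesgue" "has_weak_grad u (wgrad u)" by auto
qed

text \<open>For functions that vanish almost everywhere this fails: a nowhere locally integrable field
  \<open>h\<close> also satisfies \<^term>\<open>has_weak_grad (\<lambda>x. 0) h\<close>, because all the integrals involved are the junk value 0.\<close>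

lemma weak_grad_integrable_mult_test_fun:
  assumes H1_grad: "H1_with_grad u g" and "nonzero u" and h: "has_weak_grad u h" and \<phi>: "test_fun UNIV \<phi>"
  shows "integrable lebesgue (\<lambda>x. h x $ i * \<phi> x)"
proof (rule ccontr)
  assume not_integrable: "\<not> integrable lebesgue (\<lambda>x. h x $ i * \<phi> x)"
  have eq: "(\<integral>x. h x $ i * \<phi> x \<partial>lebesgue) = (\<integral>x. g x $ i * \<phi> x \<partial>lebesgue)" if "test_fun UNIV \<phi>" for \<phi>
    using has_weak_gradD[OF h that, of i] has_weak_gradD[OF H1_with_gradD(3)[OF H1_grad] that, of i] by simp
  note g_integrable = H1_integrable_mult_test_fun(2)[OF H1_grad]
  obtain \<psi> where \<psi>: "test_fun UNIV \<psi>" "(\<integral>x. g x $ i * \<psi> x \<partial>lebesgue) \<noteq> 0"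
  proof (rule ccontr)
    assume "\<not> thesis"
    then have "AE x in lebesgue. g x $ i = 0"
      using that H1_with_grad_measurable[OF H1_grad] by (intro fundamental_lemma g_integrable) auto
    from H1_eq_0_of_partial_eq_0[OF H1_grad this] \<open>nonzero u\<close> show False by (simp add: nonzero_def)
  qed
  have \<psi>_integrable: "integrable lebesgue (\<lambda>x. h x $ i * \<psi> x)"
  proof (rule ccontr)
    assume "\<not> integrable lebesgue (\<lambda>x. h x $ i * \<psi> x)"
    then have "(\<integral>x. h x $ i * \<psi> x \<partial>lebesgue) = 0" by (rule not_integrable_integral_eq)
    with \<psi>(2) eq[OF \<psi>(1)] show False by simp
  qed
  have "\<not> integrable lebesgue (\<lambda>x. h x $ i * (\<phi> x + \<psi> x))"
  proof
    assume "integrable lebesgue (\<lambda>x. h x $ i * (\<phi> x + \<psi> x))"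
    from Bochner_Integration.integrable_diff[OF this \<psi>_integrable] not_integrable show False by (simp add: algebra_simps)
  qed
  then have "(\<integral>x. g x $ i * (\<phi> x + \<psi> x) \<partial>lebesgue) = 0"
    using eq[OF test_fun_add[OF \<phi> \<psi>(1)]] by (simp add: not_integrable_integral_eq)
  moreover have "(\<integral>x. g x $ i * \<phi> x \<partial>lebesgue) = 0"
    using eq[OF \<phi>] not_integrable by (simp add: not_integrable_integral_eq)
  ultimately show False using \<psi>(2) g_integrable[OF \<phi>] g_integrable[OF \<psi>(1)] by (simp add: distrib_left)
qed

lemma wgrad_AE_eq:
  assumes H1_grad: "H1_with_grad u g" and "nonzero u"
  shows "AE x in lebesgue. wgrad u x = g x"
proof -
  note weak_grad = wgrad_is_weak_grad[OF H1_grad]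
  show ?thesis
    using H1_with_grad_measurable(2)[OF H1_grad] H1_with_gradD(3)[OF H1_grad] H1_integrable_mult_test_fun(2)[OF H1_grad]
      weak_grad_integrable_mult_test_fun[OF H1_grad \<open>nonzero u\<close> weak_grad(2)]
    by (intro has_weak_grad_AE_unique[OF weak_grad(1) _ weak_grad(2)])
qed

definition L2_norm_sq :: "('a::euclidean_space \<Rightarrow> 'b::real_normed_vector) \<Rightarrow> real" where
  "L2_norm_sq f = (\<integral>x. (norm (f x))\<^sup>2 \<partial>lebesgue)"

lemma L2_norm_sq_nonneg: "0 \<le> L2_norm_sq f"
  by (simp add: L2_norm_sq_def)

lemma L2_norm_sq_cong_AE:
  assumes "f \<in> borel_measurable lebesgue" "g \<in> borel_measurable lebesgue" "AE x in lebesgue. f x = g x"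
  shows "L2_norm_sq f = L2_norm_sq g"
  unfolding L2_norm_sq_def by (rule integral_cong_AE) (use assms in auto)

lemma L2_norm_sq_add_scaleR:
  fixes g k :: "'a::euclidean_space \<Rightarrow> 'b::{real_inner, second_countable_topology}"
  assumes "square_integrable lebesgue g" "square_integrable lebesgue k"
  shows "L2_norm_sq (\<lambda>x. g x + e *\<^sub>R k x) = L2_norm_sq g + 2 * e * (\<integral>x. g x \<bullet> k x \<partial>lebesgue) + e\<^sup>2 * L2_norm_sq k"
proof -
  have "L2_norm_sq (\<lambda>x. g x + e *\<^sub>R k x) = (\<integral>x. (norm (g x))\<^sup>2 + 2 * e * (g x \<bullet> k x) + e\<^sup>2 * (norm (k x))\<^sup>2 \<partial>lebesgue)"
    unfolding L2_norm_sq_def power2_norm_eq_inner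
    by (intro Bochner_Integration.integral_cong)
       (auto simp: inner_add_left inner_add_right inner_commute[of "k _" "g _"] power2_eq_square algebra_simps)
  also have "\<dots> = L2_norm_sq g + 2 * e * (\<integral>x. g x \<bullet> k x \<partial>lebesgue) + e\<^sup>2 * L2_norm_sq k"
    using integrable_inner_square_integrable[OF assms] assms[THEN integrable_norm_power2]
    by (simp add: L2_norm_sq_def)
  finally show ?thesis .
qed

lemma L2_norm_sq_dilation:
  fixes u :: "'a::euclidean_space \<Rightarrow> 'b::{real_normed_vector, second_countable_topology}"
  assumes [measurable]: "u \<in> borel_measurable lebesgue" and l: "l \<noteq> 0"
  shows "L2_norm_sq (\<lambda>x. u (a + l *\<^sub>R x)) = L2_norm_sq u / \<bar>l\<bar> ^ DIM('a)"
  using integral_dilation[OF l, of "\<lambda>x. (norm (u x))\<^sup>2" a] by (simp add: L2_norm_sq_def divide_inverse mult.commute)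

lemma L2_norm_sq_tendsto:
  fixes F :: "nat \<Rightarrow> 'a::euclidean_space \<Rightarrow> 'b::{real_normed_vector, second_countable_topology}"
  assumes [measurable]: "\<And>n. F n \<in> borel_measurable lebesgue" "f \<in> borel_measurable lebesgue"
    and w: "integrable lebesgue w" "\<And>n x. (norm (F n x))\<^sup>2 \<le> w x"
    and eq: "\<And>x. \<forall>\<^sub>F n in sequentially. F n x = f x"
  shows "(\<lambda>n. L2_norm_sq (F n)) \<longlonglongrightarrow> L2_norm_sq f"
  unfolding L2_norm_sq_def
proof (rule integral_dominated_convergence[OF _ _ w(1)])
  show "AE x in lebesgue. (\<lambda>n. (norm (F n x))\<^sup>2) \<longlonglongrightarrow> (norm (f x))\<^sup>2"
  proof (intro AE_I2 tendsto_eventually)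
    show "\<forall>\<^sub>F n in sequentially. (norm (F n x))\<^sup>2 = (norm (f x))\<^sup>2" for x using eq[of x] by eventually_elim simp
  qed
qed (use w in auto)

lemma H1_L2_norm_sq_pos:
  assumes H1_grad: "H1_with_grad u g" and nz: "nonzero u"
  shows "0 < L2_norm_sq u" "0 < L2_norm_sq g"
proof -
  show "0 < L2_norm_sq u"
    unfolding L2_norm_sq_def by (rule integral_power2_pos) (use H1_with_gradD[OF H1_grad] nz in \<open>auto simp: nonzero_def\<close>)
  have "\<not> (AE x in lebesgue. g x = 0)"
  proof
    assume "AE x in lebesgue. g x = 0"
    then have "AE x in lebesgue. g x $ 1 = 0" by eventually_elim simp
    from H1_eq_0_of_partial_eq_0[OF H1_grad this] nz show False by (simp add: nonzero_def)
  qed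
  then show "0 < L2_norm_sq g"
    unfolding L2_norm_sq_def by (intro integral_power2_pos H1_with_gradD[OF H1_grad])
qed

subsection \<open>Cutting off to a half-plane\<close>

definition ramp :: "real \<Rightarrow> R2 \<Rightarrow> real" where
  "ramp R x = max 0 (min 1 (x $ 1 + R))"

definition ramp_grad :: "real \<Rightarrow> R2 \<Rightarrow> R2" where
  "ramp_grad R x = (if - R < x $ 1 \<and> x $ 1 < 1 - R then axis 1 1 else 0)"

lemma ramp_bounds: "0 \<le> ramp R x" "ramp R x \<le> 1"
  by (auto simp: ramp_def)

lemma ramp_has_derivative:
  assumes "x $ 1 \<noteq> - R" "x $ 1 \<noteq> 1 - R"
  shows "(ramp R has_derivative (\<lambda>v. ramp_grad R x \<bullet> v)) (at x)"
proof -
  have open_half_planes: "open {y::R2. y $ 1 < a}" "open {y::R2. a < y $ 1}" for a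
    by (intro open_Collect_less continuous_intros)+
  consider "x $ 1 < - R" | "- R < x $ 1" "x $ 1 < 1 - R" | "1 - R < x $ 1" using assms by linarith
  then show ?thesis
  proof cases
    case 1
    have "((\<lambda>y. 0) has_derivative (\<lambda>v. 0)) (at x)" by simp
    then have "(ramp R has_derivative (\<lambda>v. 0)) (at x)"
      by (rule has_derivative_transform_within_open[OF _ open_half_planes(1)[of "- R"]]) (use 1 in \<open>auto simp: ramp_def\<close>)
    then show ?thesis using 1 by (simp add: ramp_grad_def)
  next
    case 2
    have "((\<lambda>y. y $ 1 + R) has_derivative (\<lambda>v. v $ 1)) (at x)"
      by (auto intro!: derivative_eq_intros bounded_linear_imp_has_derivative bounded_linear_vec_nth)
    then have "(ramp R has_derivative (\<lambda>v. v $ 1)) (at x)"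
      by (rule has_derivative_transform_within_open[
            OF _ open_Int[OF open_half_planes(2)[of "- R"] open_half_planes(1)[of "1 - R"]]])
         (use 2 in \<open>auto simp: ramp_def\<close>)
    then show ?thesis using 2 by (simp add: ramp_grad_def inner_axis')
  next
    case 3
    have "((\<lambda>y. 1) has_derivative (\<lambda>v. 0)) (at x)" by simp
    then have "(ramp R has_derivative (\<lambda>v. 0)) (at x)"
      by (rule has_derivative_transform_within_open[OF _ open_half_planes(2)[of "1 - R"]])
         (use 3 in \<open>auto simp: ramp_def\<close>)
    then show ?thesis using 3 by (simp add: ramp_grad_def)
  qed
qed

lemma norm_ramp_grad_le: "norm (ramp_grad R x) \<le> 1"
  by (simp add: ramp_grad_def)

lemma ramp_bounded_lipschitz_grad: "bounded_lipschitz_grad (ramp R) (ramp_grad R)"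
  unfolding bounded_lipschitz_grad_def
proof (intro conjI)
  show "bounded (range (ramp R))" using ramp_bounds by (auto simp: bounded_iff intro!: exI[of _ 1])
  show "bounded (range (ramp_grad R))" using norm_ramp_grad_le by (auto simp: bounded_iff)
  have "1-lipschitz_on UNIV (ramp R)"
  proof (rule lipschitz_onI)
    fix x y :: R2
    have "\<bar>ramp R x - ramp R y\<bar> \<le> \<bar>(x - y) $ 1\<bar>" by (auto simp: ramp_def max_def min_def)
    then show "dist (ramp R x) (ramp R y) \<le> 1 * dist x y"
      using component_le_norm_cart[of "x - y" 1] by (simp add: dist_norm)
  qed simp
  then show "\<exists>L. L-lipschitz_on UNIV (ramp R)" ..
  show "ramp_grad R \<in> borel_measurable borel" unfolding ramp_grad_def by measurable
  show "AE x in lborel. (ramp R has_derivative (\<lambda>v. ramp_grad R x \<bullet> v)) (at x)"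
    using AE_lborel_not_hyperplane[of 1 "- R"] AE_lborel_not_hyperplane[of 1 "1 - R"]
    by eventually_elim (rule ramp_has_derivative)
qed

definition ramp_cut :: "real \<Rightarrow> (R2 \<Rightarrow> real) \<Rightarrow> R2 \<Rightarrow> real" where
  "ramp_cut R v x = ramp R x * v x"

definition ramp_cut_grad :: "real \<Rightarrow> (R2 \<Rightarrow> real) \<Rightarrow> (R2 \<Rightarrow> R2) \<Rightarrow> R2 \<Rightarrow> R2" where
  "ramp_cut_grad R v g x = ramp R x *\<^sub>R g x + v x *\<^sub>R ramp_grad R x"

lemma H1_ramp_cut: "H1_with_grad v g \<Longrightarrow> H1_with_grad (ramp_cut R v) (ramp_cut_grad R v g)"
  unfolding ramp_cut_def[abs_def] ramp_cut_grad_def[abs_def]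
  by (rule H1_mult_bounded_lipschitz[OF _ ramp_bounded_lipschitz_grad])

lemma ramp_cut_eq_0: "x $ 1 \<le> - R \<Longrightarrow> ramp_cut R v x = 0"
  by (simp add: ramp_cut_def ramp_def)

lemma ramp_cut_eq: "1 - R \<le> x $ 1 \<Longrightarrow> ramp_cut R v x = v x"
  by (simp add: ramp_cut_def ramp_def)

lemma eventually_in_half_plane:
  fixes x :: R2
  assumes "filterlim R at_top sequentially"
  shows "\<forall>\<^sub>F n in sequentially. 1 - R n < x $ 1"
  using assms unfolding filterlim_at_top_dense by (auto elim!: allE[of _ "1 - x $ 1"] eventually_mono)

lemma half_plane_lebesgue_measurable:
  "{x::R2. x $ 1 < a} \<in> sets lebesgue" "{x::R2. a \<le> x $ 1} \<in> sets lebesgue"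
proof -
  have "{x::R2. x $ 1 < a} \<in> sets borel" "{x::R2. a \<le> x $ 1} \<in> sets borel" by measurable
  then show "{x::R2. x $ 1 < a} \<in> sets lebesgue" "{x::R2. a \<le> x $ 1} \<in> sets lebesgue" by auto
qed

lemma integrable_on_half_plane:
  fixes h :: "R2 \<Rightarrow> real"
  assumes "integrable lebesgue h"
  shows "integrable lebesgue (\<lambda>x. h x * indicator {x. a \<le> x $ 1} x)"
    "integrable lebesgue (\<lambda>x. h x * indicator {x. x $ 1 < a} x)"
  using integrable_mult_indicator[OF half_plane_lebesgue_measurable(2) assms]
    integrable_mult_indicator[OF half_plane_lebesgue_measurable(1) assms] by (simp_all add: mult.commute)

lemma integral_on_half_plane_tendsto:
  fixes h :: "R2 \<Rightarrow> real"
  assumes h: "integrable lebesgue h" and R: "filterlim R at_top sequentially"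
  shows "(\<lambda>n. \<integral>x. h x * indicator {x. 1 - R n \<le> x $ 1} x \<partial>lebesgue) \<longlonglongrightarrow> (\<integral>x. h x \<partial>lebesgue)"
    and "(\<lambda>n. \<integral>x. h x * indicator {x. x $ 1 < 1 - R n} x \<partial>lebesgue) \<longlonglongrightarrow> 0"
proof -
  show lim: "(\<lambda>n. \<integral>x. h x * indicator {x. 1 - R n \<le> x $ 1} x \<partial>lebesgue) \<longlonglongrightarrow> (\<integral>x. h x \<partial>lebesgue)"
  proof (rule integral_dominated_convergence[where w = "\<lambda>x. \<bar>h x\<bar>"])
    show "AE x in lebesgue. (\<lambda>n. h x * indicator {x. 1 - R n \<le> x $ 1} x) \<longlonglongrightarrow> h x"
    proof (intro AE_I2 tendsto_eventually)
      show "\<forall>\<^sub>F n in sequentially. h x * indicator {x. 1 - R n \<le> x $ 1} x = h x" for x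
        using eventually_in_half_plane[OF R, of x] by eventually_elim simp
    qed
    show "AE x in lebesgue. norm (h x * indicator {x. 1 - R n \<le> x $ 1} x) \<le> \<bar>h x\<bar>" for n
      by (intro AE_I2) (auto split: split_indicator)
    show "(\<lambda>x. h x * indicator {x. 1 - R n \<le> x $ 1} x) \<in> borel_measurable lebesgue" for n
      by (rule borel_measurable_integrable[OF integrable_on_half_plane(1)[OF h]])
  qed (use h in auto)
  have "(\<integral>x. h x * indicator {x. x $ 1 < 1 - R n} x \<partial>lebesgue) =
      (\<integral>x. h x \<partial>lebesgue) - (\<integral>x. h x * indicator {x. 1 - R n \<le> x $ 1} x \<partial>lebesgue)" for n
  proof -
    have "(\<integral>x. h x * indicator {x. x $ 1 < 1 - R n} x \<partial>lebesgue) =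
        (\<integral>x. h x - h x * indicator {x. 1 - R n \<le> x $ 1} x \<partial>lebesgue)"
      by (intro Bochner_Integration.integral_cong) (auto split: split_indicator)
    then show ?thesis using h integrable_on_half_plane(1)[OF h] by simp
  qed
  then show "(\<lambda>n. \<integral>x. h x * indicator {x. x $ 1 < 1 - R n} x \<partial>lebesgue) \<longlonglongrightarrow> 0"
    using tendsto_diff[OF tendsto_const lim, of "\<integral>x. h x \<partial>lebesgue"] by simp
qed

lemma L2_norm_sq_ramp_cut_tendsto:
  assumes H1_grad: "H1_with_grad v g" and R: "filterlim R at_top sequentially"
  shows "(\<lambda>n. L2_norm_sq (ramp_cut (R n) v)) \<longlonglongrightarrow> L2_norm_sq v"
    and "(\<lambda>n. L2_norm_sq (ramp_cut_grad (R n) v g)) \<longlonglongrightarrow> L2_norm_sq g"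
proof -
  note borel = H1_with_grad_measurable[OF H1_grad] H1_with_grad_measurable[OF H1_ramp_cut[OF H1_grad]]
  note L2 = integrable_power2[OF H1_with_gradD(1)[OF H1_grad]] integrable_norm_power2[OF H1_with_gradD(2)[OF H1_grad]]
  show "(\<lambda>n. L2_norm_sq (ramp_cut (R n) v)) \<longlonglongrightarrow> L2_norm_sq v"
  proof (rule L2_norm_sq_tendsto[OF borel(3,1) L2(1)])
    show "(norm (ramp_cut (R n) v x))\<^sup>2 \<le> (v x)\<^sup>2" for n x
      using ramp_bounds by (auto simp: ramp_cut_def power_mult_distrib intro!: mult_left_le_one_le power_le_one)
    show "\<forall>\<^sub>F n in sequentially. ramp_cut (R n) v x = v x" for x
      using eventually_in_half_plane[OF R, of x] by eventually_elim (simp add: ramp_cut_eq)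
  qed
  show "(\<lambda>n. L2_norm_sq (ramp_cut_grad (R n) v g)) \<longlonglongrightarrow> L2_norm_sq g"
  proof (rule L2_norm_sq_tendsto[OF borel(4,2)])
    show "integrable lebesgue (\<lambda>x. 2 * (norm (g x))\<^sup>2 + 2 * (v x)\<^sup>2)" using L2 by simp
    show "(norm (ramp_cut_grad (R n) v g x))\<^sup>2 \<le> 2 * (norm (g x))\<^sup>2 + 2 * (v x)\<^sup>2" for n x
    proof -
      have "(norm (ramp (R n) x *\<^sub>R g x))\<^sup>2 \<le> (norm (g x))\<^sup>2"
        using ramp_bounds[of "R n" x] by (intro power_mono) (auto simp: mult_left_le_one_le)
      moreover have "(norm (v x *\<^sub>R ramp_grad (R n) x))\<^sup>2 \<le> \<bar>v x\<bar>\<^sup>2"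
        using norm_ramp_grad_le[of "R n" x] by (intro power_mono) (auto simp: mult_left_le)
      ultimately show ?thesis
        using norm_add_power2_le[of "ramp (R n) x *\<^sub>R g x" "v x *\<^sub>R ramp_grad (R n) x"]
        unfolding ramp_cut_grad_def power2_abs by linarith
    qed
    show "\<forall>\<^sub>F n in sequentially. ramp_cut_grad (R n) v g x = g x" for x
      using eventually_in_half_plane[OF R, of x] by eventually_elim (simp add: ramp_cut_grad_def ramp_def ramp_grad_def)
  qed
qed

subsection \<open>The energy on the Nehari set\<close>

lemma Fprim_has_derivative:
  assumes f: "continuous_on UNIV f"
  shows "(Fprim f has_real_derivative f s) (at s)"
proof -
  define K where "K = \<bar>s\<bar> + 1"
  define G where "G u = integral {- K..u} f" for u
  have integrable: "f integrable_on {a..b}" for a b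
    using f by (intro integrable_continuous_real) (rule continuous_on_subset, auto)
  have Fprim_eq: "Fprim f u = G u - G 0" if "u \<in> {- K<..<K}" for u
  proof (cases "0 \<le> u")
    case True
    then show ?thesis
      using Henstock_Kurzweil_Integration.integral_combine[OF _ True integrable, of "- K"] that
      by (simp add: Fprim_def G_def K_def)
  next
    case False
    then show ?thesis
      using Henstock_Kurzweil_Integration.integral_combine[of "- K" u 0 f] integrable that
      by (simp add: Fprim_def G_def)
  qed
  have s: "- K < s" "s < K" by (auto simp: K_def)
  have "(G has_real_derivative f s) (at s within {- K..K})"
    unfolding G_def using s f by (intro integral_has_real_derivative) (auto intro: continuous_on_subset)
  then have "((\<lambda>u. G u - G 0) has_real_derivative f s) (at s)"
    using s by (auto simp: at_within_Icc_at intro!: derivative_eq_intros)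
  then show ?thesis
    by (rule has_field_derivative_transform_within_open[where S = "{- K<..<K}"]) (use s Fprim_eq in auto)
qed

lemma L2_norm_sq_parts:
  assumes H1_grad: "H1_with_grad u g"
  shows "L2_norm_sq u = L2_norm_sq (pos_part u) + L2_norm_sq (neg_part u)"
    and "L2_norm_sq g = L2_norm_sq (\<lambda>x. if 0 < u x then g x else 0) + L2_norm_sq (\<lambda>x. if u x < 0 then g x else 0)"
proof -
  note p = H1_pos_part[OF H1_grad] and n = H1_neg_part[OF H1_grad]
  note [measurable] = H1_with_grad_measurable[OF H1_grad]
  have "L2_norm_sq u = (\<integral>x. (pos_part u x)\<^sup>2 + (neg_part u x)\<^sup>2 \<partial>lebesgue)"
    unfolding L2_norm_sq_def pos_part_def neg_part_def
    by (intro Bochner_Integration.integral_cong) (auto simp: max_def min_def)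
  then show "L2_norm_sq u = L2_norm_sq (pos_part u) + L2_norm_sq (neg_part u)"
    using integrable_power2[OF H1_with_gradD(1)[OF p]] integrable_power2[OF H1_with_gradD(1)[OF n]]
    by (simp add: L2_norm_sq_def)
  have "L2_norm_sq g = (\<integral>x. (norm (if 0 < u x then g x else 0))\<^sup>2 + (norm (if u x < 0 then g x else 0))\<^sup>2 \<partial>lebesgue)"
    unfolding L2_norm_sq_def
  proof (rule integral_cong_AE)
    show "AE x in lebesgue. (norm (g x))\<^sup>2 =
        (norm (if 0 < u x then g x else 0))\<^sup>2 + (norm (if u x < 0 then g x else 0))\<^sup>2"
      using H1_grad_eq_0_on_zero_level[OF H1_grad] by eventually_elim auto
  qed measurable
  then show "L2_norm_sq g = L2_norm_sq (\<lambda>x. if 0 < u x then g x else 0) + L2_norm_sq (\<lambda>x. if u x < 0 then g x else 0)"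
    using integrable_norm_power2[OF H1_with_gradD(2)[OF p]] integrable_norm_power2[OF H1_with_gradD(2)[OF n]]
    by (simp add: L2_norm_sq_def)
qed

locale ambrosetti_rabinowitz =
  fixes V0 \<theta> :: real and f :: "real \<Rightarrow> real"
  assumes V0_pos: "0 < V0" and f_continuous: "continuous_on UNIV f" and theta_gt_2: "2 < \<theta>"
    and superquadratic: "\<And>s. s \<noteq> 0 \<Longrightarrow> 0 < \<theta> * Fprim f s \<and> \<theta> * Fprim f s \<le> s * f s"
begin

abbreviation F :: "real \<Rightarrow> real" where "F \<equiv> Fprim f"

lemma F_has_derivative: "(F has_real_derivative f s) (at s)"
  by (rule Fprim_has_derivative[OF f_continuous])

lemma f_borel [measurable]: "f \<in> borel_measurable borel"
  by (rule borel_measurable_continuous_onI[OF f_continuous])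

lemma F_borel [measurable]: "F \<in> borel_measurable borel"
  using F_has_derivative
  by (intro borel_measurable_continuous_onI) (meson DERIV_isCont continuous_at_imp_continuous_on)

lemma F_0 [simp]: "F 0 = 0"
  by (simp add: Fprim_def)

lemma f_mult_nonneg: "0 \<le> f s * s"
  using superquadratic[of s] by (cases "s = 0") (auto simp: mult.commute)

lemma F_nonneg: "0 \<le> F s"
  using superquadratic[of s] theta_gt_2 by (cases "s = 0") (auto simp: zero_less_mult_iff)

lemma F_le_divide: "F s \<le> f s * s / \<theta>"
  using superquadratic[of s] theta_gt_2 by (cases "s = 0") (auto simp: field_simps)

lemma F_le: "F s \<le> f s * s"
proof -
  have "f s * s / \<theta> \<le> f s * s / 1" using theta_gt_2 f_mult_nonneg by (intro divide_left_mono) auto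
  then show ?thesis using F_le_divide[of s] by simp
qed

lemma f_sign: "s < 0 \<Longrightarrow> f s \<le> 0" "0 < s \<Longrightarrow> 0 \<le> f s"
  using f_mult_nonneg[of s] by (auto simp: zero_le_mult_iff)

lemma f_0: "f 0 = 0"
proof (rule antisym)
  have lim: "(f \<longlongrightarrow> f 0) (at 0 within S)" for S
    using f_continuous by (auto simp: continuous_on_def intro: tendsto_within_subset)
  show "f 0 \<le> 0"
    by (rule tendsto_upperbound[OF lim[of "{..<0}"]]) (auto simp: eventually_at_filter f_sign)
  show "0 \<le> f 0"
    by (rule tendsto_lowerbound[OF lim[of "{0<..}"]]) (auto simp: eventually_at_filter f_sign)
qed

text \<open>Since \<open>f\<close> need not be monotone on the negative axis, \<open>f (\<sigma> s) \<sigma> s\<close> is controlled by \<open>f s s\<close> only on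
  average over \<open>\<sigma>\<close>.\<close>

lemma nn_integral_f_scaled_le_F:
  "(\<integral>\<^sup>+\<sigma>. ennreal (f (\<sigma> * s) * (\<sigma> * s)) * indicator {0..1} \<sigma> \<partial>lborel) \<le> ennreal (F s)"
proof -
  have nonneg: "0 \<le> f (\<sigma> * s) * s" if "0 \<le> \<sigma>" for \<sigma>
  proof (cases "\<sigma> = 0")
    case False
    have "0 \<le> f (\<sigma> * s) * (\<sigma> * s) / \<sigma>" by (rule divide_nonneg_nonneg[OF f_mult_nonneg that])
    then show ?thesis using False by simp
  qed (simp add: f_0)
  have "(\<integral>\<^sup>+\<sigma>. ennreal (f (\<sigma> * s) * (\<sigma> * s)) * indicator {0..1} \<sigma> \<partial>lborel)
      \<le> (\<integral>\<^sup>+\<sigma>. ennreal (f (\<sigma> * s) * s) * indicator {0..1} \<sigma> \<partial>lborel)"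
  proof (intro nn_integral_mono)
    fix \<sigma> :: real
    have "f (\<sigma> * s) * (\<sigma> * s) \<le> f (\<sigma> * s) * s" if "\<sigma> \<in> {0..1}"
      using mult_left_le_one_le[OF nonneg, of \<sigma> \<sigma>] that by (simp add: mult_ac)
    then show "ennreal (f (\<sigma> * s) * (\<sigma> * s)) * indicator {0..1} \<sigma> \<le> ennreal (f (\<sigma> * s) * s) * indicator {0..1} \<sigma>"
      by (auto intro: ennreal_leI split: split_indicator)
  qed
  also have "\<dots> = ennreal (F (1 * s) - F (0 * s))"
  proof (rule nn_integral_FTC_Icc)
    show "((\<lambda>\<sigma>. F (\<sigma> * s)) has_real_derivative f (\<sigma> * s) * s) (at \<sigma>)" for \<sigma>
      by (rule DERIV_chain2[OF F_has_derivative]) (auto intro!: derivative_eq_intros)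
  qed (use nonneg in auto)
  finally show ?thesis by simp
qed

definition reaction :: "(R2 \<Rightarrow> real) \<Rightarrow> real" where
  "reaction u = (\<integral>x. f (u x) * u x \<partial>lebesgue)"

definition potential :: "(R2 \<Rightarrow> real) \<Rightarrow> real" where
  "potential u = (\<integral>x. F (u x) \<partial>lebesgue)"

definition zero_order_deriv :: "(R2 \<Rightarrow> real) \<Rightarrow> real" where
  "zero_order_deriv u = V0 * L2_norm_sq u - reaction u"

definition zero_order_energy :: "(R2 \<Rightarrow> real) \<Rightarrow> real" where
  "zero_order_energy u = V0 / 2 * L2_norm_sq u - potential u"

abbreviation energy_ratio :: "(R2 \<Rightarrow> real) \<Rightarrow> real" where
  "energy_ratio u \<equiv> 1/2 - zero_order_energy u / zero_order_deriv u"

text \<open>The energy of the dilate of \<open>u\<close> that lies on the Nehari set.\<close>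

definition dilation_energy :: "(R2 \<Rightarrow> real) \<Rightarrow> (R2 \<Rightarrow> R2) \<Rightarrow> real" where
  "dilation_energy u g = L2_norm_sq g * energy_ratio u"

definition admissible :: "(R2 \<Rightarrow> real) \<Rightarrow> (R2 \<Rightarrow> R2) \<Rightarrow> bool" where
  "admissible u g \<longleftrightarrow> H1_with_grad u g \<and> integrable lebesgue (\<lambda>x. f (u x) * u x)"

definition on_nehari :: "(R2 \<Rightarrow> real) \<Rightarrow> bool" where
  "on_nehari u \<longleftrightarrow> nonzero u \<and> dJ V0 f u u = 0"

lemma admissibleD:
  assumes "admissible u g"
  shows "H1_with_grad u g" "integrable lebesgue (\<lambda>x. f (u x) * u x)"
  using assms by (auto simp: admissible_def)

lemma admissible_F_integrable:
  assumes "admissible u g"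
  shows "integrable lebesgue (\<lambda>x. F (u x))"
proof (rule Bochner_Integration.integrable_bound[OF admissibleD(2)[OF assms]])
  show "(\<lambda>x. F (u x)) \<in> borel_measurable lebesgue"
    using H1_with_grad_measurable(1)[OF admissibleD(1)[OF assms]] by measurable
qed (use F_nonneg F_le f_mult_nonneg in \<open>auto simp: abs_of_nonneg\<close>)

lemma
  assumes H1_grad: "H1_with_grad u g" and nz: "nonzero u"
  shows Jfun_eq: "Jfun V0 f u = L2_norm_sq g / 2 + zero_order_energy u"
    and dJ_eq: "dJ V0 f u u = L2_norm_sq g + zero_order_deriv u"
proof -
  note [measurable] = H1_with_grad_measurable[OF H1_grad] wgrad_is_weak_grad(1)[OF H1_grad]
  have "(\<integral>x. (norm (wgrad u x))\<^sup>2 + V0 * (u x)\<^sup>2 \<partial>lebesgue) = (\<integral>x. (norm (g x))\<^sup>2 + V0 * (u x)\<^sup>2 \<partial>lebesgue)"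
    by (rule integral_cong_AE) (use wgrad_AE_eq[OF H1_grad nz] in auto)
  also have "\<dots> = L2_norm_sq g + V0 * L2_norm_sq u"
    using integrable_power2[OF H1_with_gradD(1)[OF H1_grad]] integrable_norm_power2[OF H1_with_gradD(2)[OF H1_grad]]
    by (simp add: L2_norm_sq_def)
  finally have quadratic: "(\<integral>x. (norm (wgrad u x))\<^sup>2 + V0 * (u x)\<^sup>2 \<partial>lebesgue) = L2_norm_sq g + V0 * L2_norm_sq u" .
  then show "Jfun V0 f u = L2_norm_sq g / 2 + zero_order_energy u"
    by (simp add: Jfun_def zero_order_energy_def potential_def field_simps)
  show "dJ V0 f u u = L2_norm_sq g + zero_order_deriv u"
    using quadratic
    by (simp add: dJ_def zero_order_deriv_def reaction_def dot_square_norm mult.assoc power2_eq_square[symmetric])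
qed

lemma nonzero_of_zero_order_deriv_neg:
  assumes "zero_order_deriv u < 0"
  shows "nonzero u"
  unfolding nonzero_def
proof
  assume zero: "AE x in lebesgue. u x = 0"
  have "L2_norm_sq u = 0" unfolding L2_norm_sq_def by (rule integral_eq_zero_AE) (use zero in auto)
  moreover have "reaction u = 0" unfolding reaction_def by (rule integral_eq_zero_AE) (use zero in auto)
  ultimately show False using assms by (simp add: zero_order_deriv_def)
qed

context
  fixes u g assumes H1_grad: "H1_with_grad u g" and nehari: "on_nehari u"
begin

lemma on_nehari_zero_order_deriv: "zero_order_deriv u = - L2_norm_sq g" "zero_order_deriv u < 0"
  using dJ_eq[OF H1_grad] H1_L2_norm_sq_pos(2)[OF H1_grad] nehari by (auto simp: on_nehari_def)

lemma on_nehari_reaction_pos: "0 < reaction u"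
proof -
  have "0 < V0 * L2_norm_sq u"
    using V0_pos H1_L2_norm_sq_pos(1)[OF H1_grad] nehari by (simp add: on_nehari_def)
  then show ?thesis using on_nehari_zero_order_deriv(2) by (simp add: zero_order_deriv_def)
qed

text \<open>A non-integrable \<open>f (u) u\<close> would have integral 0, which the constraint excludes.\<close>

lemma on_nehari_admissible: "admissible u g"
proof -
  have "integrable lebesgue (\<lambda>x. f (u x) * u x)"
    using on_nehari_reaction_pos not_integrable_integral_eq[of lebesgue "\<lambda>x. f (u x) * u x"]
    by (auto simp: reaction_def)
  with H1_grad show ?thesis by (simp add: admissible_def)
qed

lemma on_nehari_Jfun_eq: "Jfun V0 f u = dilation_energy u g"
  using Jfun_eq[OF H1_grad] H1_L2_norm_sq_pos(2)[OF H1_grad] nehari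
  by (simp add: dilation_energy_def on_nehari_zero_order_deriv(1) on_nehari_def algebra_simps)

lemma on_nehari_Jfun_pos: "0 < Jfun V0 f u"
proof -
  have "potential u \<le> (\<integral>x. f (u x) * u x / \<theta> \<partial>lebesgue)"
    unfolding potential_def
    using admissible_F_integrable[OF on_nehari_admissible] admissibleD(2)[OF on_nehari_admissible] F_le_divide
    by (intro integral_mono) auto
  also have "\<dots> = reaction u / \<theta>" by (simp add: reaction_def)
  also have "\<dots> < reaction u / 2" using theta_gt_2 on_nehari_reaction_pos by (intro divide_strict_left_mono) auto
  finally show ?thesis
    using Jfun_eq[OF H1_grad] on_nehari_zero_order_deriv(1) nehari
    by (simp add: on_nehari_def zero_order_energy_def zero_order_deriv_def)
qed

end

lemma Mset_iff: "u \<in> Mset V0 f \<longleftrightarrow> (\<exists>g. H1_with_grad u g) \<and> on_nehari (pos_part u) \<and> on_nehari (neg_part u)"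
  by (auto simp: Mset_def H1_iff on_nehari_def)

lemma Jfun_parts:
  assumes H1_grad: "H1_with_grad u g" and nehari: "on_nehari (pos_part u)" "on_nehari (neg_part u)"
  shows "Jfun V0 f u = Jfun V0 f (pos_part u) + Jfun V0 f (neg_part u)"
proof -
  note p = H1_pos_part[OF H1_grad] and n = H1_neg_part[OF H1_grad]
  have nz: "nonzero (pos_part u)" "nonzero (neg_part u)" using nehari by (auto simp: on_nehari_def)
  have "nonzero u"
    unfolding nonzero_def
  proof
    assume "AE x in lebesgue. u x = 0"
    then have "AE x in lebesgue. pos_part u x = 0" by eventually_elim (simp add: pos_part_def)
    then show False using nz(1) by (simp add: nonzero_def)
  qed
  have "potential u = (\<integral>x. F (pos_part u x) + F (neg_part u x) \<partial>lebesgue)"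
    unfolding potential_def pos_part_def neg_part_def
    by (intro Bochner_Integration.integral_cong) (auto simp: max_def min_def)
  then have "potential u = potential (pos_part u) + potential (neg_part u)"
    using admissible_F_integrable[OF on_nehari_admissible[OF p nehari(1)]]
      admissible_F_integrable[OF on_nehari_admissible[OF n nehari(2)]] by (simp add: potential_def)
  then show ?thesis
    unfolding Jfun_eq[OF H1_grad \<open>nonzero u\<close>] Jfun_eq[OF p nz(1)] Jfun_eq[OF n nz(2)] zero_order_energy_def
      L2_norm_sq_parts[OF H1_grad] by (simp add: algebra_simps)
qed

lemma c_hat_le:
  assumes "u \<in> Mset V0 f"
  shows "c_hat V0 f \<le> Jfun V0 f u"
  unfolding c_hat_def
proof (rule cInf_lower)
  show "bdd_below (Jfun V0 f ` Mset V0 f)"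
  proof (rule bdd_belowI2)
    fix v assume "v \<in> Mset V0 f"
    then obtain g where v: "H1_with_grad v g" "on_nehari (pos_part v)" "on_nehari (neg_part v)"
      by (auto simp: Mset_iff)
    show "0 \<le> Jfun V0 f v"
      using Jfun_parts[OF v] on_nehari_Jfun_pos[OF H1_pos_part[OF v(1)] v(2)]
        on_nehari_Jfun_pos[OF H1_neg_part[OF v(1)] v(3)] by simp
  qed
qed (use assms in auto)

lemma c_hat_le_disjoint_add:
  assumes v: "H1_with_grad v g" "on_nehari v" "\<And>x. 0 \<le> v x" and m: "H1_with_grad m h" "on_nehari m" "\<And>x. m x \<le> 0"
    and disjoint: "\<And>x. v x = 0 \<or> m x = 0"
  shows "c_hat V0 f \<le> Jfun V0 f v + Jfun V0 f m"
proof -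
  define u where "u = (\<lambda>x. v x + m x)"
  have "max (v x + m x) 0 = v x" "min (v x + m x) 0 = m x" for x
    using disjoint[of x] v(3)[of x] m(3)[of x] by auto
  then have parts: "pos_part u = v" "neg_part u = m" by (simp_all add: pos_part_def neg_part_def u_def)
  have H1_grad: "H1_with_grad u (\<lambda>x. g x + h x)" using H1_lincomb[OF v(1) m(1), of 1 1] by (simp add: u_def)
  then have "u \<in> Mset V0 f" using v(2) m(2) by (auto simp: Mset_iff parts)
  then have "c_hat V0 f \<le> Jfun V0 f u" by (rule c_hat_le)
  also have "\<dots> = Jfun V0 f v + Jfun V0 f m" using Jfun_parts[OF H1_grad] v(2) m(2) by (simp add: parts)
  finally show ?thesis .
qed

subsection \<open>Dilations\<close>

lemma
  fixes a :: R2
  assumes u: "admissible u g" and l: "l \<noteq> 0"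
  shows L2_norm_sq_grad_dilation: "L2_norm_sq (\<lambda>x. l *\<^sub>R g (a + l *\<^sub>R x)) = L2_norm_sq g"
    and zero_order_deriv_dilation: "zero_order_deriv (\<lambda>x. u (a + l *\<^sub>R x)) = zero_order_deriv u / l\<^sup>2"
    and zero_order_energy_dilation: "zero_order_energy (\<lambda>x. u (a + l *\<^sub>R x)) = zero_order_energy u / l\<^sup>2"
proof -
  note [measurable] = H1_with_grad_measurable[OF admissibleD(1)[OF u]]
  have "L2_norm_sq (\<lambda>x. l *\<^sub>R g (a + l *\<^sub>R x)) = l\<^sup>2 * L2_norm_sq (\<lambda>x. g (a + l *\<^sub>R x))"
    by (simp add: L2_norm_sq_def power_mult_distrib)
  then show "L2_norm_sq (\<lambda>x. l *\<^sub>R g (a + l *\<^sub>R x)) = L2_norm_sq g"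
    using L2_norm_sq_dilation[of g l a] l by simp
  have "L2_norm_sq (\<lambda>x. u (a + l *\<^sub>R x)) = L2_norm_sq u / l\<^sup>2" using L2_norm_sq_dilation[of u l a] l by simp
  moreover have "reaction (\<lambda>x. u (a + l *\<^sub>R x)) = reaction u / l\<^sup>2" "potential (\<lambda>x. u (a + l *\<^sub>R x)) = potential u / l\<^sup>2"
    using integral_dilation[OF l, of "\<lambda>x. f (u x) * u x" a] integral_dilation[OF l, of "\<lambda>x. F (u x)" a]
    by (simp_all add: reaction_def potential_def divide_inverse mult.commute)
  ultimately show "zero_order_deriv (\<lambda>x. u (a + l *\<^sub>R x)) = zero_order_deriv u / l\<^sup>2"
    "zero_order_energy (\<lambda>x. u (a + l *\<^sub>R x)) = zero_order_energy u / l\<^sup>2"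
    by (simp_all add: zero_order_deriv_def zero_order_energy_def diff_divide_distrib)
qed

text \<open>A negative factor reflects a half-plane to the opposite one.\<close>

lemma ex_dilation_on_nehari:
  assumes u: "admissible u g" and neg: "zero_order_deriv u < 0" and \<epsilon>: "\<epsilon> = 1 \<or> \<epsilon> = -1"
  obtains l h where "0 < l * \<epsilon>" "H1_with_grad (\<lambda>x. u (a + l *\<^sub>R x)) h" "on_nehari (\<lambda>x. u (a + l *\<^sub>R x))"
    "Jfun V0 f (\<lambda>x. u (a + l *\<^sub>R x)) = dilation_energy u g"
proof -
  have A: "0 < L2_norm_sq g"
    by (rule H1_L2_norm_sq_pos(2)[OF admissibleD(1)[OF u] nonzero_of_zero_order_deriv_neg[OF neg]])
  then have ratio: "0 < - zero_order_deriv u / L2_norm_sq g" using neg by (intro divide_pos_pos) auto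
  define l where "l = \<epsilon> * sqrt (- zero_order_deriv u / L2_norm_sq g)"
  have l_power2: "l\<^sup>2 = - zero_order_deriv u / L2_norm_sq g"
    using \<epsilon> real_sqrt_pow2[OF less_imp_le[OF ratio]] by (auto simp: l_def power_mult_distrib)
  have l: "l \<noteq> 0" using l_power2 ratio by auto
  let ?v = "\<lambda>x. u (a + l *\<^sub>R x)"
  note H1_grad = H1_dilation[OF admissibleD(1)[OF u] l, of a]
  have deriv: "zero_order_deriv ?v = - L2_norm_sq g"
    using A neg unfolding zero_order_deriv_dilation[OF u l] l_power2 by (simp add: field_simps)
  then have nz: "nonzero ?v" using A by (intro nonzero_of_zero_order_deriv_neg) simp
  then have nehari: "on_nehari ?v"
    unfolding on_nehari_def dJ_eq[OF H1_grad nz] L2_norm_sq_grad_dilation[OF u l] deriv by simp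
  have "Jfun V0 f ?v = dilation_energy u g"
    unfolding Jfun_eq[OF H1_grad nz] L2_norm_sq_grad_dilation[OF u l] zero_order_energy_dilation[OF u l]
      l_power2 dilation_energy_def by (simp add: algebra_simps)
  with that[OF _ H1_grad nehari] show ?thesis using \<epsilon> ratio by (auto simp: l_def)
qed

lemma c_hat_le_half_planes:
  assumes v: "admissible v g" "zero_order_deriv v < 0" "\<And>x. 0 \<le> v x" "\<And>x. x $ 1 \<le> - R \<Longrightarrow> v x = 0"
    and m: "admissible m h" "zero_order_deriv m < 0" "\<And>x. m x \<le> 0" "\<And>x. x $ 1 \<le> - R' \<Longrightarrow> m x = 0"
  shows "c_hat V0 f \<le> dilation_energy v g + dilation_energy m h"
proof -
  obtain l g' where l: "0 < l * 1" "H1_with_grad (\<lambda>x. v (axis 1 (- R) + l *\<^sub>R x)) g'"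
    "on_nehari (\<lambda>x. v (axis 1 (- R) + l *\<^sub>R x))" "Jfun V0 f (\<lambda>x. v (axis 1 (- R) + l *\<^sub>R x)) = dilation_energy v g"
    using ex_dilation_on_nehari[OF v(1,2), of 1 "axis 1 (- R)"] by blast
  obtain k h' where k: "0 < k * (-1)" "H1_with_grad (\<lambda>x. m (axis 1 (- R') + k *\<^sub>R x)) h'"
    "on_nehari (\<lambda>x. m (axis 1 (- R') + k *\<^sub>R x))" "Jfun V0 f (\<lambda>x. m (axis 1 (- R') + k *\<^sub>R x)) = dilation_energy m h"
    using ex_dilation_on_nehari[OF m(1,2), of "-1" "axis 1 (- R')"] by blast
  have "v (axis 1 (- R) + l *\<^sub>R x) = 0 \<or> m (axis 1 (- R') + k *\<^sub>R x) = 0" for x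
  proof (cases "x $ 1 \<le> 0")
    case True
    then show ?thesis using v(4)[of "axis 1 (- R) + l *\<^sub>R x"] l(1) by (simp add: axis_def mult_le_0_iff)
  next
    case False
    then show ?thesis using m(4)[of "axis 1 (- R') + k *\<^sub>R x"] k(1) by (simp add: axis_def mult_le_0_iff)
  qed
  from c_hat_le_disjoint_add[OF l(2,3) v(3) k(2,3) m(3) this] show ?thesis by (simp add: l(4) k(4))
qed

subsection \<open>Separation by cut-offs\<close>

definition strip_density :: "(R2 \<Rightarrow> real) \<Rightarrow> real \<Rightarrow> R2 \<Rightarrow> real" where
  "strip_density v R x = (if - R < x $ 1 \<and> x $ 1 < 1 - R then f (ramp_cut R v x) * ramp_cut R v x else 0)"

lemma strip_density_nonneg: "0 \<le> strip_density v R x"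
  using f_mult_nonneg by (simp add: strip_density_def)

lemma strip_density_measurable:
  assumes [measurable]: "v \<in> borel_measurable lebesgue"
  shows "strip_density v R \<in> borel_measurable lebesgue"
proof -
  have [measurable]: "ramp R \<in> borel_measurable lebesgue" "(\<lambda>x::R2. x $ 1) \<in> borel_measurable lebesgue"
    by (intro borel_measurable_lebesgueI bounded_lipschitz_grad_borel[OF ramp_bounded_lipschitz_grad], measurable)
       (intro borel_measurable_lebesgueI, measurable)
  show ?thesis unfolding strip_density_def ramp_cut_def by measurable
qed

lemma ramp_pair_borel [measurable]: "(\<lambda>(x, R). ramp R x) \<in> borel_measurable (borel \<Otimes>\<^sub>M borel)"
proof -
  have "continuous_on UNIV (\<lambda>z::R2 \<times> real. ramp (snd z) (fst z))"
    unfolding ramp_def by (intro continuous_intros)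
  from borel_measurable_continuous_onI[OF this] show ?thesis
    by (simp add: borel_prod case_prod_beta')
qed

lemma nn_integral_strip_density_slice_le:
  "(\<integral>\<^sup>+R. ennreal (strip_density v R x) * indicator {c..c + 1} R \<partial>lborel)
    \<le> ennreal (F (v x)) * indicator {x. x $ 1 < 1 - c} x"
proof -
  let ?H = "\<lambda>\<sigma>. ennreal (f (\<sigma> * v x) * (\<sigma> * v x)) * indicator {0..1} \<sigma>"
  have "(\<integral>\<^sup>+R. ennreal (strip_density v R x) * indicator {c..c + 1} R \<partial>lborel)
     \<le> (\<integral>\<^sup>+R. ?H (x $ 1 + 1 * R) * indicator {x. x $ 1 < 1 - c} x \<partial>lborel)"
    by (rule nn_integral_mono) (auto simp: strip_density_def ramp_cut_def ramp_def indicator_def)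
  also have "\<dots> = (\<integral>\<^sup>+R. ?H (x $ 1 + 1 * R) \<partial>lborel) * indicator {x. x $ 1 < 1 - c} x"
    by (rule nn_integral_multc) measurable
  also have "(\<integral>\<^sup>+R. ?H (x $ 1 + 1 * R) \<partial>lborel) = (\<integral>\<^sup>+\<sigma>. ?H \<sigma> \<partial>lborel)"
    using nn_integral_real_affine[of ?H 1 "x $ 1"] by simp
  also have "\<dots> * indicator {x. x $ 1 < 1 - c} x \<le> ennreal (F (v x)) * indicator {x. x $ 1 < 1 - c} x"
    by (intro mult_right_mono nn_integral_f_scaled_le_F) auto
  finally show ?thesis .
qed

lemma nn_integral_strip_density_average_le:
  assumes v: "v \<in> borel_measurable lebesgue"
  shows "(\<integral>\<^sup>+R. (\<integral>\<^sup>+x. ennreal (strip_density v R x) \<partial>lebesgue) * indicator {c..c + 1} R \<partial>lborel)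
     \<le> (\<integral>\<^sup>+x. ennreal (F (v x)) * indicator {x. x $ 1 < 1 - c} x \<partial>lebesgue)"
proof -
  obtain w where w [measurable]: "w \<in> borel_measurable borel" and eq: "AE x in lborel. v x = w x"
    using ex_borel_representative[OF v] .
  have [measurable]: "(\<lambda>(x, R). strip_density w R x) \<in> borel_measurable (lborel \<Otimes>\<^sub>M lborel)"
    unfolding strip_density_def ramp_cut_def by measurable
  have "(\<integral>\<^sup>+x. ennreal (strip_density v R x) \<partial>lebesgue) = (\<integral>\<^sup>+x. ennreal (strip_density w R x) \<partial>lborel)" for R
    unfolding nn_integral_completion
    by (rule nn_integral_cong_AE) (use eq in \<open>eventually_elim, simp add: strip_density_def ramp_cut_def\<close>)
  then have "(\<integral>\<^sup>+R. (\<integral>\<^sup>+x. ennreal (strip_density v R x) \<partial>lebesgue) * indicator {c..c + 1} R \<partial>lborel)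
      = (\<integral>\<^sup>+R. \<integral>\<^sup>+x. ennreal (strip_density w R x) * indicator {c..c + 1} R \<partial>lborel \<partial>lborel)"
    by (simp add: nn_integral_multc)
  also have "\<dots> = (\<integral>\<^sup>+x. \<integral>\<^sup>+R. ennreal (strip_density w R x) * indicator {c..c + 1} R \<partial>lborel \<partial>lborel)"
    by (rule lborel_pair.Fubini'[symmetric]) measurable
  also have "\<dots> \<le> (\<integral>\<^sup>+x. ennreal (F (w x)) * indicator {x. x $ 1 < 1 - c} x \<partial>lborel)"
    by (intro nn_integral_mono nn_integral_strip_density_slice_le)
  also have "\<dots> = (\<integral>\<^sup>+x. ennreal (F (v x)) * indicator {x. x $ 1 < 1 - c} x \<partial>lebesgue)"
    unfolding nn_integral_completion by (rule nn_integral_cong_AE) (use eq in \<open>eventually_elim, simp\<close>)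
  finally show ?thesis .
qed

lemma ex_small_strip:
  assumes v: "admissible v g"
  shows "\<exists>R\<ge>c. integrable lebesgue (strip_density v R) \<and>
    (\<integral>x. strip_density v R x \<partial>lebesgue) \<le> (\<integral>x. F (v x) * indicator {x. x $ 1 < 1 - c} x \<partial>lebesgue) + 1 / (\<bar>c\<bar> + 1)"
proof -
  note v_borel = H1_with_grad_measurable(1)[OF admissibleD(1)[OF v]]
  define \<epsilon> where "\<epsilon> = (\<integral>x. F (v x) * indicator {x. x $ 1 < 1 - c} x \<partial>lebesgue)"
  define \<delta> where "\<delta> = 1 / (\<bar>c\<bar> + 1)"
  have \<delta>: "0 < \<delta>" by (simp add: \<delta>_def add_nonneg_pos)
  have \<epsilon>: "0 \<le> \<epsilon>" unfolding \<epsilon>_def using F_nonneg by (intro Bochner_Integration.integral_nonneg) auto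
  have "(\<integral>\<^sup>+x. ennreal (F (v x)) * indicator {x. x $ 1 < 1 - c} x \<partial>lebesgue) =
      (\<integral>\<^sup>+x. ennreal (F (v x) * indicator {x. x $ 1 < 1 - c} x) \<partial>lebesgue)"
    by (intro nn_integral_cong) (auto split: split_indicator)
  also have "\<dots> = ennreal \<epsilon>"
    unfolding \<epsilon>_def using F_nonneg
    by (intro nn_integral_eq_integral integrable_on_half_plane admissible_F_integrable[OF v]) auto
  finally have "(\<integral>\<^sup>+R. (\<integral>\<^sup>+x. ennreal (strip_density v R x) \<partial>lebesgue) * indicator {c..c + 1} R \<partial>lborel) \<le> ennreal \<epsilon>"
    using nn_integral_strip_density_average_le[OF v_borel, of c] by simp
  then obtain R where R: "c \<le> R" "(\<integral>\<^sup>+x. ennreal (strip_density v R x) \<partial>lebesgue) \<le> ennreal (\<epsilon> + \<delta>)"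
    using nn_integral_Icc_ex_le[OF _ \<epsilon> \<delta>] by force
  then have integrable: "integrable lebesgue (strip_density v R)"
    by (intro integrableI_bounded strip_density_measurable v_borel)
       (auto simp: strip_density_nonneg intro: le_less_trans)
  then have "ennreal (\<integral>x. strip_density v R x \<partial>lebesgue) \<le> ennreal (\<epsilon> + \<delta>)"
    using R(2) by (subst nn_integral_eq_integral[symmetric]) (auto simp: strip_density_nonneg)
  then have "(\<integral>x. strip_density v R x \<partial>lebesgue) \<le> \<epsilon> + \<delta>" using \<epsilon> \<delta> by (subst (asm) ennreal_le_iff) auto
  with R(1) integrable show ?thesis by (auto simp: \<epsilon>_def \<delta>_def)
qed

lemma ex_vanishing_strips:
  assumes v: "admissible v g"
  obtains R where "filterlim R at_top sequentially" "\<forall>n. integrable lebesgue (strip_density v (R n))"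
    "(\<lambda>n. \<integral>x. strip_density v (R n) x \<partial>lebesgue) \<longlonglongrightarrow> 0"
proof -
  let ?tail = "\<lambda>n. \<integral>x. F (v x) * indicator {x. x $ 1 < 1 - real n} x \<partial>lebesgue"
  have "\<forall>n. \<exists>R. real n \<le> R \<and> integrable lebesgue (strip_density v R) \<and>
      (\<integral>x. strip_density v R x \<partial>lebesgue) \<le> ?tail n + mesh n"
    using ex_small_strip[OF v, of "real n" for n] by (simp add: mesh_def)
  from choice[OF this] obtain R where R: "real n \<le> R n" "integrable lebesgue (strip_density v (R n))"
    "(\<integral>x. strip_density v (R n) x \<partial>lebesgue) \<le> ?tail n + mesh n" for n by auto
  have "filterlim R at_top sequentially"
    by (rule filterlim_at_top_mono[OF filterlim_real_sequentially]) (simp add: R(1))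
  moreover have "(\<lambda>n. \<integral>x. strip_density v (R n) x \<partial>lebesgue) \<longlonglongrightarrow> 0"
  proof (rule tendsto_sandwich[OF _ _ tendsto_const])
    show "(\<lambda>n. ?tail n + mesh n) \<longlonglongrightarrow> 0"
      using integral_on_half_plane_tendsto(2)[OF admissible_F_integrable[OF v] filterlim_real_sequentially]
      by (rule tendsto_add_zero[OF _ mesh_tendsto_0])
  qed (auto simp: R(3) intro!: always_eventually Bochner_Integration.integral_nonneg strip_density_nonneg)
  ultimately show ?thesis using R(2) by (intro that[of R]) simp_all
qed

lemma f_ramp_cut_mult_eq:
  "f (ramp_cut R v x) * ramp_cut R v x = f (v x) * v x * indicator {x. 1 - R \<le> x $ 1} x + strip_density v R x"
  by (auto simp: strip_density_def ramp_cut_def ramp_def f_0 indicator_def)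

lemma F_ramp_cut_diff_le:
  "\<bar>F (ramp_cut R v x) - F (v x) * indicator {x. 1 - R \<le> x $ 1} x\<bar> \<le> strip_density v R x"
  using F_nonneg[of "ramp_cut R v x"] F_le[of "ramp_cut R v x"]
  by (auto simp: strip_density_def ramp_cut_def ramp_def indicator_def)

lemma admissible_ramp_cut:
  assumes "admissible v g" "integrable lebesgue (strip_density v R)"
  shows "admissible (ramp_cut R v) (ramp_cut_grad R v g)"
  unfolding admissible_def f_ramp_cut_mult_eq
  using H1_ramp_cut[OF admissibleD(1)[OF assms(1)]] integrable_on_half_plane(1)[OF admissibleD(2)[OF assms(1)]] assms(2)
  by simp

context
  fixes v g and R :: "nat \<Rightarrow> real"
  assumes v: "admissible v g" and R: "filterlim R at_top sequentially"
    and strip: "\<forall>n. integrable lebesgue (strip_density v (R n))" "(\<lambda>n. \<integral>x. strip_density v (R n) x \<partial>lebesgue) \<longlonglongrightarrow> 0"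
begin

lemma reaction_ramp_cut_tendsto: "(\<lambda>n. reaction (ramp_cut (R n) v)) \<longlonglongrightarrow> reaction v"
proof -
  have "reaction (ramp_cut (R n) v) =
      (\<integral>x. f (v x) * v x * indicator {x. 1 - R n \<le> x $ 1} x \<partial>lebesgue) + (\<integral>x. strip_density v (R n) x \<partial>lebesgue)" for n
    unfolding reaction_def f_ramp_cut_mult_eq
    using integrable_on_half_plane(1)[OF admissibleD(2)[OF v]] strip(1) by simp
  then show ?thesis
    using tendsto_add[OF integral_on_half_plane_tendsto(1)[OF admissibleD(2)[OF v] R] strip(2)]
    by (simp add: reaction_def)
qed

lemma potential_ramp_cut_tendsto: "(\<lambda>n. potential (ramp_cut (R n) v)) \<longlonglongrightarrow> potential v"
proof -
  let ?tail = "\<lambda>n. \<integral>x. F (v x) * indicator {x. 1 - R n \<le> x $ 1} x \<partial>lebesgue"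
  note integrable = admissible_F_integrable[OF admissible_ramp_cut[OF v strip(1)[rule_format]]]
    integrable_on_half_plane(1)[OF admissible_F_integrable[OF v]]
  have "(\<lambda>n. potential (ramp_cut (R n) v) - ?tail n) \<longlonglongrightarrow> 0"
    unfolding potential_def real_norm_def
    by (intro Lim_null_comparison[OF always_eventually strip(2)] allI)
       (simp add: abs_integral_diff_le[OF integrable strip(1)[rule_format] F_ramp_cut_diff_le])
  from tendsto_add[OF this integral_on_half_plane_tendsto(1)[OF admissible_F_integrable[OF v] R]]
  show ?thesis by (simp add: potential_def)
qed

lemma zero_order_deriv_ramp_cut_tendsto: "(\<lambda>n. zero_order_deriv (ramp_cut (R n) v)) \<longlonglongrightarrow> zero_order_deriv v"
  unfolding zero_order_deriv_def
  by (intro tendsto_intros L2_norm_sq_ramp_cut_tendsto(1)[OF admissibleD(1)[OF v] R] reaction_ramp_cut_tendsto)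

lemma dilation_energy_ramp_cut_tendsto:
  assumes "zero_order_deriv v < 0"
  shows "(\<lambda>n. dilation_energy (ramp_cut (R n) v) (ramp_cut_grad (R n) v g)) \<longlonglongrightarrow> dilation_energy v g"
  unfolding dilation_energy_def zero_order_energy_def
  by (intro tendsto_intros zero_order_deriv_ramp_cut_tendsto L2_norm_sq_ramp_cut_tendsto[OF admissibleD(1)[OF v] R]
      potential_ramp_cut_tendsto) (use assms in auto)

end

lemma c_hat_le_dilation_energy_add:
  assumes v: "admissible v g" "zero_order_deriv v < 0" "\<And>x. 0 \<le> v x"
    and m: "admissible m h" "zero_order_deriv m < 0" "\<And>x. m x \<le> 0"
  shows "c_hat V0 f \<le> dilation_energy v g + dilation_energy m h"
proof -
  obtain R where R: "filterlim R at_top sequentially" "\<forall>n. integrable lebesgue (strip_density v (R n))"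
    "(\<lambda>n. \<integral>x. strip_density v (R n) x \<partial>lebesgue) \<longlonglongrightarrow> 0" using ex_vanishing_strips[OF v(1)] .
  obtain S where S: "filterlim S at_top sequentially" "\<forall>n. integrable lebesgue (strip_density m (S n))"
    "(\<lambda>n. \<integral>x. strip_density m (S n) x \<partial>lebesgue) \<longlonglongrightarrow> 0" using ex_vanishing_strips[OF m(1)] .
  have "\<forall>\<^sub>F n in sequentially. c_hat V0 f \<le> dilation_energy (ramp_cut (R n) v) (ramp_cut_grad (R n) v g)
      + dilation_energy (ramp_cut (S n) m) (ramp_cut_grad (S n) m h)"
    using order_tendstoD(2)[OF zero_order_deriv_ramp_cut_tendsto[OF v(1) R] v(2)]
      order_tendstoD(2)[OF zero_order_deriv_ramp_cut_tendsto[OF m(1) S] m(2)]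
  proof eventually_elim
    case (elim n)
    then show ?case
      using v(3) m(3) ramp_bounds
      by (intro c_hat_le_half_planes[where R = "R n" and R' = "S n"] admissible_ramp_cut v(1) m(1)
          R(2)[rule_format] S(2)[rule_format])
         (auto simp: ramp_cut_eq_0, auto simp: ramp_cut_def mult_nonneg_nonpos)
  qed
  then show ?thesis
    by (rule tendsto_lowerbound[OF tendsto_add[OF dilation_energy_ramp_cut_tendsto[OF v(1) R v(2)]
          dilation_energy_ramp_cut_tendsto[OF m(1) S m(2)]]]) simp
qed

lemma
  assumes u: "admissible u g" and borel: "u' \<in> borel_measurable lebesgue" "g' \<in> borel_measurable lebesgue"
    and eq: "AE x in lebesgue. u x = u' x" "AE x in lebesgue. g x = g' x"
  shows admissible_cong_AE: "admissible u' g'"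
    and zero_order_deriv_cong_AE: "zero_order_deriv u' = zero_order_deriv u"
    and dilation_energy_cong_AE: "dilation_energy u' g' = dilation_energy u g"
proof -
  note borel' = H1_with_grad_measurable[OF admissibleD(1)[OF u]]
  note [measurable] = borel borel'
  have "integrable lebesgue (\<lambda>x. f (u' x) * u' x)"
    by (rule integrable_cong_AE_imp[OF admissibleD(2)[OF u]]) (use eq(1) in auto)
  then show "admissible u' g'"
    using H1_with_grad_cong_AE[OF admissibleD(1)[OF u] borel eq] by (simp add: admissible_def)
  have "reaction u' = reaction u" "potential u' = potential u"
    unfolding reaction_def potential_def by (rule integral_cong_AE; use eq(1) in auto)+
  then show "zero_order_deriv u' = zero_order_deriv u" "dilation_energy u' g' = dilation_energy u g"
    using L2_norm_sq_cong_AE[OF borel'(1) borel(1) eq(1)] L2_norm_sq_cong_AE[OF borel'(2) borel(2) eq(2)]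
    by (simp_all add: dilation_energy_def zero_order_deriv_def zero_order_energy_def)
qed

end

subsection \<open>Positivity of supersolutions\<close>

definition supersolution_below_one :: "real \<Rightarrow> (R2 \<Rightarrow> real) \<Rightarrow> (R2 \<Rightarrow> R2) \<Rightarrow> bool" where
  "supersolution_below_one \<kappa> w g \<longleftrightarrow> H1_with_grad w g \<and> (\<forall>x. 0 \<le> w x) \<and>
     (\<forall>\<zeta> k M. H1_with_grad \<zeta> k \<longrightarrow> (\<forall>x. 0 \<le> \<zeta> x \<and> \<zeta> x \<le> M) \<longrightarrow> (\<forall>x. 1 \<le> w x \<longrightarrow> \<zeta> x = 0) \<longrightarrow>
       - \<kappa> * (\<integral>x. w x * \<zeta> x \<partial>lebesgue) \<le> (\<integral>x. g x \<bullet> k x \<partial>lebesgue))"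

lemma supersolution_below_oneD:
  assumes "supersolution_below_one \<kappa> w g"
  shows "H1_with_grad w g" "0 \<le> w x"
    "H1_with_grad \<zeta> k \<Longrightarrow> (\<And>x. 0 \<le> \<zeta> x) \<Longrightarrow> (\<And>x. \<zeta> x \<le> M) \<Longrightarrow> (\<And>x. 1 \<le> w x \<Longrightarrow> \<zeta> x = 0) \<Longrightarrow>
      - \<kappa> * (\<integral>x. w x * \<zeta> x \<partial>lebesgue) \<le> (\<integral>x. g x \<bullet> k x \<partial>lebesgue)"
  using assms unfolding supersolution_below_one_def by blast+

lemma power2_pos_part_one_minus_derivative:
  "((\<lambda>s::real. (max 0 (1 - s))\<^sup>2) has_real_derivative - 2 * max 0 (1 - a)) (at a)"
proof -
  define tangent :: "real \<Rightarrow> real" where "tangent t = (max 0 (1 - a))\<^sup>2 - 2 * max 0 (1 - a) * (t - a)" for t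
  have "\<bar>(max 0 x)\<^sup>2 - (max 0 y)\<^sup>2 - 2 * max 0 y * (x - y)\<bar> \<le> (x - y)\<^sup>2" for x y :: real
  proof (cases "x < 0 \<and> 0 < y")
    case True
    then have "0 \<le> y\<^sup>2 - 2 * (x * y)"
      using mult_nonpos_nonneg[of x y] zero_le_power2[of y] by linarith
    moreover have "(max 0 x)\<^sup>2 - (max 0 y)\<^sup>2 - 2 * max 0 y * (x - y) = y\<^sup>2 - 2 * (x * y)"
      using True by (simp add: power2_eq_square algebra_simps)
    ultimately show ?thesis by (simp add: power2_diff)
  next
    case False
    then show ?thesis
      using zero_le_power2[of "x - y"] mult_nonneg_nonpos[of x y]
      by (auto simp: max_def power2_eq_square algebra_simps)
  qed
  from this[of "1 - t" "1 - a" for t]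
  have "((\<lambda>t. (max 0 (1 - t))\<^sup>2 - tangent t) has_real_derivative 0) (at a)"
    by (intro has_real_derivative_0_of_quadratic_bound[where K = 1])
       (simp add: tangent_def algebra_simps power2_commute)
  moreover have "(tangent has_real_derivative - 2 * max 0 (1 - a)) (at a)"
    unfolding tangent_def by (auto intro!: derivative_eq_intros)
  ultimately show ?thesis using DERIV_add by fastforce
qed

definition log_test :: "real \<Rightarrow> real \<Rightarrow> real" where
  "log_test d s = (max 0 (1 - s))\<^sup>2 / (s + d)"

definition log_test' :: "real \<Rightarrow> real \<Rightarrow> real" where
  "log_test' d s = - (2 * max 0 (1 - s) * (s + d) + (max 0 (1 - s))\<^sup>2) / (s + d)\<^sup>2"

definition log_weight :: "real \<Rightarrow> real \<Rightarrow> real" where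
  "log_weight d s = max 0 (1 - s) / (max 0 s + d)"

definition log_cut :: "real \<Rightarrow> real \<Rightarrow> real" where
  "log_cut d = Fprim (log_weight d)"

context
  fixes d :: real assumes d: "0 < d"
begin

lemma log_weight_continuous: "continuous_on UNIV (log_weight d)"
  unfolding log_weight_def using d by (intro continuous_intros) (auto simp: max_def)

lemma log_weight_nonneg: "0 \<le> log_weight d s"
  unfolding log_weight_def using d by (intro divide_nonneg_nonneg) auto

lemma log_weight_le: "0 \<le> s \<Longrightarrow> log_weight d s \<le> 1 / d"
  unfolding log_weight_def using d by (intro frac_le) auto

lemma log_cut_has_derivative: "(log_cut d has_real_derivative log_weight d s) (at s)"
  unfolding log_cut_def by (rule Fprim_has_derivative[OF log_weight_continuous])

lemma log_cut_0: "log_cut d 0 = 0"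
  by (simp add: log_cut_def Fprim_def)

lemma log_cut_continuous: "continuous_on UNIV (log_cut d)"
  using log_cut_has_derivative by (meson DERIV_isCont continuous_at_imp_continuous_on)

lemma log_cut_bounded_C1_on: "bounded_C1_on {0..} (1 / d) (log_cut d) (log_weight d)"
  unfolding bounded_C1_on_def
  using log_weight_nonneg log_weight_le log_cut_has_derivative log_weight_continuous log_cut_continuous
  by (auto intro: has_field_derivative_at_within continuous_on_subset borel_measurable_continuous_onI)

lemma log_cut_mono: "a \<le> b \<Longrightarrow> log_cut d a \<le> log_cut d b"
  using DERIV_nonneg_imp_nondecreasing[of a b "log_cut d"] log_cut_has_derivative log_weight_nonneg by blast

lemma log_cut_ge:
  assumes c: "0 \<le> c" "c \<le> 1/2" and "c \<le> s"
  shows "1/2 * ln (1 + c / d) \<le> log_cut d s"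
proof -
  have "log_cut d 0 - 1/2 * ln (1 + 0 / d) \<le> log_cut d c - 1/2 * ln (1 + c / d)"
  proof (rule DERIV_nonneg_imp_nondecreasing[OF c(1)])
    fix t assume t: "0 \<le> t" "t \<le> c"
    have "((\<lambda>s. log_cut d s - 1/2 * ln (1 + s / d)) has_real_derivative log_weight d t - 1/2 * (1 / (t + d))) (at t)"
      using t d by (auto intro!: derivative_eq_intros log_cut_has_derivative simp: field_simps add_pos_nonneg)
    moreover have "(1/2) / (t + d) \<le> (1 - t) / (t + d)" using t d c by (intro divide_right_mono) auto
    then have "1/2 * (1 / (t + d)) \<le> log_weight d t" using t c by (simp add: log_weight_def)
    ultimately show "\<exists>y. ((\<lambda>s. log_cut d s - 1/2 * ln (1 + s / d)) has_real_derivative y) (at t) \<and> 0 \<le> y" by force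
  qed
  then show ?thesis using log_cut_mono[OF \<open>c \<le> s\<close>] by (simp add: log_cut_0)
qed

lemma log_test_eq_0: "1 \<le> s \<Longrightarrow> log_test d s = 0"
  by (simp add: log_test_def)

lemma log_test_continuous: "continuous_on {0..} (log_test d)" "continuous_on {0..} (log_test' d)"
  unfolding log_test_def log_test'_def using d by (intro continuous_intros; auto simp: add_nonneg_eq_0_iff)+

lemma log_test_has_derivative:
  assumes "0 \<le> s"
  shows "(log_test d has_real_derivative log_test' d s) (at s)"
proof -
  have "((\<lambda>s. (max 0 (1 - s))\<^sup>2 / (s + d)) has_real_derivative log_test' d s) (at s)"
    unfolding log_test'_def
    by (rule derivative_eq_intros power2_pos_part_one_minus_derivative refl
        | use assms d in \<open>simp add: power2_eq_square\<close>)+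
  then show ?thesis unfolding log_test_def[abs_def] .
qed

context
  fixes s :: real assumes s: "0 \<le> s"
begin

lemma log_test_nonneg: "0 \<le> log_test d s"
  using s d by (simp add: log_test_def)

lemma log_test_le: "log_test d s \<le> 1 / d"
proof -
  have "(max 0 (1 - s))\<^sup>2 \<le> 1" using s by (intro power_le_one) auto
  then show ?thesis unfolding log_test_def using s d by (intro frac_le) auto
qed

lemma mult_log_test_le_1: "s * log_test d s \<le> 1"
proof -
  have "(max 0 (1 - s))\<^sup>2 \<le> 1" using s by (intro power_le_one) auto
  then have "s * (max 0 (1 - s))\<^sup>2 \<le> s + d" using s d mult_left_mono[of "(max 0 (1 - s))\<^sup>2" 1 s] by simp
  then show ?thesis using s d by (simp add: log_test_def divide_le_eq)
qed

lemma log_test_le_log_weight: "log_test d s \<le> log_weight d s"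
  unfolding log_test_def log_weight_def using s d
  by (auto simp: max_def power2_eq_square mult_left_le intro!: divide_right_mono)

lemma log_test'_le: "log_test' d s \<le> - (log_weight d s)\<^sup>2"
proof -
  have "- (2 * max 0 (1 - s) * (s + d) + (max 0 (1 - s))\<^sup>2) \<le> - ((max 0 (1 - s))\<^sup>2)"
    using s d by simp
  then have "log_test' d s \<le> - ((max 0 (1 - s))\<^sup>2) / (s + d)\<^sup>2"
    unfolding log_test'_def by (intro divide_right_mono) auto
  then show ?thesis using s by (simp add: log_weight_def power_divide)
qed

lemma log_test'_abs_le: "\<bar>log_test' d s\<bar> \<le> 2 / d + 1 / d\<^sup>2"
proof -
  have "0 \<le> 2 * max 0 (1 - s) * (s + d) + (max 0 (1 - s))\<^sup>2" using s d by simp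
  then have "\<bar>log_test' d s\<bar> = (2 * max 0 (1 - s) * (s + d) + (max 0 (1 - s))\<^sup>2) / (s + d)\<^sup>2"
    unfolding log_test'_def abs_divide abs_minus_cancel by simp
  also have "\<dots> = 2 * max 0 (1 - s) / (s + d) + (max 0 (1 - s))\<^sup>2 / (s + d)\<^sup>2"
    using s d by (simp add: add_divide_distrib power2_eq_square[of "s + d"])
  also have "\<dots> \<le> 2 / d + 1 / d\<^sup>2"
    using s d by (intro add_mono frac_le power_mono power_le_one) auto
  finally show ?thesis .
qed

end

lemma log_test_bounded_C1_on:
  "bounded_C1_on {0..} (2 / d + 1 / d\<^sup>2) (\<lambda>s. log_test d s - 1 / d) (log_test' d)"
proof -
  have "((\<lambda>s. log_test d s - 1 / d) has_real_derivative log_test' d s) (at s within {0..})" if "0 \<le> s" for s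
    using DERIV_diff[OF log_test_has_derivative[OF that] DERIV_const[of "1 / d"]]
    by (simp add: has_field_derivative_at_within)
  moreover have "(\<lambda>s. log_test d s - 1 / d) \<in> borel_measurable borel" "log_test' d \<in> borel_measurable borel"
    unfolding log_test_def log_test'_def by measurable
  ultimately show ?thesis
    unfolding bounded_C1_on_def using log_test'_abs_le log_test_continuous(2) by auto
qed

lemma H1_test_fun_mult_log_test:
  assumes H1_grad: "H1_with_grad w g" and w: "\<And>x. 0 \<le> w x" and \<phi>: "test_fun UNIV \<phi>"
  shows "H1_with_grad (\<lambda>x. \<phi> x * log_test d (w x))
    (\<lambda>x. (\<phi> x * log_test' d (w x)) *\<^sub>R g x + log_test d (w x) *\<^sub>R cgrad \<phi> x)"
proof -
  have "H1_with_grad (\<lambda>x. log_test d (w x) - 1 / d) (\<lambda>x. log_test' d (w x) *\<^sub>R g x)"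
    by (rule H1_chain[OF H1_grad _ _ log_test_bounded_C1_on]) (use w in \<open>auto simp: log_test_def\<close>)
  then have "H1_with_grad (\<lambda>x. \<phi> x * (log_test d (w x) - 1 / d))
      (\<lambda>x. \<phi> x *\<^sub>R (log_test' d (w x) *\<^sub>R g x) + (log_test d (w x) - 1 / d) *\<^sub>R cgrad \<phi> x)"
    by (rule H1_mult_bounded_lipschitz[OF _ test_fun_bounded_lipschitz_grad[OF \<phi>]])
  from H1_lincomb[OF this test_fun_H1[OF \<phi>], of 1 "1 / d"]
  show ?thesis by (simp add: algebra_simps)
qed

end

text \<open>Young's inequality absorbs the cross term with the gradient of the cut-off.\<close>

lemma log_weight_power2_le_inner:
  fixes G N :: "'a::real_inner"
  assumes d: "0 < d" and s: "0 \<le> s" and p: "0 \<le> p" and N: "(norm N)\<^sup>2 \<le> K * p"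
  shows "p * (log_weight d s * norm G)\<^sup>2
    \<le> K * of_bool (0 < p) - 2 * (G \<bullet> ((p * log_test' d s) *\<^sub>R G + log_test d s *\<^sub>R N))"
proof (cases "p = 0")
  case True
  then show ?thesis using N by simp
next
  case False
  define t where "t = log_weight d s * norm G"
  have t: "0 \<le> t" using log_weight_nonneg[OF d] by (simp add: t_def)
  have "G \<bullet> ((p * log_test' d s) *\<^sub>R G + log_test d s *\<^sub>R N) = p * (log_test' d s * (norm G)\<^sup>2) + log_test d s * (G \<bullet> N)"
    by (simp add: inner_add_right dot_square_norm mult.assoc)
  also have "\<dots> \<le> p * (- (log_weight d s)\<^sup>2 * (norm G)\<^sup>2) + log_test d s * (norm G * norm N)"
    using p log_test'_le[OF d s] log_test_nonneg[OF d s] norm_cauchy_schwarz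
    by (intro add_mono mult_right_mono mult_left_mono) auto
  also have "log_test d s * (norm G * norm N) \<le> log_weight d s * (norm G * norm N)"
    by (intro mult_right_mono log_test_le_log_weight[OF d s]) auto
  finally have "G \<bullet> ((p * log_test' d s) *\<^sub>R G + log_test d s *\<^sub>R N) \<le> t * norm N - p * t\<^sup>2"
    by (simp add: t_def power_mult_distrib)
  moreover have "p * (2 * (t * norm N)) \<le> p * (p * t\<^sup>2 + K)"
    using sum_squares_bound[of "p * t" "norm N"] N by (simp add: algebra_simps power2_eq_square)
  then have "2 * (t * norm N) \<le> p * t\<^sup>2 + K" using False p by (simp add: mult_le_cancel_left)
  ultimately show ?thesis using False p by (simp add: t_def)
qed

lemma supersolution_inner_log_test_ge:
  assumes w: "supersolution_below_one \<kappa> w g" and \<phi>: "test_fun UNIV \<phi>" "\<And>x. 0 \<le> \<phi> x" "\<And>x. \<phi> x \<le> indicator (cbox a b) x"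
    and d: "0 < d"
  defines "k \<equiv> \<lambda>x. (\<phi> x * log_test' d (w x)) *\<^sub>R g x + log_test d (w x) *\<^sub>R cgrad \<phi> x"
  shows "integrable lebesgue (\<lambda>x. g x \<bullet> k x)"
    and "- \<bar>\<kappa>\<bar> * measure lebesgue (cbox a b) \<le> (\<integral>x. g x \<bullet> k x \<partial>lebesgue)"
proof -
  note H1_grad = supersolution_below_oneD(1)[OF w] and w0 = supersolution_below_oneD(2)[OF w]
  let ?i = "indicator (cbox a b) :: R2 \<Rightarrow> real"
  define \<zeta> where "\<zeta> = (\<lambda>x. \<phi> x * log_test d (w x))"
  have \<zeta>: "H1_with_grad \<zeta> k" unfolding \<zeta>_def k_def by (rule H1_test_fun_mult_log_test[OF d H1_grad w0 \<phi>(1)])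
  show "integrable lebesgue (\<lambda>x. g x \<bullet> k x)"
    by (rule integrable_inner_square_integrable[OF H1_with_gradD(2)[OF H1_grad] H1_with_gradD(2)[OF \<zeta>]])
  have nonneg: "0 \<le> \<zeta> x" for x using \<phi>(2) log_test_nonneg[OF d w0] by (simp add: \<zeta>_def)
  have "\<phi> x \<le> 1" for x using \<phi>(3)[of x] indicator_le_1[of "cbox a b" x] by (rule order_trans)
  then have bounded: "\<zeta> x \<le> 1 / d" for x
    using mult_mono[of "\<phi> x" 1 "log_test d (w x)" "1 / d"] log_test_le[OF d w0] log_test_nonneg[OF d w0]
    by (simp add: \<zeta>_def)
  have "\<phi> x * (w x * log_test d (w x)) \<le> ?i x * 1" for x
    using \<phi>(2,3) mult_log_test_le_1[OF d w0] w0 log_test_nonneg[OF d w0] by (intro mult_mono) auto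
  then have "(\<integral>x. w x * \<zeta> x \<partial>lebesgue) \<le> (\<integral>x. ?i x \<partial>lebesgue)"
    by (intro integral_mono integrable_mult_square_integrable[OF H1_with_gradD(1)[OF H1_grad] H1_with_gradD(1)[OF \<zeta>]]
        integrable_real_indicator) (auto simp: \<zeta>_def mult_ac emeasure_lborel_cbox_eq)
  moreover have "0 \<le> (\<integral>x. w x * \<zeta> x \<partial>lebesgue)"
    using w0 nonneg by (intro Bochner_Integration.integral_nonneg) auto
  ultimately have "\<kappa> * (\<integral>x. w x * \<zeta> x \<partial>lebesgue) \<le> \<bar>\<kappa>\<bar> * measure lebesgue (cbox a b)"
    by (intro mult_mono) auto
  moreover have "- \<kappa> * (\<integral>x. w x * \<zeta> x \<partial>lebesgue) \<le> (\<integral>x. g x \<bullet> k x \<partial>lebesgue)"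
    by (rule supersolution_below_oneD(3)[OF w \<zeta> nonneg bounded]) (simp add: \<zeta>_def log_test_eq_0[OF d])
  ultimately show "- \<bar>\<kappa>\<bar> * measure lebesgue (cbox a b) \<le> (\<integral>x. g x \<bullet> k x \<partial>lebesgue)" by simp
qed

lemma supersolution_log_estimate:
  assumes w: "supersolution_below_one \<kappa> w g"
    and \<phi>: "test_fun UNIV \<phi>" "\<And>x. 0 \<le> \<phi> x" "\<And>x. \<phi> x \<le> indicator (cbox a b) x"
    and K: "0 \<le> K" "\<And>x. (norm (cgrad \<phi> x))\<^sup>2 \<le> K * \<phi> x" and d: "0 < d"
  shows "(\<integral>\<^sup>+x. ennreal (\<phi> x * (log_weight d (w x) * norm (g x))\<^sup>2) \<partial>lebesgue)
    \<le> ennreal ((2 * \<bar>\<kappa>\<bar> + K) * measure lebesgue (cbox a b))"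
proof -
  let ?i = "indicator (cbox a b) :: R2 \<Rightarrow> real"
  let ?k = "\<lambda>x. (\<phi> x * log_test' d (w x)) *\<^sub>R g x + log_test d (w x) *\<^sub>R cgrad \<phi> x"
  note test = supersolution_inner_log_test_ge[OF w \<phi> d]
  have indicator: "integrable lebesgue ?i" by (intro integrable_real_indicator) (auto simp: emeasure_lborel_cbox_eq)
  have pointwise: "\<phi> x * (log_weight d (w x) * norm (g x))\<^sup>2 \<le> K * ?i x - 2 * (g x \<bullet> ?k x)" for x
  proof -
    have "K * of_bool (0 < \<phi> x) \<le> K * ?i x"
      using \<phi>(3)[of x] K(1) by (cases "x \<in> cbox a b") auto
    then show ?thesis
      using log_weight_power2_le_inner[OF d supersolution_below_oneD(2)[OF w] \<phi>(2) K(2), of x x "g x"] by simp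
  qed
  have "(\<integral>\<^sup>+x. ennreal (\<phi> x * (log_weight d (w x) * norm (g x))\<^sup>2) \<partial>lebesgue)
      \<le> (\<integral>\<^sup>+x. ennreal (K * ?i x - 2 * (g x \<bullet> ?k x)) \<partial>lebesgue)"
    by (intro nn_integral_mono ennreal_leI pointwise)
  also have "\<dots> = ennreal (\<integral>x. K * ?i x - 2 * (g x \<bullet> ?k x) \<partial>lebesgue)"
  proof (intro nn_integral_eq_integral AE_I2)
    show "0 \<le> K * ?i x - 2 * (g x \<bullet> ?k x)" for x
      using pointwise[of x] \<phi>(2)[of x] by (meson mult_nonneg_nonneg order_trans zero_le_power2)
  qed (intro Bochner_Integration.integrable_diff integrable_mult_right indicator test(1))
  also have "(\<integral>x. K * ?i x - 2 * (g x \<bullet> ?k x) \<partial>lebesgue)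
      = K * measure lebesgue (cbox a b) - 2 * (\<integral>x. g x \<bullet> ?k x \<partial>lebesgue)"
    using Bochner_Integration.integral_diff[OF integrable_mult_right[OF indicator] integrable_mult_right[OF test(1)]]
    by simp
  also have "\<dots> \<le> (2 * \<bar>\<kappa>\<bar> + K) * measure lebesgue (cbox a b)" using test(2) by (simp add: algebra_simps)
  finally show ?thesis by (simp add: ennreal_leI)
qed

lemma power2_inner_scaleR_le:
  fixes G a :: "'a::real_inner"
  assumes "0 < c" "c \<le> p"
  shows "((t *\<^sub>R G) \<bullet> a)\<^sup>2 \<le> (norm a)\<^sup>2 / c * (p * (t * norm G)\<^sup>2)"
proof -
  have "((t *\<^sub>R G) \<bullet> a)\<^sup>2 \<le> (norm (t *\<^sub>R G) * norm a)\<^sup>2"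
    using power_mono[OF Cauchy_Schwarz_ineq2, of "t *\<^sub>R G" a 2] by simp
  also have "\<dots> = (norm a)\<^sup>2 / c * (c * (t * norm G)\<^sup>2)"
    using assms(1) by (simp add: power_mult_distrib)
  also have "\<dots> \<le> (norm a)\<^sup>2 / c * (p * (t * norm G)\<^sup>2)"
    using assms by (intro mult_left_mono mult_right_mono) auto
  finally show ?thesis .
qed

lemma log_cut_translation_bounded:
  assumes w: "supersolution_below_one \<kappa> w g" and borel: "w \<in> borel_measurable borel" "g \<in> borel_measurable borel"
    and E: "E \<in> sets borel" "E \<subseteq> box l u" "\<And>x. x \<in> E \<Longrightarrow> x + a \<in> box l u"
  shows "\<exists>Q\<ge>0. \<forall>d>0. (\<integral>\<^sup>+x. ennreal ((log_cut d (w (x + a)) - log_cut d (w x))\<^sup>2) * indicator E x \<partial>lborel) \<le> ennreal Q"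
proof -
  obtain \<phi> c K where \<phi>: "test_fun UNIV \<phi>" "\<And>x. 0 \<le> \<phi> x" "\<And>x. \<phi> x \<le> 1" "0 < c" "\<And>x. x \<in> box l u \<Longrightarrow> c \<le> \<phi> x"
    "0 \<le> K" "\<And>x. (norm (cgrad \<phi> x))\<^sup>2 \<le> K * \<phi> x" "\<And>x. x \<notin> cbox (l - 1) (u + 1) \<Longrightarrow> \<phi> x = 0"
    using cutoff_exists[of l u] by blast
  have \<phi>_le: "\<phi> x \<le> indicator (cbox (l - 1) (u + 1)) x" for x
    using \<phi>(3)[of x] \<phi>(8)[of x] by (cases "x \<in> cbox (l - 1) (u + 1)") auto
  define b where "b = (norm a)\<^sup>2 / c"
  define D where "D = (2 * \<bar>\<kappa>\<bar> + K) * measure lebesgue (cbox (l - 1) (u + 1))"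
  have b: "0 \<le> b" and D: "0 \<le> D" using \<phi>(4,6) by (auto simp: b_def D_def)
  have "(\<integral>\<^sup>+x. ennreal ((log_cut d (w (x + a)) - log_cut d (w x))\<^sup>2) * indicator E x \<partial>lborel) \<le> ennreal (b * D)"
    if d: "0 < d" for d
  proof -
    note C1 = log_cut_bounded_C1_on[OF d]
    note [measurable] = borel bounded_C1_onD(6,7)[OF C1] test_fun_borel[OF \<phi>(1)]
    have "H1_with_grad (\<lambda>x. log_cut d (w x)) (\<lambda>x. log_weight d (w x) *\<^sub>R g x)"
      by (rule H1_chain[OF supersolution_below_oneD(1)[OF w] _ _ C1 log_cut_0[OF d]])
         (use supersolution_below_oneD(2)[OF w] in auto)
    then have "(\<integral>\<^sup>+x. ennreal ((log_cut d (w (x + a)) - log_cut d (w x))\<^sup>2) * indicator E x \<partial>lborel)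
        \<le> (\<integral>\<^sup>+x. ennreal (((log_weight d (w x) *\<^sub>R g x) \<bullet> a)\<^sup>2) * indicator (box l u) x \<partial>lborel)"
      by (intro H1_translation_estimate) (use E in \<open>auto intro: convex_box\<close>)
    also have "\<dots> \<le> (\<integral>\<^sup>+x. ennreal b * ennreal (\<phi> x * (log_weight d (w x) * norm (g x))\<^sup>2) \<partial>lborel)"
    proof (rule nn_integral_mono)
      show "ennreal (((log_weight d (w x) *\<^sub>R g x) \<bullet> a)\<^sup>2) * indicator (box l u) x
          \<le> ennreal b * ennreal (\<phi> x * (log_weight d (w x) * norm (g x))\<^sup>2)" for x
        using power2_inner_scaleR_le[OF \<phi>(4,5), of x "log_weight d (w x)" "g x" a] b \<phi>(2)[of x]
        by (auto simp: ennreal_mult[symmetric] b_def split: split_indicator intro!: ennreal_leI)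
    qed
    also have "\<dots> = ennreal b * (\<integral>\<^sup>+x. ennreal (\<phi> x * (log_weight d (w x) * norm (g x))\<^sup>2) \<partial>lborel)"
      by (rule nn_integral_cmult) measurable
    also have "\<dots> \<le> ennreal b * ennreal D"
      using supersolution_log_estimate[OF w \<phi>(1,2) \<phi>_le \<phi>(6,7) d]
      by (intro mult_left_mono) (simp_all add: D_def nn_integral_completion)
    finally show ?thesis using b D by (simp add: ennreal_mult)
  qed
  then show ?thesis using b D by (intro exI[of _ "b * D"]) simp
qed

lemma log_bound_imp_nonpos:
  assumes c: "0 < c" and bound: "\<And>d. 0 < d \<Longrightarrow> (1/2 * ln (1 + c / d))\<^sup>2 * m \<le> Q"
  shows "m \<le> (0::real)"
proof (rule ccontr)
  assume "\<not> m \<le> 0"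
  then have m: "0 < m" by simp
  define T where "T = \<bar>Q\<bar> / m + 1"
  have T: "1 \<le> T" using m by (simp add: T_def)
  define d where "d = c / (exp (2 * T) - 1)"
  have "0 < d" "1 + c / d = exp (2 * T)" using c T by (auto simp: d_def)
  with bound[of d] have "T\<^sup>2 * m \<le> Q" by simp
  moreover have "T * m \<le> T\<^sup>2 * m" using T m by (intro mult_right_mono) (auto simp: power2_eq_square)
  moreover have "T * m = \<bar>Q\<bar> + m" using m by (simp add: T_def field_simps)
  ultimately show False using m by linarith
qed

lemma ex_common_box_zero_set_level_set:
  fixes w :: "'a::euclidean_space \<Rightarrow> real"
  assumes w: "w \<in> borel_measurable borel" "\<And>x. 0 \<le> w x"
    and "\<not> (AE x in lborel. w x = 0)" "\<not> (AE x in lborel. w x \<noteq> 0)"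
  shows "\<exists>n. 0 < emeasure lborel {x \<in> centred_box n. w x = 0} \<and>
    0 < emeasure lborel {x \<in> centred_box n. 1 / (real n + 2) \<le> w x}"
proof -
  note [measurable] = w(1)
  define Z where "Z n = {x \<in> centred_box n. w x = 0}" for n
  define P where "P n = {x \<in> centred_box n. 1 / (real n + 2) \<le> w x}" for n
  have sets: "Z n \<in> sets lborel" "P n \<in> sets lborel" for n
    unfolding Z_def P_def by measurable
  have "P m \<subseteq> P n" if "m \<le> n" for m n
  proof -
    have "1 / (real n + 2) \<le> 1 / (real m + 2)" using that by (intro frac_le) auto
    then show ?thesis using centred_box_mono[OF that] by (auto simp: P_def)
  qed
  then have mono: "incseq Z" "incseq P"
    unfolding incseq_def Z_def using centred_box_mono by blast+
  have "(\<Union>n. Z n) = {x. w x = 0}" using UN_centred_box by (auto simp: Z_def)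
  moreover have "(\<Union>n. P n) = {x. w x \<noteq> 0}"
  proof (intro equalityI subsetI)
    fix x assume "x \<in> (\<Union>n. P n)"
    then show "x \<in> {x. w x \<noteq> 0}" by (auto simp: P_def)
  next
    fix x assume "x \<in> {x. w x \<noteq> 0}"
    then have w_pos: "0 < w x" using w(2)[of x] by simp
    obtain l where l: "x \<in> centred_box l" using UN_centred_box by blast
    obtain m where m: "1 / w x < real m" using reals_Archimedean2 by blast
    have "1 / w x < real (max m l) + 2" using m by simp
    then have "1 / (real (max m l) + 2) \<le> w x" using w_pos by (simp add: field_simps)
    then show "x \<in> (\<Union>n. P n)" using centred_box_mono[of l "max m l"] l by (auto simp: P_def)
  qed
  ultimately have "\<not> (AE x in lborel. x \<notin> (\<Union>n. Z n))" "\<not> (AE x in lborel. x \<notin> (\<Union>n. P n))"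
    using assms(3,4) by simp_all
  from emeasure_incseq_eventually_pos[OF sets(1) mono(1) this(1)]
    emeasure_incseq_eventually_pos[OF sets(2) mono(2) this(2)]
  have "\<forall>\<^sub>F n in sequentially. 0 < emeasure lborel (Z n) \<and> 0 < emeasure lborel (P n)" by eventually_elim simp
  then show ?thesis unfolding eventually_sequentially Z_def P_def by blast
qed

theorem supersolution_nonzero_AE:
  assumes w: "supersolution_below_one \<kappa> w g" and borel: "w \<in> borel_measurable borel" "g \<in> borel_measurable borel"
    and nz: "nonzero w"
  shows "AE x in lborel. w x \<noteq> 0"
proof (rule ccontr)
  assume "\<not> (AE x in lborel. w x \<noteq> 0)"
  moreover have "\<not> (AE x in lborel. w x = 0)" using nz AE_completion by (auto simp: nonzero_def)
  ultimately obtain n where n: "0 < emeasure lborel {x \<in> centred_box n. w x = 0}"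
      "0 < emeasure lborel {x \<in> centred_box n. 1 / (real n + 2) \<le> w x}"
    using ex_common_box_zero_set_level_set[OF borel(1) supersolution_below_oneD(2)[OF w]] by blast
  note [measurable] = borel
  obtain a where a: "0 < emeasure lborel
      {x \<in> {x \<in> centred_box n. w x = 0}. x + a \<in> {x \<in> centred_box n. 1 / (real n + 2) \<le> w x}}"
    using ex_translate_overlap_pos[OF _ _ n] by auto
  define E where "E = {x \<in> centred_box n. w x = 0 \<and> x + a \<in> centred_box n \<and> 1 / (real n + 2) \<le> w (x + a)}"
  have E [measurable]: "E \<in> sets borel" unfolding E_def by measurable
  have E_box: "E \<subseteq> centred_box n" "\<And>x. x \<in> E \<Longrightarrow> x + a \<in> centred_box n" by (auto simp: E_def)
  have E_pos: "0 < emeasure lborel E" using a by (simp add: E_def conj_assoc)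
  have "emeasure lborel E < \<infinity>"
    by (intro emeasure_bounded_finite bounded_subset[OF _ E_box(1)]) (simp add: centred_box_def bounded_box)
  then obtain m where m: "emeasure lborel E = ennreal m" "0 \<le> m" by (cases "emeasure lborel E") auto
  obtain Q where Q: "0 \<le> Q" "\<And>d. 0 < d \<Longrightarrow>
      (\<integral>\<^sup>+x. ennreal ((log_cut d (w (x + a)) - log_cut d (w x))\<^sup>2) * indicator E x \<partial>lborel) \<le> ennreal Q"
    using log_cut_translation_bounded[OF w borel E E_box[unfolded centred_box_def]] by blast
  define c where "c = 1 / (real n + 2)"
  have c: "0 < c" "c \<le> 1/2" by (auto simp: c_def)
  have "(1/2 * ln (1 + c / d))\<^sup>2 * m \<le> Q" if d: "0 < d" for d
  proof -
    define l where "l = 1/2 * ln (1 + c / d)"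
    have l: "0 \<le> l" using c d by (simp add: l_def)
    have "l\<^sup>2 \<le> (log_cut d (w (x + a)) - log_cut d (w x))\<^sup>2" if "x \<in> E" for x
      using log_cut_ge[OF d _ c(2), of "w (x + a)"] c l that
      by (intro power_mono) (auto simp: E_def l_def c_def log_cut_0[OF d])
    then have "(\<integral>\<^sup>+x. ennreal (l\<^sup>2) * indicator E x \<partial>lborel)
        \<le> (\<integral>\<^sup>+x. ennreal ((log_cut d (w (x + a)) - log_cut d (w x))\<^sup>2) * indicator E x \<partial>lborel)"
      by (intro nn_integral_mono) (auto split: split_indicator intro: ennreal_leI)
    also have "\<dots> \<le> ennreal Q" by (rule Q(2)[OF d])
    finally show ?thesis using m Q(1) by (simp add: nn_integral_cmult_indicator ennreal_mult[symmetric] l_def)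
  qed
  then have "m \<le> 0" by (rule log_bound_imp_nonpos[OF c(1)])
  then show False using E_pos m by simp
qed

subsection \<open>Minimizers are supersolutions\<close>

context ambrosetti_rabinowitz
begin

definition minimizes_dilation_energy :: "(R2 \<Rightarrow> real) \<Rightarrow> (R2 \<Rightarrow> R2) \<Rightarrow> bool" where
  "minimizes_dilation_energy w g \<longleftrightarrow> admissible w g \<and> (\<forall>x. 0 \<le> w x) \<and> zero_order_deriv w < 0 \<and>
     (\<forall>v h. admissible v h \<longrightarrow> (\<forall>x. 0 \<le> v x) \<longrightarrow> zero_order_deriv v < 0 \<longrightarrow> dilation_energy w g \<le> dilation_energy v h)"

lemma minimizes_dilation_energyD:
  assumes "minimizes_dilation_energy w g"
  shows "admissible w g" "0 \<le> w x" "zero_order_deriv w < 0"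
    "admissible v h \<Longrightarrow> (\<And>x. 0 \<le> v x) \<Longrightarrow> zero_order_deriv v < 0 \<Longrightarrow> dilation_energy w g \<le> dilation_energy v h"
  using assms by (auto simp: minimizes_dilation_energy_def)

lemma pos_part_minimizes_dilation_energy:
  assumes H1_grad: "H1_with_grad u g" and nehari: "on_nehari (pos_part u)" "on_nehari (neg_part u)"
    and attained: "Jfun V0 f u = c_hat V0 f"
  shows "minimizes_dilation_energy (pos_part u) (\<lambda>x. if 0 < u x then g x else 0)"
    (is "minimizes_dilation_energy ?w ?g")
  unfolding minimizes_dilation_energy_def
proof (intro conjI allI impI)
  note p = H1_pos_part[OF H1_grad] and n = H1_neg_part[OF H1_grad]
  show "admissible ?w ?g" "zero_order_deriv ?w < 0"
    by (rule on_nehari_admissible[OF p nehari(1)], rule on_nehari_zero_order_deriv(2)[OF p nehari(1)])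
  show "0 \<le> pos_part u x" for x by (simp add: pos_part_def)
  fix v h assume v: "admissible v h" "\<forall>x. 0 \<le> v x" "zero_order_deriv v < 0"
  let ?h = "\<lambda>x. if u x < 0 then g x else 0"
  have "dilation_energy ?w ?g + dilation_energy (neg_part u) ?h = c_hat V0 f"
    using Jfun_parts[OF H1_grad nehari] attained on_nehari_Jfun_eq[OF p nehari(1)] on_nehari_Jfun_eq[OF n nehari(2)] by simp
  also have "\<dots> \<le> dilation_energy v h + dilation_energy (neg_part u) ?h"
    by (intro c_hat_le_dilation_energy_add v on_nehari_admissible[OF n] on_nehari_zero_order_deriv(2)[OF n] nehari(2))
       (use v(2) in \<open>auto simp: neg_part_def\<close>)
  finally show "dilation_energy ?w ?g \<le> dilation_energy v h" by simp
qed

lemma minimizes_dilation_energy_borel_representative: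
  assumes w: "minimizes_dilation_energy w g"
  obtains w' g' where "w' \<in> borel_measurable borel" "g' \<in> borel_measurable borel" "AE x in lebesgue. w x = w' x"
    "minimizes_dilation_energy w' g'" "dilation_energy w' g' = dilation_energy w g"
proof -
  note adm = minimizes_dilation_energyD(1)[OF w]
  have nonneg: "w x \<in> {0..}" for x using minimizes_dilation_energyD(2)[OF w] by simp
  obtain w' g' where r: "w' \<in> borel_measurable borel" "g' \<in> borel_measurable borel" "\<forall>x. w' x \<in> {0..}"
      "AE x in lebesgue. w x = w' x" "AE x in lebesgue. g x = g' x" "H1_with_grad w' g'"
    using H1_borel_representative[OF admissibleD(1)[OF adm] atLeast_borel nonneg] .
  note cong = r(1,2)[THEN borel_measurable_lebesgueI] r(4,5)
  have "minimizes_dilation_energy w' g'"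
    using w r(3) admissible_cong_AE[OF adm cong] zero_order_deriv_cong_AE[OF adm cong]
      dilation_energy_cong_AE[OF adm cong]
    by (simp add: minimizes_dilation_energy_def)
  with that[OF r(1,2,4)] show ?thesis using dilation_energy_cong_AE[OF adm cong] by simp
qed

end

lemma abs_divide_diff_le:
  fixes b b' q q' :: real
  assumes "b \<noteq> 0" "b' \<noteq> 0" and b: "\<bar>b' - b\<bar> \<le> 2 * y" and q: "\<bar>q' - q\<bar> \<le> y"
  shows "\<bar>q' / b' - q / b\<bar> \<le> y * (\<bar>b\<bar> + 2 * \<bar>q\<bar>) / (\<bar>b'\<bar> * \<bar>b\<bar>)"
proof -
  have "q' / b' - q / b = ((q' - q) * b - q * (b' - b)) / (b' * b)" using assms(1,2) by (simp add: field_simps)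
  moreover have "\<bar>(q' - q) * b - q * (b' - b)\<bar> \<le> y * \<bar>b\<bar> + \<bar>q\<bar> * (2 * y)"
    using abs_triangle_ineq4[of "(q' - q) * b" "q * (b' - b)"]
      mult_right_mono[OF q, of "\<bar>b\<bar>"] mult_left_mono[OF b, of "\<bar>q\<bar>"] by (simp add: abs_mult)
  ultimately show ?thesis by (simp add: abs_mult algebra_simps divide_right_mono)
qed

abbreviation perturbed :: "(R2 \<Rightarrow> real) \<Rightarrow> (R2 \<Rightarrow> real) \<Rightarrow> real \<Rightarrow> R2 \<Rightarrow> real" where
  "perturbed w \<zeta> e \<equiv> \<lambda>x. w x + e * \<zeta> x"

definition perturbation_size :: "(R2 \<Rightarrow> real) \<Rightarrow> (R2 \<Rightarrow> real) \<Rightarrow> real \<Rightarrow> real" where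
  "perturbation_size w \<zeta> e = (\<integral>x. perturbed w \<zeta> e x * \<zeta> x \<partial>lebesgue)"

lemma
  assumes w: "square_integrable lebesgue w" and \<zeta>: "square_integrable lebesgue \<zeta>"
  shows integrable_perturbation_size: "integrable lebesgue (\<lambda>x. perturbed w \<zeta> e x * \<zeta> x)"
    and perturbation_size_eq: "perturbation_size w \<zeta> e = (\<integral>x. w x * \<zeta> x \<partial>lebesgue) + e * L2_norm_sq \<zeta>"
proof -
  have eq: "perturbed w \<zeta> e x * \<zeta> x = w x * \<zeta> x + e * (\<zeta> x)\<^sup>2" for x by (simp add: power2_eq_square algebra_simps)
  show "integrable lebesgue (\<lambda>x. perturbed w \<zeta> e x * \<zeta> x)"
    "perturbation_size w \<zeta> e = (\<integral>x. w x * \<zeta> x \<partial>lebesgue) + e * L2_norm_sq \<zeta>"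
    unfolding perturbation_size_def eq
    using integrable_mult_square_integrable[OF w \<zeta>] integrable_power2[OF \<zeta>] by (simp_all add: L2_norm_sq_def)
qed

lemma perturbation_size_tendsto:
  assumes "square_integrable lebesgue w" "square_integrable lebesgue \<zeta>"
  shows "((\<lambda>e. perturbation_size w \<zeta> e) \<longlongrightarrow> (\<integral>x. w x * \<zeta> x \<partial>lebesgue)) (at_right 0)"
proof -
  have "((\<lambda>e. (\<integral>x. w x * \<zeta> x \<partial>lebesgue) + e * L2_norm_sq \<zeta>)
      \<longlongrightarrow> (\<integral>x. w x * \<zeta> x \<partial>lebesgue) + 0 * L2_norm_sq \<zeta>) (at_right 0)"
    by (intro tendsto_intros)
  then show ?thesis unfolding perturbation_size_eq[OF assms] by simp
qed

locale ambrosetti_rabinowitz_lipschitz = ambrosetti_rabinowitz +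
  fixes C :: real
  assumes C_nonneg: "0 \<le> C"
    and f_lipschitz: "\<And>a b. 0 \<le> b \<Longrightarrow> b \<le> a \<Longrightarrow> a \<le> 2 \<Longrightarrow> \<bar>f a - f b\<bar> \<le> C * (a - b)"
begin

definition ratio_slope :: "(R2 \<Rightarrow> real) \<Rightarrow> real \<Rightarrow> real" where
  "ratio_slope w b = (V0 + C) * (\<bar>zero_order_deriv w\<bar> + 2 * \<bar>zero_order_energy w\<bar>) / (\<bar>b\<bar> * \<bar>zero_order_deriv w\<bar>)"

lemma f_abs_le: "0 \<le> a \<Longrightarrow> a \<le> 2 \<Longrightarrow> \<bar>f a\<bar> \<le> C * a"
  using f_lipschitz[of 0 a] f_0 by simp

lemma
  assumes b: "0 \<le> b" "b \<le> a" and a: "a \<le> 2"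
  shows f_mult_diff_le: "\<bar>f a * a - f b * b\<bar> \<le> 2 * C * (a * (a - b))"
    and F_diff_le: "\<bar>F a - F b\<bar> \<le> C * (a * (a - b))"
proof -
  have "f a * a - f b * b = f a * (a - b) + b * (f a - f b)" by (simp add: algebra_simps)
  also have "\<bar>\<dots>\<bar> \<le> \<bar>f a\<bar> * (a - b) + b * \<bar>f a - f b\<bar>"
    using b abs_triangle_ineq[of "f a * (a - b)" "b * (f a - f b)"] by (simp add: abs_mult)
  also have "\<dots> \<le> (C * a) * (a - b) + a * (C * (a - b))"
    using a b f_abs_le f_lipschitz C_nonneg by (intro add_mono mult_mono) auto
  finally show "\<bar>f a * a - f b * b\<bar> \<le> 2 * C * (a * (a - b))" by (simp add: mult_ac)
  have "norm (F a - F b) \<le> (C * a) * norm (a - b)"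
  proof (rule field_differentiable_bound[where S = "{b..a}" and f' = f])
    fix s assume s: "s \<in> {b..a}"
    then have "\<bar>f s\<bar> \<le> C * s" using a b by (intro f_abs_le) auto
    also have "\<dots> \<le> C * a" using s C_nonneg by (intro mult_left_mono) auto
    finally show "norm (f s) \<le> C * a" by simp
  qed (use b in \<open>auto intro: has_field_derivative_at_within F_has_derivative\<close>)
  then show "\<bar>F a - F b\<bar> \<le> C * (a * (a - b))" using b by (simp add: mult.assoc)
qed

context
  fixes w \<zeta> :: "R2 \<Rightarrow> real" and g k e
  assumes w: "admissible w g" "\<And>x. 0 \<le> w x"
    and \<zeta>: "H1_with_grad \<zeta> k" "\<And>x. 0 \<le> \<zeta> x" "\<And>x. 1 \<le> w x \<Longrightarrow> \<zeta> x = 0" and e: "0 < e" "\<And>x. e * \<zeta> x \<le> 1"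
begin

lemma perturbation_pointwise:
  shows "\<bar>f (perturbed w \<zeta> e x) * perturbed w \<zeta> e x - f (w x) * w x\<bar> \<le> 2 * C * (e * (perturbed w \<zeta> e x * \<zeta> x))"
    and "\<bar>F (perturbed w \<zeta> e x) - F (w x)\<bar> \<le> C * (e * (perturbed w \<zeta> e x * \<zeta> x))"
proof -
  have eq: "e * (perturbed w \<zeta> e x * \<zeta> x) = perturbed w \<zeta> e x * (perturbed w \<zeta> e x - w x)" by simp
  have "\<zeta> x = 0 \<or> w x \<le> perturbed w \<zeta> e x \<and> perturbed w \<zeta> e x \<le> 2"
    using \<zeta>(2,3)[of x] e(1) e(2)[of x] by (cases "w x < 1") auto
  then show "\<bar>f (perturbed w \<zeta> e x) * perturbed w \<zeta> e x - f (w x) * w x\<bar> \<le> 2 * C * (e * (perturbed w \<zeta> e x * \<zeta> x))"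
    "\<bar>F (perturbed w \<zeta> e x) - F (w x)\<bar> \<le> C * (e * (perturbed w \<zeta> e x * \<zeta> x))"
    unfolding eq
    using f_mult_diff_le[OF w(2), of x "perturbed w \<zeta> e x"] F_diff_le[OF w(2), of x "perturbed w \<zeta> e x"] by auto
qed

lemma perturbation_H1: "H1_with_grad (perturbed w \<zeta> e) (\<lambda>x. g x + e *\<^sub>R k x)"
  using H1_lincomb[OF admissibleD(1)[OF w(1)] \<zeta>(1), of 1 e] by simp

lemmas perturbation_square_integrable = H1_with_gradD(1)[OF admissibleD(1)[OF w(1)]] H1_with_gradD(1)[OF \<zeta>(1)]

lemma perturbation_admissible: "admissible (perturbed w \<zeta> e) (\<lambda>x. g x + e *\<^sub>R k x)"
proof -
  note [measurable] = H1_with_grad_measurable(1)[OF perturbation_H1]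
    H1_with_grad_measurable(1)[OF admissibleD(1)[OF w(1)]]
  have "integrable lebesgue (\<lambda>x. f (perturbed w \<zeta> e x) * perturbed w \<zeta> e x - f (w x) * w x)"
  proof (rule Bochner_Integration.integrable_bound)
    show "integrable lebesgue (\<lambda>x. 2 * C * (e * (perturbed w \<zeta> e x * \<zeta> x)))"
      by (intro integrable_mult_right integrable_perturbation_size perturbation_square_integrable)
    show "AE x in lebesgue. norm (f (perturbed w \<zeta> e x) * perturbed w \<zeta> e x - f (w x) * w x)
        \<le> norm (2 * C * (e * (perturbed w \<zeta> e x * \<zeta> x)))"
      using perturbation_pointwise(1) by (intro AE_I2) (metis abs_ge_self order_trans real_norm_def)
  qed measurable
  from Bochner_Integration.integrable_add[OF this admissibleD(2)[OF w(1)]] show ?thesis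
    using perturbation_H1 by (simp add: admissible_def)
qed

lemma mass_perturbation:
  "\<bar>V0 * L2_norm_sq (perturbed w \<zeta> e) - V0 * L2_norm_sq w\<bar> \<le> V0 * (2 * (e * perturbation_size w \<zeta> e))"
proof -
  have "0 \<le> (\<integral>x. w x * \<zeta> x \<partial>lebesgue)" using w(2) \<zeta>(2) by (intro Bochner_Integration.integral_nonneg) auto
  then have "0 \<le> e * (\<integral>x. w x * \<zeta> x \<partial>lebesgue)" "0 \<le> e\<^sup>2 * L2_norm_sq \<zeta>"
    using e(1) L2_norm_sq_nonneg[of \<zeta>] by (auto intro: mult_nonneg_nonneg)
  then have "\<bar>L2_norm_sq (perturbed w \<zeta> e) - L2_norm_sq w\<bar> \<le> 2 * (e * perturbation_size w \<zeta> e)"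
    using L2_norm_sq_add_scaleR[OF perturbation_square_integrable, of e]
    unfolding perturbation_size_eq[OF perturbation_square_integrable] by (simp add: algebra_simps power2_eq_square)
  from mult_left_mono[OF this, of V0] show ?thesis using V0_pos by (simp add: right_diff_distrib[symmetric] abs_mult)
qed

lemma zero_order_deriv_perturbation:
  "\<bar>zero_order_deriv (perturbed w \<zeta> e) - zero_order_deriv w\<bar> \<le> 2 * ((V0 + C) * (e * perturbation_size w \<zeta> e))"
proof -
  have "\<bar>reaction (perturbed w \<zeta> e) - reaction w\<bar> \<le> (\<integral>x. 2 * C * (e * (perturbed w \<zeta> e x * \<zeta> x)) \<partial>lebesgue)"
    unfolding reaction_def
    by (intro abs_integral_diff_le admissibleD(2)[OF perturbation_admissible] admissibleD(2)[OF w(1)]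
        integrable_mult_right integrable_perturbation_size perturbation_square_integrable perturbation_pointwise)
  also have "\<dots> = 2 * C * (e * perturbation_size w \<zeta> e)"
    unfolding perturbation_size_def by (simp only: integral_mult_right_zero)
  finally have "\<bar>reaction (perturbed w \<zeta> e) - reaction w\<bar> \<le> 2 * C * (e * perturbation_size w \<zeta> e)" .
  with mass_perturbation show ?thesis unfolding zero_order_deriv_def by (simp add: algebra_simps)
qed

lemma zero_order_energy_perturbation:
  "\<bar>zero_order_energy (perturbed w \<zeta> e) - zero_order_energy w\<bar> \<le> (V0 + C) * (e * perturbation_size w \<zeta> e)"
proof -
  have "\<bar>potential (perturbed w \<zeta> e) - potential w\<bar> \<le> (\<integral>x. C * (e * (perturbed w \<zeta> e x * \<zeta> x)) \<partial>lebesgue)"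
    unfolding potential_def
    by (intro abs_integral_diff_le admissible_F_integrable[OF perturbation_admissible] admissible_F_integrable[OF w(1)]
        integrable_mult_right integrable_perturbation_size perturbation_square_integrable perturbation_pointwise)
  also have "\<dots> = C * (e * perturbation_size w \<zeta> e)"
    unfolding perturbation_size_def by (simp only: integral_mult_right_zero)
  finally have "\<bar>potential (perturbed w \<zeta> e) - potential w\<bar> \<le> C * (e * perturbation_size w \<zeta> e)" .
  with mass_perturbation show ?thesis unfolding zero_order_energy_def by (simp add: algebra_simps)
qed

lemma minimizer_perturbation_nonneg:
  assumes min: "minimizes_dilation_energy w g" and neg: "zero_order_deriv (perturbed w \<zeta> e) < 0"
  shows "0 \<le> (2 * (\<integral>x. g x \<bullet> k x \<partial>lebesgue) + e * L2_norm_sq k) * energy_ratio (perturbed w \<zeta> e)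
    + L2_norm_sq g * (ratio_slope w (zero_order_deriv (perturbed w \<zeta> e)) * perturbation_size w \<zeta> e)"
proof -
  let ?A = "L2_norm_sq g" and ?I = "2 * (\<integral>x. g x \<bullet> k x \<partial>lebesgue) + e * L2_norm_sq k"
  let ?D = "ratio_slope w (zero_order_deriv (perturbed w \<zeta> e)) * perturbation_size w \<zeta> e"
  have "?A * energy_ratio w \<le> dilation_energy (perturbed w \<zeta> e) (\<lambda>x. g x + e *\<^sub>R k x)"
    using minimizes_dilation_energyD(4)[OF min perturbation_admissible _ neg] w(2) \<zeta>(2) e(1)
    by (simp add: dilation_energy_def)
  also have "L2_norm_sq (\<lambda>x. g x + e *\<^sub>R k x) = ?A + e * ?I"
    using L2_norm_sq_add_scaleR[OF H1_with_gradD(2)[OF admissibleD(1)[OF w(1)]] H1_with_gradD(2)[OF \<zeta>(1)], of e]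
    by (simp add: algebra_simps power2_eq_square)
  then have "dilation_energy (perturbed w \<zeta> e) (\<lambda>x. g x + e *\<^sub>R k x) = (?A + e * ?I) * energy_ratio (perturbed w \<zeta> e)"
    by (simp add: dilation_energy_def)
  finally have "0 \<le> e * (?I * energy_ratio (perturbed w \<zeta> e)) + ?A * (energy_ratio (perturbed w \<zeta> e) - energy_ratio w)"
    by (simp add: algebra_simps)
  also have "energy_ratio (perturbed w \<zeta> e) - energy_ratio w \<le> e * ?D"
    using abs_divide_diff_le[OF _ _ zero_order_deriv_perturbation zero_order_energy_perturbation] neg
      minimizes_dilation_energyD(3)[OF min] by (simp add: ratio_slope_def mult_ac)
  then have "?A * (energy_ratio (perturbed w \<zeta> e) - energy_ratio w) \<le> ?A * (e * ?D)"
    by (rule mult_left_mono[OF _ L2_norm_sq_nonneg])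
  finally have "0 \<le> e * (?I * energy_ratio (perturbed w \<zeta> e) + ?A * ?D)" by (simp add: algebra_simps)
  then show ?thesis using e(1) by (simp add: zero_le_mult_iff)
qed

end

text \<open>The denominator is positive when \<open>dilation_energy w g\<close> is; hence the Lagrange multiplier of the Nehari
  constraint need not be identified.\<close>

definition supersolution_constant :: "(R2 \<Rightarrow> real) \<Rightarrow> (R2 \<Rightarrow> R2) \<Rightarrow> real" where
  "supersolution_constant w g = L2_norm_sq g * ratio_slope w (zero_order_deriv w) / (2 * energy_ratio w)"

context
  fixes w \<zeta> :: "R2 \<Rightarrow> real" and g k and M :: real
  assumes w: "minimizes_dilation_energy w g"
    and \<zeta>: "H1_with_grad \<zeta> k" "\<And>x. 0 \<le> \<zeta> x" "\<And>x. \<zeta> x \<le> M" "\<And>x. 1 \<le> w x \<Longrightarrow> \<zeta> x = 0"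
begin

lemma eventually_small_perturbation: "\<forall>\<^sub>F e in at_right 0. 0 < e \<and> (\<forall>x. e * \<zeta> x \<le> 1)"
proof -
  have "\<forall>\<^sub>F e in at_right 0. e \<in> {0<..<1 / max M 1}" by (rule eventually_at_right_real) simp
  then show ?thesis
  proof eventually_elim
    case (elim e)
    have "e * \<zeta> x \<le> 1" for x
    proof -
      have "e * \<zeta> x \<le> e * max M 1" using elim \<zeta>(3)[of x] by (intro mult_left_mono) auto
      also have "\<dots> \<le> 1" using elim by (simp add: pos_less_divide_eq)
      finally show ?thesis .
    qed
    then show ?case using elim by simp
  qed
qed

lemmas minimizer_perturbation_size_tendsto = perturbation_size_tendsto[OF
    H1_with_gradD(1)[OF admissibleD(1)[OF minimizes_dilation_energyD(1)[OF w]]] H1_with_gradD(1)[OF \<zeta>(1)]]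

lemma zero_order_perturbation_tendsto:
  "((\<lambda>e. zero_order_deriv (perturbed w \<zeta> e)) \<longlongrightarrow> zero_order_deriv w) (at_right 0)"
  "((\<lambda>e. zero_order_energy (perturbed w \<zeta> e)) \<longlongrightarrow> zero_order_energy w) (at_right 0)"
proof -
  note adm = minimizes_dilation_energyD(1,2)[OF w]
  have bound_lim: "((\<lambda>e. c * (e * perturbation_size w \<zeta> e)) \<longlongrightarrow> 0) (at_right 0)" for c
    using tendsto_mult[OF tendsto_const tendsto_mult[OF tendsto_ident_at minimizer_perturbation_size_tendsto], of c]
    by simp
  have "\<forall>\<^sub>F e in at_right 0. norm (zero_order_deriv (perturbed w \<zeta> e) - zero_order_deriv w)
      \<le> 2 * ((V0 + C) * (e * perturbation_size w \<zeta> e))"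
    using eventually_small_perturbation
    by eventually_elim (use zero_order_deriv_perturbation[OF adm \<zeta>(1,2,4)] in simp)
  from Lim_null_comparison[OF this tendsto_mult_right_zero[OF bound_lim]]
  show "((\<lambda>e. zero_order_deriv (perturbed w \<zeta> e)) \<longlongrightarrow> zero_order_deriv w) (at_right 0)" by (simp add: LIM_zero_iff)
  have "\<forall>\<^sub>F e in at_right 0. norm (zero_order_energy (perturbed w \<zeta> e) - zero_order_energy w)
      \<le> (V0 + C) * (e * perturbation_size w \<zeta> e)"
    using eventually_small_perturbation
    by eventually_elim (use zero_order_energy_perturbation[OF adm \<zeta>(1,2,4)] in simp)
  from Lim_null_comparison[OF this bound_lim]
  show "((\<lambda>e. zero_order_energy (perturbed w \<zeta> e)) \<longlongrightarrow> zero_order_energy w) (at_right 0)" by (simp add: LIM_zero_iff)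
qed

lemma minimizer_first_variation_nonneg:
  "0 \<le> 2 * (\<integral>x. g x \<bullet> k x \<partial>lebesgue) * energy_ratio w
    + L2_norm_sq g * (ratio_slope w (zero_order_deriv w) * (\<integral>x. w x * \<zeta> x \<partial>lebesgue))" (is "0 \<le> ?variation")
proof -
  note w_facts = minimizes_dilation_energyD(1-3)[OF w]
  let ?r = "\<lambda>e. (2 * (\<integral>x. g x \<bullet> k x \<partial>lebesgue) + e * L2_norm_sq k) * energy_ratio (perturbed w \<zeta> e)
    + L2_norm_sq g * (ratio_slope w (zero_order_deriv (perturbed w \<zeta> e)) * perturbation_size w \<zeta> e)"
  have "\<forall>\<^sub>F e in at_right 0. 0 \<le> ?r e"
    using eventually_small_perturbation order_tendstoD(2)[OF zero_order_perturbation_tendsto(1) w_facts(3)]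
  proof eventually_elim
    case (elim e)
    then show ?case by (intro minimizer_perturbation_nonneg[OF w_facts(1,2) \<zeta>(1,2,4) _ _ w]) auto
  qed
  moreover have "(?r \<longlongrightarrow> (2 * (\<integral>x. g x \<bullet> k x \<partial>lebesgue) + 0 * L2_norm_sq k) * energy_ratio w
      + L2_norm_sq g * (ratio_slope w (zero_order_deriv w) * (\<integral>x. w x * \<zeta> x \<partial>lebesgue))) (at_right 0)"
    unfolding ratio_slope_def
    by (intro tendsto_intros zero_order_perturbation_tendsto minimizer_perturbation_size_tendsto)
       (use w_facts(3) in auto)
  then have "(?r \<longlongrightarrow> ?variation) (at_right 0)" by simp
  ultimately show ?thesis by (intro tendsto_lowerbound) auto
qed

end

lemma minimizer_supersolution:
  assumes w: "minimizes_dilation_energy w g" and pos: "0 < dilation_energy w g"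
  shows "supersolution_below_one (supersolution_constant w g) w g"
  unfolding supersolution_below_one_def
proof (intro conjI allI impI)
  note w_facts = minimizes_dilation_energyD(1-3)[OF w]
  show "H1_with_grad w g" "0 \<le> w x" for x using admissibleD(1)[OF w_facts(1)] w_facts(2) by auto
  fix \<zeta> k and M :: real
  assume \<zeta>: "H1_with_grad \<zeta> k" "\<forall>x. 0 \<le> \<zeta> x \<and> \<zeta> x \<le> M" "\<forall>x. 1 \<le> w x \<longrightarrow> \<zeta> x = 0"
  define r where "r = energy_ratio w"
  have "0 < L2_norm_sq g * r" using pos by (simp add: dilation_energy_def r_def)
  then have r: "0 < r" using L2_norm_sq_nonneg[of g] by (simp add: zero_less_mult_iff)
  have "0 \<le> 2 * (\<integral>x. g x \<bullet> k x \<partial>lebesgue) * r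
      + L2_norm_sq g * ratio_slope w (zero_order_deriv w) * (\<integral>x. w x * \<zeta> x \<partial>lebesgue)"
    using minimizer_first_variation_nonneg[OF w \<zeta>(1), of M] \<zeta>(2,3) by (simp add: r_def mult_ac)
  moreover have "L2_norm_sq g * ratio_slope w (zero_order_deriv w) = supersolution_constant w g * (2 * r)"
    using r unfolding supersolution_constant_def r_def[symmetric] by simp
  ultimately have "0 \<le> ((\<integral>x. g x \<bullet> k x \<partial>lebesgue) + supersolution_constant w g * (\<integral>x. w x * \<zeta> x \<partial>lebesgue)) * (2 * r)"
    by (simp add: algebra_simps)
  then show "- supersolution_constant w g * (\<integral>x. w x * \<zeta> x \<partial>lebesgue) \<le> (\<integral>x. g x \<bullet> k x \<partial>lebesgue)"
    using r by (simp add: zero_le_mult_iff)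
qed

theorem c_hat_not_attained:
  assumes u: "u \<in> Mset V0 f"
  shows "Jfun V0 f u \<noteq> c_hat V0 f"
proof
  assume attained: "Jfun V0 f u = c_hat V0 f"
  from u obtain g where H1_grad: "H1_with_grad u g" and nehari: "on_nehari (pos_part u)" "on_nehari (neg_part u)"
    by (auto simp: Mset_iff)
  let ?w = "pos_part u" and ?g = "\<lambda>x. if 0 < u x then g x else 0"
  note p = H1_pos_part[OF H1_grad]
  obtain w g' where r: "w \<in> borel_measurable borel" "g' \<in> borel_measurable borel" "AE x in lebesgue. ?w x = w x"
      "minimizes_dilation_energy w g'" "dilation_energy w g' = dilation_energy ?w ?g"
    using minimizes_dilation_energy_borel_representative[OF pos_part_minimizes_dilation_energy[OF H1_grad nehari attained]] .
  have "0 < dilation_energy w g'"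
    using on_nehari_Jfun_pos[OF p nehari(1)] by (simp add: r(5) on_nehari_Jfun_eq[OF p nehari(1)])
  from supersolution_nonzero_AE[OF minimizer_supersolution[OF r(4) this] r(1,2)
      nonzero_of_zero_order_deriv_neg[OF minimizes_dilation_energyD(3)[OF r(4)]]]
  have "AE x in lebesgue. w x \<noteq> 0" by (rule AE_completion)
  with r(3) have "AE x in lebesgue. neg_part u x = 0"
    by eventually_elim (auto simp: pos_part_def neg_part_def)
  then show False using nehari(2) by (simp add: on_nehari_def nonzero_def)
qed

end

lemma C1_differentiable_on_UNIV_imp_lipschitz:
  fixes f :: "real \<Rightarrow> real"
  assumes "f C1_differentiable_on UNIV"
  obtains C where "0 \<le> C" "\<forall>s\<in>{a..b}. \<forall>t\<in>{a..b}. \<bar>f s - f t\<bar> \<le> C * \<bar>s - t\<bar>"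
proof -
  obtain D where D: "\<And>x. (f has_real_derivative D x) (at x)" "continuous_on UNIV D"
    using assms unfolding C1_differentiable_on_def by (auto simp: has_real_derivative_iff_has_vector_derivative)
  have "compact (D ` {a..b})" by (intro compact_continuous_image continuous_on_subset[OF D(2)]) auto
  then obtain C where C: "0 < C" "\<And>x. x \<in> {a..b} \<Longrightarrow> norm (D x) \<le> C"
    using compact_imp_bounded bounded_pos by (metis imageI)
  have "\<bar>f s - f t\<bar> \<le> C * \<bar>s - t\<bar>" if "s \<in> {a..b}" "t \<in> {a..b}" for s t
    using field_differentiable_bound[of "{a..b}" f D C s t] that C(2) has_field_derivative_at_within[OF D(1)] by simp
  with that[of C] C(1) show ?thesis by simp
qed

theorem theorem1p2:
  fixes V0 \<theta> p Cp :: real and f :: "real \<Rightarrow> real"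
  assumes V0: "V0 > 0"
    and C1: "f C1_differentiable_on UNIV"
    and f1: "\<exists>C>0. \<forall>s. \<bar>f s\<bar> \<le> C * exp (4 * pi * s\<^sup>2)"
    and f2: "((\<lambda>s. f s / s) \<longlongrightarrow> 0) (at 0)"
    and f3: "\<theta> > 2" "\<forall>s. s \<noteq> 0 \<longrightarrow> 0 < \<theta> * Fprim f s \<and> \<theta> * Fprim f s \<le> s * f s"
    and f4: "strict_mono_on {0<..} (\<lambda>s. f s / \<bar>s\<bar>)"
    and f5: "p > 2" "Cp > 0" "\<forall>s. s \<noteq> 0 \<longrightarrow> sgn s * f s \<ge> Cp * \<bar>s\<bar> powr (p - 1)"
    and Cp_bound: "Cp > (chi_p V0 p * (2 * \<theta> / (\<theta> - 2))) powr ((p - 2) / 2)"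
  shows "(\<nexists>u. least_energy_nodal_solution V0 f u) \<and>
         (\<nexists>u. u \<in> Mset V0 f \<and> Jfun V0 f u = c_hat V0 f)"
proof -
  obtain C where C: "0 \<le> C" "\<forall>s\<in>{0..2}. \<forall>t\<in>{0..2}. \<bar>f s - f t\<bar> \<le> C * \<bar>s - t\<bar>"
    using C1_differentiable_on_UNIV_imp_lipschitz[OF C1] .
  interpret ambrosetti_rabinowitz_lipschitz V0 \<theta> f C
  proof
    show "\<bar>f a - f b\<bar> \<le> C * (a - b)" if "0 \<le> b" "b \<le> a" "a \<le> 2" for a b
      using C(2)[rule_format, of a b] that by simp
  qed (use V0 f3 C(1) C1_differentiable_imp_continuous_on[OF C1] in auto)
  show ?thesis using c_hat_not_attained by (auto simp: least_energy_nodal_solution_def)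
qed

end
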